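(* Let $(A,\mu,\alpha,\beta)$ be a bihom-associative algebra over a field $\mathbb{K}$ of characteristic zero. Then its Hochschild cochain complex $C^\bullet_{\mathrm{Hoch}}(A,A)=\bigoplus_{n\ge1}C^n_{\mathrm{Hoch}}(A,A)$, with the braces $\{\,\}\{\,,\dots,\,\}$, the product $\cup_{\alpha,\beta}$ and the differential $d_{\alpha,\beta}$ described in the context, carries a homotopy $G$-algebra structure. Hence the Hochschild cohomology $H^\bullet_{\mathrm{Hoch}}(A,A)$ inherits a Gerstenhaber algebra structure, with product induced by $\cup_{\alpha,\beta}$ and bracket induced by $[f,g]=f\circ g-(-1)^{|f||g|}g\circ f$, where $f\circ g=\{f\}\{g\}$.
   Context: A bihom-associative algebra $(A,\mu,\alpha,\beta)$ is a vector space $A$ with a bilinear map $\mu:A\times A\to A$ and two commuting linear maps $\alpha,\beta:A\to A$ such that $\alpha(\mu(a,b))=\mu(\alpha(a),\alpha(b))$, $\beta(\mu(a,b))=\mu(\beta(a),\beta(b))$ and $\mu(\alpha(a),\mu(b,c))=\mu(\mu(a,b),\beta(c))$ for all $a,b,c\in A$. For $n\ge1$, $C^n_{\mathrm{Hoch}}(A,A)$ is the space of linear maps $f:A^{\otimes n}\to A$ with $\alpha\circ f=f\circ\alpha^{\otimes n}$ and $\beta\circ f=f\circ\beta^{\otimes n}$. The Hochschild coboundary is $$(\delta_{\mathrm{Hoch}}f)(a_1,\dots,a_{n+1})=\mu(\alpha^{n-1}(a_1),f(a_2,\dots,a_{n+1}))+\sum_{i=1}^n(-1)^if(\alpha(a_1),\dots,\alpha(a_{i-1}),\mu(a_i,a_{i+1}),\beta(a_{i+2}),\dots,\beta(a_{n+1}))+(-1)^{n+1}\mu(f(a_1,\dots,a_n),\beta^{n-1}(a_{n+1})),$$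 and $H^\bullet_{\mathrm{Hoch}}(A,A)$ is the cohomology of $(C^\bullet_{\mathrm{Hoch}}(A,A),\delta_{\mathrm{Hoch}})$. Throughout, for an element $x$ of degree $n$ in a graded vector space, $|x|=n-1$. Operations on $C^\bullet_{\mathrm{Hoch}}(A,A)$. For $f\in C^k_{\mathrm{Hoch}}(A,A)$ and $g_i\in C^{n_i}_{\mathrm{Hoch}}(A,A)$, $\gamma(f;g_1,\dots,g_k)\in C^{n_1+\dots+n_k}_{\mathrm{Hoch}}(A,A)$ is obtained by inserting in the $i$-th argument of $f$ the element $\alpha^{\sum_{l>i}|g_l|}\beta^{\sum_{l<i}|g_l|}g_i(a_{n_1+\dots+n_{i-1}+1},\dots,a_{n_1+\dots+n_i})$, $i=1,\dots,k$. Braces: $\{f\}\{g_1,\dots,g_n\}=\sum(-1)^{\epsilon}\gamma(f;\mathrm{id},\dots,\mathrm{id},g_1,\mathrm{id},\dots,\mathrm{id},g_n,\mathrm{id},\dots,\mathrm{id})$, the sum over all substitutions of $g_1,\dots,g_n$ into $f$ in the given order, with $\epsilon=\sum_p|g_p|i_p$, $i_p$ being the total number of inputs in front of $g_p$; $\{f\}\{\}=f$, and the brace is $0$ if $n$ exceeds the arity of $f$. Product: for $f$ of degree $m$ and $g$ of degree $n$, $f\cup_{\alpha,\beta}g=(-1)^{|f|+1}\{\mu\}\{f,g\}$, that is, $(f\cup_{\alpha,\beta}g)(a_1,\dots,a_{m+n})=(-1)^{mn}\mu(f(\alpha^{n-1}a_1,\dots,\alpha^{n-1}a_m),g(\beta^{m-1}a_{m+1},\dots,\beta^{m-1}a_{m+n}))$.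 Differential: $d_{\alpha,\beta}f=\mu\circ f-(-1)^{|f|}f\circ\mu$; it equals $\delta_{\mathrm{Hoch}}f$ up to a sign depending only on the degree of $f$, so it has the same cohomology as $\delta_{\mathrm{Hoch}}$. Homotopy $G$-algebra (Gerstenhaber–Voronov): a graded vector space $V=\bigoplus_n V^n$ with multilinear braces $\{x\}\{x_1,\dots,x_n\}$ ($n\ge0$, $\{x\}\{\}=x$) satisfying $|\{x\}\{x_1,\dots,x_n\}|=|x|+\sum|x_i|$, a product $\cdot$ of degree $0$ and a differential $d$ of degree $1$, such that $(V,\cdot,d)$ is a differential graded associative algebra ($d(x\cdot y)=dx\cdot y+(-1)^{|x|+1}x\cdot dy$) and the following hold for homogeneous elements: (i) $\{\{x\}\{x_1,\dots,x_m\}\}\{y_1,\dots,y_n\}=\sum_{0\le i_1\le j_1\le i_2\le\dots\le i_m\le j_m\le n}(-1)^{\epsilon}\{x\}\{y_1,\dots,y_{i_1},\{x_1\}\{y_{i_1+1},\dots,y_{j_1}\},y_{j_1+1},\dots,y_{i_m},\{x_m\}\{y_{i_m+1},\dots,y_{j_m}\},y_{j_m+1},\dots,y_n\}$, with $\epsilon=\sum_{p=1}^m|x_p|\sum_{q=1}^{i_p}|y_q|$; (ii) $\{x_1\cdot x_2\}\{y_1,\dots,y_n\}=\sum_{k=0}^n(-1)^{(|x_2|+1)\sum_{p\le k}|y_p|}\{x_1\}\{y_1,\dots,y_k\}\cdot\{x_2\}\{y_{k+1},\dots,y_n\}$; (iii) for $N\ge1$, $d(\{x\}\{x_1,\dots,x_N\})-\{dx\}\{x_1,\dots,x_N\}-(-1)^{|x|}\sum_{i=1}^N(-1)^{|x_1|+\dots+|x_{i-1}|}\{x\}\{x_1,\dots,dx_i,\dots,x_N\}=(-1)^{(|x|+1)|x_1|}x_1\cdot\{x\}\{x_2,\dots,x_N\}-(-1)^{|x|}\sum_{i=1}^{N-1}(-1)^{|x_1|+\dots+|x_i|}\{x\}\{x_1,\dots,x_i\cdot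 x_{i+1},\dots,x_N\}+(-1)^{|x|+|x_1|+\dots+|x_{N-1}|}\{x\}\{x_1,\dots,x_{N-1}\}\cdot x_N$. Gerstenhaber algebra: a graded commutative associative algebra $(\mathcal{A}=\bigoplus\mathcal{A}^i,\cdot)$ (so $a\cdot b=(-1)^{ij}b\cdot a$ for $a\in\mathcal{A}^i$, $b\in\mathcal{A}^j$) with a degree $-1$ bracket $[-,-]$ which is a graded Lie bracket with respect to $|\cdot|$ (that is, $[a,b]=-(-1)^{|a||b|}[b,a]$ and $[a,[b,c]]=[[a,b],c]+(-1)^{|a||b|}[b,[a,c]]$) and satisfies $[a,b\cdot c]=[a,b]\cdot c+(-1)^{|a|(|b|+1)}b\cdot[a,c]$. *)

theory Defs
  imports "HOL-Algebra.AbelCoset" "HOL-Algebra.Algebraic_Closure_Type"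
begin

section \<open>Graded vector spaces and algebraic structures on them\<close>

text \<open>
  Vector spaces that may occur as quotients are given by carriers, as modules over a field in the
  sense of \<^locale>\<open>module\<close>; the multiplication and unit fields of the module record are not used.
  The sign $(-1)^k$ acts on a module without reference to scalars.
\<close>

definition signed :: "('k, 'v, 'm) module_scheme \<Rightarrow> int \<Rightarrow> 'v \<Rightarrow> 'v" where
  "signed M k x = (if even k then x else \<ominus>\<^bsub>M\<^esub> x)"

definition linear_on :: "('k, 'r) ring_scheme \<Rightarrow> ('k, 'v, 'm) module_scheme \<Rightarrow> ('v \<Rightarrow> 'v) \<Rightarrow> bool" where
  "linear_on K M f \<longleftrightarrow>
     f \<in> carrier M \<rightarrow> carrier M \<and>
     (\<forall>x\<in>carrier M. \<forall>y\<in>carrier M. f (x \<oplus>\<^bsub>M\<^esub> y) = f x \<oplus>\<^bsub>M\<^esub> f y) \<and>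
     (\<forall>c\<in>carrier K. \<forall>x\<in>carrier M. f (c \<odot>\<^bsub>M\<^esub> x) = c \<odot>\<^bsub>M\<^esub> f x)"

definition bilinear_on ::
    "('k, 'r) ring_scheme \<Rightarrow> ('k, 'v, 'm) module_scheme \<Rightarrow> ('v \<Rightarrow> 'v \<Rightarrow> 'v) \<Rightarrow> bool" where
  "bilinear_on K M p \<longleftrightarrow>
     (\<forall>x\<in>carrier M. linear_on K M (\<lambda>y. p x y)) \<and> (\<forall>y\<in>carrier M. linear_on K M (\<lambda>x. p x y))"

locale graded_vector_space = module K M + field K
  for K :: "('k, 'r) ring_scheme" (structure) and M :: "('k, 'v, 'm) module_scheme" (structure) +
  fixes V :: "int \<Rightarrow> 'v set"
  assumes graded_submodule: "submodule (V i) K M"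
    and direct_sum: "x \<in> carrier M \<Longrightarrow>
      \<exists>!c. (\<forall>i. c i \<in> V i) \<and> finite {i. c i \<noteq> \<zero>\<^bsub>M\<^esub>} \<and> x = (\<Oplus>\<^bsub>M\<^esub>i\<in>{i. c i \<noteq> \<zero>\<^bsub>M\<^esub>}. c i)"

text \<open>
  Signs are governed by the shifted degree $|x| = n - 1$ of an element $x$ of degree $n$:
  \<open>x \<in> shifted V a\<close> means $|x| = a$, and \<open>shifted_list V as xs\<close> says that \<open>as\<close> is the list of
  the numbers $|x_i|$.
\<close>

definition shifted :: "(int \<Rightarrow> 'v set) \<Rightarrow> int \<Rightarrow> 'v set" where
  "shifted V a = V (a + 1)"

definition shifted_list :: "(int \<Rightarrow> 'v set) \<Rightarrow> int list \<Rightarrow> 'v list \<Rightarrow> bool" where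
  "shifted_list V as xs \<longleftrightarrow> list_all2 (\<lambda>a x. x \<in> shifted V a) as xs"

definition slice :: "nat \<Rightarrow> nat \<Rightarrow> 'v list \<Rightarrow> 'v list" where
  "slice i j xs = take (j - i) (drop i xs)"

text \<open>
  The sequences $0 \le i_1 \le j_1 \le i_2 \le \dots \le i_m \le j_m \le n$, as pairs of lists
  $(i_1,\dots,i_m)$ and $(j_1,\dots,j_m)$; and the list
  $y_1,\dots,y_{i_1},\{x_1\}\{y_{i_1+1},\dots,y_{j_1}\},y_{j_1+1},\dots,
   \{x_m\}\{y_{i_m+1},\dots,y_{j_m}\},y_{j_m+1},\dots,y_n$ they determine.
\<close>

definition brace_indices :: "nat \<Rightarrow> nat \<Rightarrow> (nat list \<times> nat list) set" where
  "brace_indices m n = {(is, js). length is = m \<and> length js = m \<and>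
     (\<forall>p<m. is ! p \<le> js ! p \<and> js ! p \<le> n) \<and> (\<forall>p. Suc p < m \<longrightarrow> js ! p \<le> is ! Suc p)}"

definition brace_args ::
    "('v \<Rightarrow> 'v list \<Rightarrow> 'v) \<Rightarrow> 'v list \<Rightarrow> 'v list \<Rightarrow> nat list \<Rightarrow> nat list \<Rightarrow> 'v list" where
  "brace_args brace xs ys is js =
     concat (map (\<lambda>p. slice ((0 # js) ! p) (is ! p) ys @ [brace (xs ! p) (slice (is ! p) (js ! p) ys)])
       [0..<length xs]) @ drop (last (0 # js)) ys"

locale homotopy_G_algebra = graded_vector_space K M V
  for K :: "('k, 'r) ring_scheme" (structure) and M :: "('k, 'v, 'm) module_scheme" (structure)
    and V :: "int \<Rightarrow> 'v set" +
  fixes brace :: "'v \<Rightarrow> 'v list \<Rightarrow> 'v"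
    and prd :: "'v \<Rightarrow> 'v \<Rightarrow> 'v" (infixl \<open>\<star>\<close> 70)
    and d :: "'v \<Rightarrow> 'v"
  assumes brace_multilinear_head: "set xs \<subseteq> carrier M \<Longrightarrow> linear_on K M (\<lambda>x. brace x xs)"
    and brace_multilinear_arg: "\<lbrakk>x \<in> carrier M; set xs \<subseteq> carrier M; i < length xs\<rbrakk> \<Longrightarrow>
      linear_on K M (\<lambda>y. brace x (xs[i := y]))"
    and brace_Nil: "x \<in> carrier M \<Longrightarrow> brace x [] = x"
    and brace_degree: "\<lbrakk>x \<in> shifted V a; shifted_list V as xs\<rbrakk> \<Longrightarrow>
      brace x xs \<in> shifted V (a + sum_list as)"
    and prd_bilinear: "bilinear_on K M prd"
    and prd_degree: "\<lbrakk>x \<in> V i; y \<in> V j\<rbrakk> \<Longrightarrow> x \<star> y \<in> V (i + j)"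
    and prd_assoc: "\<lbrakk>x \<in> carrier M; y \<in> carrier M; z \<in> carrier M\<rbrakk> \<Longrightarrow> (x \<star> y) \<star> z = x \<star> (y \<star> z)"
    and d_linear: "linear_on K M d"
    and d_degree: "x \<in> V i \<Longrightarrow> d x \<in> V (i + 1)"
    and d_d: "x \<in> carrier M \<Longrightarrow> d (d x) = \<zero>\<^bsub>M\<^esub>"
    and d_derivation: "\<lbrakk>x \<in> shifted V a; y \<in> shifted V b\<rbrakk> \<Longrightarrow>
      d (x \<star> y) = d x \<star> y \<oplus>\<^bsub>M\<^esub> signed M (a + 1) (x \<star> d y)"
    and brace_brace: "\<lbrakk>x \<in> shifted V a; shifted_list V as xs; shifted_list V bs ys\<rbrakk> \<Longrightarrow>
      brace (brace x xs) ys =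
        finsum M (\<lambda>(is, js).
           signed M (\<Sum>p<length xs. as ! p * (\<Sum>q<is ! p. bs ! q))
             (brace x (brace_args brace xs ys is js)))
          (brace_indices (length xs) (length ys))"
    and brace_prd: "\<lbrakk>x1 \<in> shifted V a1; x2 \<in> shifted V a2; shifted_list V bs ys\<rbrakk> \<Longrightarrow>
      brace (x1 \<star> x2) ys =
        (\<Oplus>\<^bsub>M\<^esub>k\<in>{0..length ys}. signed M ((a2 + 1) * (\<Sum>p<k. bs ! p))
           (brace x1 (take k ys) \<star> brace x2 (drop k ys)))"
    and d_brace: "\<lbrakk>x \<in> shifted V a; shifted_list V as xs; N = length xs; N \<ge> 1\<rbrakk> \<Longrightarrow>
      d (brace x xs) \<ominus>\<^bsub>M\<^esub> brace (d x) xs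
        \<ominus>\<^bsub>M\<^esub> signed M a (\<Oplus>\<^bsub>M\<^esub>i\<in>{0..<N}. signed M (\<Sum>p<i. as ! p) (brace x (xs[i := d (xs ! i)])))
      = signed M ((a + 1) * as ! 0) (xs ! 0 \<star> brace x (tl xs))
        \<ominus>\<^bsub>M\<^esub> signed M a (\<Oplus>\<^bsub>M\<^esub>i\<in>{0..<N - 1}. signed M (\<Sum>p\<le>i. as ! p)
             (brace x (take i xs @ [xs ! i \<star> xs ! Suc i] @ drop (i + 2) xs)))
        \<oplus>\<^bsub>M\<^esub> signed M (a + (\<Sum>p<N - 1. as ! p)) (brace x (butlast xs) \<star> last xs)"

locale gerstenhaber_algebra = graded_vector_space K M V
  for K :: "('k, 'r) ring_scheme" (structure) and M :: "('k, 'v, 'm) module_scheme" (structure)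
    and V :: "int \<Rightarrow> 'v set" +
  fixes prd :: "'v \<Rightarrow> 'v \<Rightarrow> 'v" (infixl \<open>\<star>\<close> 70)
    and brk :: "'v \<Rightarrow> 'v \<Rightarrow> 'v"
  assumes prd_bilinear: "bilinear_on K M prd"
    and prd_degree: "\<lbrakk>x \<in> V i; y \<in> V j\<rbrakk> \<Longrightarrow> x \<star> y \<in> V (i + j)"
    and prd_assoc: "\<lbrakk>x \<in> carrier M; y \<in> carrier M; z \<in> carrier M\<rbrakk> \<Longrightarrow> (x \<star> y) \<star> z = x \<star> (y \<star> z)"
    and prd_comm: "\<lbrakk>x \<in> V i; y \<in> V j\<rbrakk> \<Longrightarrow> x \<star> y = signed M (i * j) (y \<star> x)"
    and brk_bilinear: "bilinear_on K M brk"
    and brk_degree: "\<lbrakk>x \<in> V i; y \<in> V j\<rbrakk> \<Longrightarrow> brk x y \<in> V (i + j - 1)"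
    and brk_skew: "\<lbrakk>x \<in> shifted V a; y \<in> shifted V b\<rbrakk> \<Longrightarrow> brk x y = \<ominus>\<^bsub>M\<^esub> signed M (a * b) (brk y x)"
    and brk_jacobi: "\<lbrakk>x \<in> shifted V a; y \<in> shifted V b; z \<in> shifted V c\<rbrakk> \<Longrightarrow>
      brk x (brk y z) = brk (brk x y) z \<oplus>\<^bsub>M\<^esub> signed M (a * b) (brk y (brk x z))"
    and brk_leibniz: "\<lbrakk>x \<in> shifted V a; y \<in> shifted V b; z \<in> shifted V c\<rbrakk> \<Longrightarrow>
      brk x (y \<star> z) = brk x y \<star> z \<oplus>\<^bsub>M\<^esub> signed M (a * (b + 1)) (y \<star> brk x z)"

section \<open>Cohomology of a graded vector space with a differential\<close>

definition cocycles :: "('k, 'v, 'm) module_scheme \<Rightarrow> ('v \<Rightarrow> 'v) \<Rightarrow> 'v set" where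
  "cocycles M d = {x \<in> carrier M. d x = \<zero>\<^bsub>M\<^esub>}"

definition cohomology_class :: "('k, 'v, 'm) module_scheme \<Rightarrow> ('v \<Rightarrow> 'v) \<Rightarrow> 'v \<Rightarrow> 'v set" where
  "cohomology_class M d x = (d ` carrier M) +>\<^bsub>M\<^esub> x"

definition cohomology :: "('k, 'v, 'm) module_scheme \<Rightarrow> ('v \<Rightarrow> 'v) \<Rightarrow> ('k, 'v set) module" where
  "cohomology M d =
     \<lparr>carrier = cohomology_class M d ` cocycles M d,
      monoid.mult = undefined, one = undefined,
      ring.zero = d ` carrier M,
      add = set_add M,
      module.smult = (\<lambda>c S. \<Union>x\<in>S. cohomology_class M d (c \<odot>\<^bsub>M\<^esub> x))\<rparr>"

definition cohomology_grading ::
    "('k, 'v, 'm) module_scheme \<Rightarrow> (int \<Rightarrow> 'v set) \<Rightarrow> ('v \<Rightarrow> 'v) \<Rightarrow> int \<Rightarrow> 'v set set" where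
  "cohomology_grading M V d i = cohomology_class M d ` (cocycles M d \<inter> V i)"

section \<open>Bihom-associative algebras and their Hochschild complex\<close>

locale bihom_associative_algebra = vector_space scale
  for scale :: "'k::field \<Rightarrow> 'a::ab_group_add \<Rightarrow> 'a" +
  fixes \<mu> :: "'a \<Rightarrow> 'a \<Rightarrow> 'a" and \<alpha> \<beta> :: "'a \<Rightarrow> 'a"
  assumes mu_linear_right: "Vector_Spaces.linear scale scale (\<lambda>b. \<mu> a b)"
    and mu_linear_left: "Vector_Spaces.linear scale scale (\<lambda>a. \<mu> a b)"
    and alpha_linear: "Vector_Spaces.linear scale scale \<alpha>"
    and beta_linear: "Vector_Spaces.linear scale scale \<beta>"
    and alpha_beta_commute: "\<alpha> (\<beta> a) = \<beta> (\<alpha> a)"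
    and alpha_mu: "\<alpha> (\<mu> a b) = \<mu> (\<alpha> a) (\<alpha> b)"
    and beta_mu: "\<beta> (\<mu> a b) = \<mu> (\<beta> a) (\<beta> b)"
    and bihom_assoc: "\<mu> (\<alpha> a) (\<mu> b c) = \<mu> (\<mu> a b) (\<beta> c)"

text \<open>
  A linear map $A^{\otimes n} \to A$ is represented by the corresponding multilinear map, as a
  function on lists that is zero on all lists of length different from $n$.  An element of the
  direct sum $\bigoplus_{n\ge1} C^n$ is then a single function on lists, whose $n$-th component
  is its restriction to lists of length $n$.
\<close>

type_synonym 'a cochain = "'a list \<Rightarrow> 'a"

definition cochains ::
    "('k::field \<Rightarrow> 'a::ab_group_add \<Rightarrow> 'a) \<Rightarrow> ('a \<Rightarrow> 'a) \<Rightarrow> ('a \<Rightarrow> 'a) \<Rightarrow> nat \<Rightarrow> 'a cochain set" where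
  "cochains scale \<alpha> \<beta> n = {f.
     (\<forall>xs. length xs \<noteq> n \<longrightarrow> f xs = 0) \<and>
     (\<forall>xs i. length xs = n \<and> i < n \<longrightarrow> Vector_Spaces.linear scale scale (\<lambda>x. f (xs[i := x]))) \<and>
     (\<forall>xs. length xs = n \<longrightarrow> \<alpha> (f xs) = f (map \<alpha> xs)) \<and>
     (\<forall>xs. length xs = n \<longrightarrow> \<beta> (f xs) = f (map \<beta> xs))}"

definition component :: "nat \<Rightarrow> 'a::zero cochain \<Rightarrow> 'a cochain" where
  "component n f = (\<lambda>xs. if length xs = n then f xs else 0)"

definition arity_set :: "'a::zero cochain \<Rightarrow> nat set" where
  "arity_set f = {n. \<exists>xs. length xs = n \<and> f xs \<noteq> 0}"

definition hoch_degree ::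
    "('k::field \<Rightarrow> 'a::ab_group_add \<Rightarrow> 'a) \<Rightarrow> ('a \<Rightarrow> 'a) \<Rightarrow> ('a \<Rightarrow> 'a) \<Rightarrow> int \<Rightarrow> 'a cochain set" where
  "hoch_degree scale \<alpha> \<beta> i = (if i \<ge> 1 then cochains scale \<alpha> \<beta> (nat i) else {\<lambda>_. 0})"

subsection \<open>Braces\<close>

text \<open>
  Homogeneous cochains are paired with their arity.  In \<open>gamma\<close> the exponent $|g_l|$ is
  \<open>fst (gs ! l) - 1\<close>, which involves no truncation since every arity is positive.
\<close>

definition gamma ::
    "('a \<Rightarrow> 'a) \<Rightarrow> ('a \<Rightarrow> 'a) \<Rightarrow> 'a::zero cochain \<Rightarrow> (nat \<times> 'a cochain) list \<Rightarrow> 'a cochain" where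
  "gamma \<alpha> \<beta> f gs = (\<lambda>xs.
     if length xs = (\<Sum>l<length gs. fst (gs ! l)) then
       f (map (\<lambda>i.
           (\<alpha> ^^ (\<Sum>l\<in>{i<..<length gs}. fst (gs ! l) - 1))
           ((\<beta> ^^ (\<Sum>l<i. fst (gs ! l) - 1))
             (snd (gs ! i) (slice (\<Sum>l<i. fst (gs ! l)) (\<Sum>l\<le>i. fst (gs ! l)) xs))))
         [0..<length gs])
     else 0)"

definition id_cochain :: "'a::zero cochain" where
  "id_cochain xs = (if length xs = 1 then hd xs else 0)"

text \<open>
  A substitution of $g_1,\dots,g_n$ into $f$ (of arity $k$) in the given order is determined by the
  set \<open>S\<close> of the argument positions of $f$ that receive one of the $g_p$.
\<close>

definition substitution :: "nat \<Rightarrow> (nat \<times> 'a::zero cochain) list \<Rightarrow> nat set \<Rightarrow> (nat \<times> 'a cochain) list" where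
  "substitution k gs S =
     map (\<lambda>j. if j \<in> S then gs ! card {s \<in> S. s < j} else (1, id_cochain)) [0..<k]"

definition substitution_sign :: "nat \<Rightarrow> (nat \<times> 'a::zero cochain) list \<Rightarrow> nat set \<Rightarrow> nat" where
  "substitution_sign k gs S =
     (let hs = substitution k gs S in \<Sum>j\<in>S. (fst (hs ! j) - 1) * (\<Sum>l<j. fst (hs ! l)))"

definition homogeneous_brace ::
    "('k::field \<Rightarrow> 'a::ab_group_add \<Rightarrow> 'a) \<Rightarrow> ('a \<Rightarrow> 'a) \<Rightarrow> ('a \<Rightarrow> 'a) \<Rightarrow>
     nat \<times> 'a cochain \<Rightarrow> (nat \<times> 'a cochain) list \<Rightarrow> 'a cochain" where
  "homogeneous_brace scale \<alpha> \<beta> f gs = (\<lambda>xs.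
     \<Sum>S | S \<subseteq> {..<fst f} \<and> card S = length gs.
       scale ((-1) ^ substitution_sign (fst f) gs S)
         (gamma \<alpha> \<beta> (snd f) (substitution (fst f) gs S) xs))"

text \<open>Multilinear extension to the direct sum: all arguments are split into their components.\<close>

definition hoch_brace ::
    "('k::field \<Rightarrow> 'a::ab_group_add \<Rightarrow> 'a) \<Rightarrow> ('a \<Rightarrow> 'a) \<Rightarrow> ('a \<Rightarrow> 'a) \<Rightarrow>
     'a cochain \<Rightarrow> 'a cochain list \<Rightarrow> 'a cochain" where
  "hoch_brace scale \<alpha> \<beta> f gs = (\<lambda>xs.
     \<Sum>k\<in>arity_set f. \<Sum>ns\<in>listset (map arity_set gs).
       homogeneous_brace scale \<alpha> \<beta> (k, component k f)
         (map2 (\<lambda>n g. (n, component n g)) ns gs) xs)"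

subsection \<open>Product and differentials\<close>

definition mult_cochain :: "('a \<Rightarrow> 'a \<Rightarrow> 'a) \<Rightarrow> 'a::zero cochain" where
  "mult_cochain \<mu> xs = (if length xs = 2 then \<mu> (xs ! 0) (xs ! 1) else 0)"

text \<open>On the component of arity \<open>m\<close> the sign $(-1)^{|f|+1}$ is $(-1)^m$.\<close>

definition hoch_cup ::
    "('k::field \<Rightarrow> 'a::ab_group_add \<Rightarrow> 'a) \<Rightarrow> ('a \<Rightarrow> 'a \<Rightarrow> 'a) \<Rightarrow> ('a \<Rightarrow> 'a) \<Rightarrow> ('a \<Rightarrow> 'a) \<Rightarrow>
     'a cochain \<Rightarrow> 'a cochain \<Rightarrow> 'a cochain" where
  "hoch_cup scale \<mu> \<alpha> \<beta> f g = (\<lambda>xs. \<Sum>m\<in>arity_set f.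
     scale ((-1) ^ m) (hoch_brace scale \<alpha> \<beta> (mult_cochain \<mu>) [component m f, g] xs))"

definition hoch_d ::
    "('k::field \<Rightarrow> 'a::ab_group_add \<Rightarrow> 'a) \<Rightarrow> ('a \<Rightarrow> 'a \<Rightarrow> 'a) \<Rightarrow> ('a \<Rightarrow> 'a) \<Rightarrow> ('a \<Rightarrow> 'a) \<Rightarrow>
     'a cochain \<Rightarrow> 'a cochain" where
  "hoch_d scale \<mu> \<alpha> \<beta> f = (\<lambda>xs. \<Sum>m\<in>arity_set f.
     hoch_brace scale \<alpha> \<beta> (mult_cochain \<mu>) [component m f] xs
     - scale ((-1) ^ (m - 1)) (hoch_brace scale \<alpha> \<beta> (component m f) [mult_cochain \<mu>] xs))"

text \<open>
  The Hochschild coboundary.  Its value on $n+1$ arguments only involves the component of arity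
  $n$, so the formula makes sense on the direct sum.  List positions are counted from zero:
  $a_i$ is \<open>xs ! (i - 1)\<close>.
\<close>

definition hoch_delta ::
    "('k::field \<Rightarrow> 'a::ab_group_add \<Rightarrow> 'a) \<Rightarrow> ('a \<Rightarrow> 'a \<Rightarrow> 'a) \<Rightarrow> ('a \<Rightarrow> 'a) \<Rightarrow> ('a \<Rightarrow> 'a) \<Rightarrow>
     'a cochain \<Rightarrow> 'a cochain" where
  "hoch_delta scale \<mu> \<alpha> \<beta> f = (\<lambda>xs.
     if length xs < 2 then 0
     else let n = length xs - 1 in
       \<mu> ((\<alpha> ^^ (n - 1)) (hd xs)) (f (tl xs))
       + (\<Sum>i=1..n. scale ((-1) ^ i)
           (f (map \<alpha> (take (i - 1) xs) @ [\<mu> (xs ! (i - 1)) (xs ! i)] @ map \<beta> (drop (i + 1) xs))))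
       + scale ((-1) ^ (n + 1)) (\<mu> (f (butlast xs)) ((\<beta> ^^ (n - 1)) (last xs))))"

subsection \<open>The complex and its cohomology\<close>

definition hoch_complex ::
    "('k::field \<Rightarrow> 'a::ab_group_add \<Rightarrow> 'a) \<Rightarrow> ('a \<Rightarrow> 'a) \<Rightarrow> ('a \<Rightarrow> 'a) \<Rightarrow> ('k, 'a cochain) module" where
  "hoch_complex scale \<alpha> \<beta> =
     \<lparr>carrier = {f. f [] = 0 \<and> finite (arity_set f) \<and> (\<forall>n\<ge>1. component n f \<in> cochains scale \<alpha> \<beta> n)},
      monoid.mult = undefined, one = undefined,
      ring.zero = (\<lambda>xs. 0),
      add = (\<lambda>f g xs. f xs + g xs),
      module.smult = (\<lambda>c f xs. scale c (f xs))\<rparr>"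

abbreviation hoch_cocycles where
  "hoch_cocycles scale \<mu> \<alpha> \<beta> \<equiv> cocycles (hoch_complex scale \<alpha> \<beta>) (hoch_delta scale \<mu> \<alpha> \<beta>)"

abbreviation hoch_class where
  "hoch_class scale \<mu> \<alpha> \<beta> \<equiv> cohomology_class (hoch_complex scale \<alpha> \<beta>) (hoch_delta scale \<mu> \<alpha> \<beta>)"

abbreviation hoch_cohomology where
  "hoch_cohomology scale \<mu> \<alpha> \<beta> \<equiv> cohomology (hoch_complex scale \<alpha> \<beta>) (hoch_delta scale \<mu> \<alpha> \<beta>)"

abbreviation hoch_cohomology_degree where
  "hoch_cohomology_degree scale \<mu> \<alpha> \<beta> \<equiv>
     cohomology_grading (hoch_complex scale \<alpha> \<beta>) (hoch_degree scale \<alpha> \<beta>) (hoch_delta scale \<mu> \<alpha> \<beta>)"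

text \<open>The bracket $[f,g] = \{f\}\{g\} - (-1)^{|f||g|}\{g\}\{f\}$ of cochains with $|f| = a$, $|g| = b$.\<close>

definition hoch_bracket ::
    "('k::field \<Rightarrow> 'a::ab_group_add \<Rightarrow> 'a) \<Rightarrow> ('a \<Rightarrow> 'a) \<Rightarrow> ('a \<Rightarrow> 'a) \<Rightarrow> int \<Rightarrow> int \<Rightarrow>
     'a cochain \<Rightarrow> 'a cochain \<Rightarrow> 'a cochain" where
  "hoch_bracket scale \<alpha> \<beta> a b f g =
     (let M = hoch_complex scale \<alpha> \<beta> in
      hoch_brace scale \<alpha> \<beta> f [g] \<ominus>\<^bsub>M\<^esub> signed M (a * b) (hoch_brace scale \<alpha> \<beta> g [f]))"

end

theory Submission
  imports Defs "HOL-Library.Function_Algebras"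
begin

text \<open>
  Every sign and every twist in the braces can be absorbed into a single bookkeeping device.  A
  cochain $g$ with shifted degree $|g| = e$ is treated as a block \<open>(e, g)\<close>.  When a block is
  inserted into a list of arguments, every argument in front of it is hit by $(-\alpha)^e$ and every
  argument behind it by $\beta^e$.  Replacing $\alpha$ by $\tau = -\alpha$ makes all Koszul signs
  of the braces disappear: an argument that passes a cochain of shifted degree $e$ picks up
  $(-1)^e$, which is exactly the sign of $\tau^e$.  So $\{f\}\{g_1,\dots,g_n\}$ evaluated on a
  list is the plain, sign-free sum \<open>ins G f as\<close> of the values of $f$ on all lists that arise from
  \<open>as\<close> by inserting $g_1,\dots,g_n$ in this order (\<open>hoch_brace_eq_ins\<close>).

  The operator \<open>ins G\<close> acts on arbitrary functions on lists, so formal sums of tensors are never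
  needed.  It behaves like the action of the tensor coalgebra of cochains on the tensor coalgebra of
  arguments: it is compatible with deconcatenation (\<open>ins_cuts\<close>), and inserting $Y, z, W$ in a row
  means choosing the place of $z$ and inserting $Y$ in front of and $W$ behind it
  (\<open>ins_node\<close>).  These two facts give the brace relation (\<open>ins_ins\<close>) by
  induction: inserting $Y$ and then $H$ is the same as inserting the sum of all lists obtained by
  distributing $Y$ between and into the members of $H$.  The only signs left come from moving
  $\tau$ through the members of $Y$.

  Bihom-associativity says exactly that $\{m\}\{m\} = 0$ for the multiplication cochain $m$
  (\<open>m_m_zero\<close>).  Product and differential are $\pm\{m\}\{f,g\}$ and
  $\{m\}\{f\} \mp \{f\}\{m\}$, so all remaining axioms of a homotopy $G$-algebra are instances of
  the brace relation in which one of the cochains is $m$: since $m$ takes two arguments, a brace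
  $\{m\}\{\dots\}$ with more than two entries vanishes and only few terms survive
  (\<open>ins_block_cup\<close>, \<open>block_d_ins\<close>, \<open>block_cup_assoc\<close>, \<open>block_d_block_d\<close>, \<open>block_d_block_cup\<close>).

  On cohomology, the homotopy formula \<open>block_d_ins\<close> with one brace entry makes the product graded
  commutative (\<open>cup_comm\<close>) and the differential a derivation of the bracket (\<open>block_d_block_bracket\<close>); with two
  entries it makes the bracket a derivation of the product up to a boundary (\<open>block_bracket_leibniz\<close>).  The
  Jacobi identity holds on cochains and follows from the brace relation with one entry
  (\<open>block_bracket_jacobi\<close>).  The coboundary \<open>hoch_delta\<close> differs from \<open>hoch_d\<close> by a sign depending on
  the arity, hence has the same cocycles and the same boundaries (\<open>delta_dh_cohomology\<close>).
\<close>

section \<open>Splittings of lists and signs\<close>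

text \<open>
  Sum of $F$ over all ways of splitting a list into two consecutive parts.  Summing over splittings
  instead of index intervals makes coassociativity available as a rewrite rule.
\<close>

fun cuts :: "'b list \<Rightarrow> ('b list \<Rightarrow> 'b list \<Rightarrow> 'c::comm_monoid_add) \<Rightarrow> 'c" where
  "cuts [] F = F [] []"
| "cuts (x # xs) F = F [] (x # xs) + cuts xs (\<lambda>p q. F (x # p) q)"

lemma cuts_cong:
  assumes "\<And>p q. p @ q = xs \<Longrightarrow> F p q = G p q"
  shows "cuts xs F = cuts xs G"
  using assms
proof (induction xs arbitrary: F G)
  case (Cons x xs)
  have "cuts xs (\<lambda>p q. F (x # p) q) = cuts xs (\<lambda>p q. G (x # p) q)"
  proof (rule Cons.IH)
    fix p q assume "p @ q = xs"
    then show "F (x # p) q = G (x # p) q" by (intro Cons.prems) simp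
  qed
  moreover have "F [] (x # xs) = G [] (x # xs)" by (rule Cons.prems) simp
  ultimately show ?case by (simp only: cuts.simps)
next
  case Nil
  show ?case by (simp only: cuts.simps Nil append_Nil)
qed

lemma cuts_add: "cuts xs (\<lambda>p q. F p q + G p q) = cuts xs F + cuts xs G"
  by (induction xs arbitrary: F G) (auto simp: ac_simps)

lemma cuts_zero [simp]: "cuts xs (\<lambda>p q. 0) = 0"
  by (induction xs) auto

text \<open>
  A splitting sum is never empty, so additivity alone lets a map pass through it.
\<close>

lemma additive_cuts:
  assumes "\<And>x y. h (x + y) = h x + h y"
  shows "h (cuts xs F) = cuts xs (\<lambda>p q. h (F p q))"
  by (induction xs arbitrary: F) (auto simp: assms)

text \<open>
  The form used for operators \<open>Op\<close> that bind a variable, such as \<open>ins G\<close> applied to a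
  function of the inserted list.
\<close>

lemma operator_cuts:
  assumes "\<And>f g. Op (\<lambda>m. f m + g m) = Op f + Op g"
  shows "Op (\<lambda>m. cuts xs (F m)) = cuts xs (\<lambda>p q. Op (\<lambda>m. F m p q))"
  by (induction xs arbitrary: F) (auto simp: assms)

lemma cuts_swap:
  "cuts xs (\<lambda>p q. cuts ys (\<lambda>r s. F p q r s)) = cuts ys (\<lambda>r s. cuts xs (\<lambda>p q. F p q r s))"
  by (induction xs arbitrary: F) (auto simp: cuts_add)

text \<open>
  Coassociativity of deconcatenation: both sides range over the splittings into three parts.
\<close>

lemma cuts_assoc:
  "cuts xs (\<lambda>p r. cuts r (\<lambda>q s. F p q s)) = cuts xs (\<lambda>r s. cuts r (\<lambda>p q. F p q s))"
proof (induction xs arbitrary: F)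
  case (Cons x xs)
  show ?case
    by (simp add: Cons.IH cuts_add add.assoc)
qed simp

text \<open>
  A cut of a list with a marked entry falls either in front of that entry or behind it.
\<close>

lemma cuts_append_node:
  "cuts (P @ z # L) F = cuts P (\<lambda>p1 p2. F p1 (p2 @ z # L)) + cuts L (\<lambda>l1 l2. F (P @ z # l1) l2)"
  by (induction P arbitrary: F) (auto simp: add.assoc)

lemma cuts_map: "cuts (map h xs) F = cuts xs (\<lambda>p q. F (map h p) (map h q))"
  by (induction xs arbitrary: F) auto

lemma cuts_eq_sum: "cuts xs F = (\<Sum>i\<le>length xs. F (take i xs) (drop i xs))"
proof (induction xs arbitrary: F)
  case (Cons x xs)
  show ?case
    by (simp add: Cons.IH sum.atMost_Suc_shift del: sum.atMost_Suc)
qed simp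

text \<open>
  The sign $(-1)^k$ on an abelian group, with a natural exponent.  Almost every sign identity
  below is settled by a case distinction on parities.
\<close>

definition sg :: "nat \<Rightarrow> 'b::ab_group_add \<Rightarrow> 'b" where
  "sg k x = (if even k then x else - x)"

lemma sg_add: "sg k (x + y) = sg k x + sg k y"
  by (simp add: sg_def)

lemma sg_zero [simp]: "sg k 0 = 0" "sg 0 x = x"
  by (simp_all add: sg_def)

lemma sg_sg: "sg k (sg l x) = sg (k + l) x"
  by (simp add: sg_def)

lemma sg_uminus: "sg k (- x) = - sg k x"
  by (simp add: sg_def)

text \<open>
  A block \<open>(e, g)\<close> carries its shifted degree $e = |g|$, because the zero cochain has no
  degree of its own; \<open>weight\<close> is $|g_1| + \dots + |g_n|$.
\<close>

definition weight :: "(nat \<times> 'b) list \<Rightarrow> nat" where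
  "weight G = sum_list (map fst G)"

lemma weight_simps [simp]: "weight [] = 0" "weight (x # G) = fst x + weight G" "weight (G @ H) = weight G + weight H"
  by (simp_all add: weight_def)

text \<open>
  Formulated for lists of every length at once: a function that is multilinear on lists of one fixed
  length, extended by zero, satisfies it.
\<close>

definition multiadditive :: "('b::ab_group_add list \<Rightarrow> 'c::ab_group_add) \<Rightarrow> bool" where
  "multiadditive \<phi> \<longleftrightarrow> (\<forall>p x y q. \<phi> (p @ (x + y) # q) = \<phi> (p @ x # q) + \<phi> (p @ y # q))"

lemma additive_minus:
  fixes h :: "'b::ab_group_add \<Rightarrow> 'c::ab_group_add"
  assumes "\<And>x y. h (x + y) = h x + h y"
  shows "h (- x) = - h x" "h 0 = 0" "h (x - y) = h x - h y" "h (sg k x) = sg k (h x)"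
proof -
  interpret additive h by (standard, rule assms)
  show "h (- x) = - h x" "h 0 = 0" "h (x - y) = h x - h y" "h (sg k x) = sg k (h x)"
    by (simp_all add: minus zero diff sg_def)
qed

lemma multiadditive_slot: "multiadditive \<phi> \<Longrightarrow> \<phi> (p @ (x + y) # q) = \<phi> (p @ x # q) + \<phi> (p @ y # q)"
  by (simp add: multiadditive_def)

lemma multiadditive_sg: "multiadditive \<phi> \<Longrightarrow> \<phi> (p @ sg k x # q) = sg k (\<phi> (p @ x # q))"
  by (rule additive_minus(4)[where h = "\<lambda>x. \<phi> (p @ x # q)"]) (rule multiadditive_slot)

lemma multiadditive_shift:
  assumes "multiadditive \<phi>"
  shows "multiadditive (\<lambda>L. \<phi> (p @ L))" and "multiadditive (\<lambda>L. \<phi> (z # L))" and "multiadditive (\<lambda>L. \<phi> (L @ p))"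
proof -
  show "multiadditive (\<lambda>L. \<phi> (p @ L))"
    using assms unfolding multiadditive_def by (metis append.assoc)
  show "multiadditive (\<lambda>L. \<phi> (z # L))"
    using assms unfolding multiadditive_def by (metis append_Cons)
  show "multiadditive (\<lambda>L. \<phi> (L @ p))"
    using assms unfolding multiadditive_def by simp
qed

section \<open>Insertion of cochains into lists of arguments\<close>

locale twisted_insertion =
  fixes \<tau> \<beta> :: "'a::ab_group_add \<Rightarrow> 'a"
  assumes tau_beta: "\<tau> (\<beta> x) = \<beta> (\<tau> x)"
    and tau_add: "\<tau> (x + y) = \<tau> x + \<tau> y"
begin

abbreviation T :: "nat \<Rightarrow> 'a list \<Rightarrow> 'a list" where "T k \<equiv> map (\<tau> ^^ k)"
abbreviation B :: "nat \<Rightarrow> 'a list \<Rightarrow> 'a list" where "B k \<equiv> map (\<beta> ^^ k)"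

lemma tau_pow_beta_pow: "(\<tau> ^^ k) ((\<beta> ^^ l) x) = (\<beta> ^^ l) ((\<tau> ^^ k) x)"
proof (induction k arbitrary: x)
  case (Suc k)
  have "\<tau> ((\<beta> ^^ l) y) = (\<beta> ^^ l) (\<tau> y)" for y
    by (induction l) (simp_all add: tau_beta)
  then show ?case by (simp add: Suc)
qed simp

lemma TB: "T k (B l xs) = B l (T k xs)"
  by (simp add: tau_pow_beta_pow)

lemma TT: "T k (T l xs) = T (k + l) xs"
  by (simp add: funpow_add)

lemma BB: "B k (B l xs) = B (k + l) xs"
  by (simp add: funpow_add)

text \<open>
  \<open>ins G \<phi> as\<close> is the sum of $\varphi$ over all lists that arise from \<open>as\<close> by replacing
  disjoint consecutive pieces, from left to right, by their values under the blocks of \<open>G\<close>.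
  The first block splits \<open>as\<close> into $p\,q\,s$ and consumes $q$.  The part $p$ lies in front of all
  blocks, $q$ in front of all but the first, and $s$ behind the first one; this determines their
  twists.  The $\beta$-twists due to several blocks accumulate through the recursion.  Pieces of the
  wrong length contribute zero as soon as the blocks vanish on them.
\<close>

fun ins :: "(nat \<times> ('a list \<Rightarrow> 'a)) list \<Rightarrow> ('a list \<Rightarrow> 'b::ab_group_add) \<Rightarrow> 'a list \<Rightarrow> 'b" where
  "ins [] \<phi> as = \<phi> as"
| "ins (x # G) \<phi> as = cuts as (\<lambda>p r. cuts r (\<lambda>q s.
     ins G (\<lambda>L. \<phi> (T (fst x + weight G) p @ snd x (T (weight G) q) # L)) (B (fst x) s)))"

lemma ins_Nil [simp]: "ins [] \<phi> = \<phi>"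
  by (rule ext) (simp add: ins.simps)

text \<open>
  Stated as an equation between functions so that it also applies when the argument list is
  eta-contracted away.
\<close>

lemma ins_Cons:
  "ins (x # G) \<phi> = (\<lambda>as. cuts as (\<lambda>p r. cuts r (\<lambda>q s.
     ins G (\<lambda>L. \<phi> (T (fst x + weight G) p @ snd x (T (weight G) q) # L)) (B (fst x) s))))"
  by (rule ext) (simp add: ins.simps)

declare ins.simps [simp del] ins_Cons [simp]

lemma ins_add: "ins G (\<lambda>L. \<phi> L + \<psi> L) as = ins G \<phi> as + ins G \<psi> as"
  by (induction G arbitrary: \<phi> \<psi> as) (simp_all add: cuts_add)

text \<open>
  \<open>ins G\<close> is a finite sum of evaluations, hence commutes with every additive operator.  Instances
  are the exchange of two insertions and of an insertion with a splitting sum.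
\<close>

lemma operator_ins:
  assumes "\<And>f g. Op (\<lambda>m. f m + g m) = Op f + Op g"
  shows "Op (\<lambda>m. ins G (F m) as) = ins G (\<lambda>L. Op (\<lambda>m. F m L)) as"
  by (induction G arbitrary: F as) (simp_all add: operator_cuts[of Op, OF assms])

lemma additive_ins:
  assumes "\<And>x y. h (x + y) = h x + h y"
  shows "h (ins G f as) = ins G (\<lambda>L. h (f L)) as"
  using operator_ins[of "\<lambda>f. h (f ())" G "\<lambda>_. f" as] by (simp add: assms)

lemma ins_cuts_swap:
  "ins G (\<lambda>L. cuts xs (\<lambda>p q. F L p q)) as = cuts xs (\<lambda>p q. ins G (\<lambda>L. F L p q) as)"
  by (rule operator_cuts[of "\<lambda>f. ins G f as"]) (rule ins_add)

lemma ins_sg: "ins G (\<lambda>L. sg k (\<phi> L)) as = sg k (ins G \<phi> as)"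
  by (rule additive_ins[symmetric]) (rule sg_add)

lemma multiadditive_ins:
  assumes "\<And>M. multiadditive (\<lambda>L. F L M)"
  shows "multiadditive (\<lambda>L. ins G (F L) as)"
  unfolding multiadditive_def
proof (intro allI)
  fix p x y q
  have "(\<lambda>M. F (p @ (x + y) # q) M) = (\<lambda>M. F (p @ x # q) M + F (p @ y # q) M)"
    using assms by (simp add: multiadditive_def)
  then show "ins G (F (p @ (x + y) # q)) as = ins G (F (p @ x # q)) as + ins G (F (p @ y # q)) as"
    by (simp add: ins_add)
qed

lemma ins_zero [simp]: "ins G (\<lambda>L. 0) as = 0"
  by (induction G arbitrary: as) simp_all

text \<open>
  Compatibility with deconcatenation: cutting the list after an insertion amounts to cutting both
  the list of blocks and the list of arguments.  The twists on the right record that the blocks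
  of \<open>H2\<close> lie behind \<open>a1\<close> and those of \<open>H1\<close> in front of \<open>a2\<close>.  In the induction, a cut
  of the new list lies in front of the value of the first block or behind it, which corresponds to
  \<open>H1 = []\<close> or to a nonempty \<open>H1\<close>.
\<close>

lemma ins_cuts:
  "ins H (\<lambda>L. cuts L \<Psi>) as =
     cuts H (\<lambda>H1 H2. cuts as (\<lambda>a1 a2.
       ins H1 (\<lambda>L1. ins H2 (\<lambda>L2. \<Psi> L1 L2) (B (weight H1) a2)) (T (weight H2) a1)))"
proof (induction H arbitrary: \<Psi> as)
  case Nil
  show ?case by simp
next
  case (Cons x G)
  let ?e = "fst x" and ?g = "snd x"
  define P where "P p = T (?e + weight G) p" for p
  define z where "z q = ?g (T (weight G) q)" for q
  have lhs: "ins (x # G) (\<lambda>L. cuts L \<Psi>) as =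
     cuts as (\<lambda>p r. cuts r (\<lambda>q s. ins G (\<lambda>L. cuts (P p) (\<lambda>p1 p2. \<Psi> p1 (p2 @ z q # L))) (B ?e s)))
     + cuts as (\<lambda>p r. cuts r (\<lambda>q s. ins G (\<lambda>L. cuts L (\<lambda>l1 l2. \<Psi> (P p @ z q # l1) l2)) (B ?e s)))"
    by (simp add: cuts_append_node ins_add cuts_add P_def z_def)
  have left: "cuts as (\<lambda>p r. cuts r (\<lambda>q s. ins G (\<lambda>L. cuts (P p) (\<lambda>p1 p2. \<Psi> p1 (p2 @ z q # L))) (B ?e s)))
     = cuts as (\<lambda>a1 a2. ins (x # G) (\<lambda>L2. \<Psi> (T (weight (x # G)) a1) L2) a2)"
    (is "?l = ?r")
  proof -
    have "?l = cuts as (\<lambda>p r. cuts r (\<lambda>q s. cuts p (\<lambda>p1 p2. ins G (\<lambda>L. \<Psi> (P p1) (P p2 @ z q # L)) (B ?e s))))"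
      by (simp add: ins_cuts_swap P_def cuts_map)
    also have "\<dots> = cuts as (\<lambda>p r. cuts p (\<lambda>p1 p2. cuts r (\<lambda>q s. ins G (\<lambda>L. \<Psi> (P p1) (P p2 @ z q # L)) (B ?e s))))"
      by (subst cuts_swap) simp
    also have "\<dots> = ?r"
      by (subst cuts_assoc[symmetric]) (simp add: P_def z_def)
    finally show ?thesis .
  qed
  have right: "cuts as (\<lambda>p r. cuts r (\<lambda>q s. ins G (\<lambda>L. cuts L (\<lambda>l1 l2. \<Psi> (P p @ z q # l1) l2)) (B ?e s)))
     = cuts G (\<lambda>G1 G2. cuts as (\<lambda>a1 a2. ins (x # G1) (\<lambda>L1. ins G2 (\<lambda>L2. \<Psi> L1 L2) (B (weight (x # G1)) a2)) (T (weight G2) a1)))"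
    (is "?l = ?r")
  proof -
    have "?l = cuts as (\<lambda>p r. cuts r (\<lambda>q s. cuts G (\<lambda>G1 G2. cuts s (\<lambda>s1 s2.
       ins G1 (\<lambda>L1. ins G2 (\<lambda>L2. \<Psi> (P p @ z q # L1) L2) (B (weight G1) (B ?e s2))) (T (weight G2) (B ?e s1))))))"
      by (simp add: Cons.IH cuts_map del: map_map)
    also have "\<dots> = cuts G (\<lambda>G1 G2. cuts as (\<lambda>p r. cuts r (\<lambda>q s. cuts s (\<lambda>s1 s2.
       ins G1 (\<lambda>L1. ins G2 (\<lambda>L2. \<Psi> (P p @ z q # L1) L2) (B (weight G1) (B ?e s2))) (T (weight G2) (B ?e s1))))))"
      by (subst (2) cuts_swap, subst cuts_swap) simp
    also have "\<dots> = cuts G (\<lambda>G1 G2. cuts as (\<lambda>a1 a2. cuts a1 (\<lambda>p r. cuts r (\<lambda>q s1.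
       ins G1 (\<lambda>L1. ins G2 (\<lambda>L2. \<Psi> (P p @ z q # L1) L2) (B (weight G1) (B ?e a2))) (T (weight G2) (B ?e s1))))))"
      by (simp add: cuts_assoc del: map_map)
    also have "\<dots> = ?r"
    proof (rule cuts_cong, rule cuts_cong)
      fix G1 G2 a1 a2 assume "G1 @ G2 = G"
      then have weight: "weight G = weight G1 + weight G2" by auto
      show "cuts a1 (\<lambda>p r. cuts r (\<lambda>q s1.
           ins G1 (\<lambda>L1. ins G2 (\<lambda>L2. \<Psi> (P p @ z q # L1) L2) (B (weight G1) (B ?e a2))) (T (weight G2) (B ?e s1))))
         = ins (x # G1) (\<lambda>L1. ins G2 (\<lambda>L2. \<Psi> L1 L2) (B (weight (x # G1)) a2)) (T (weight G2) a1)"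
        by (simp add: cuts_map P_def z_def TT TB BB weight ac_simps del: map_map)
    qed
    finally show ?thesis .
  qed
  show ?case
    unfolding lhs left right cuts.simps(2) ins_Nil weight_simps(1) funpow.simps(1) list.map_id id_apply by (rule refl)
qed

text \<open>
  The place \<open>a2\<close> consumed by a chosen block \<open>z\<close> separates the insertion of the blocks in
  front of it from the insertion of those behind it.
\<close>

lemma ins_node:
  "ins (Y @ z # W) \<phi> as = cuts as (\<lambda>a1 r. cuts r (\<lambda>a2 a3.
     ins Y (\<lambda>L1. ins W (\<lambda>L3. \<phi> (L1 @ snd z (T (weight W) (B (weight Y) a2)) # L3)) (B (fst z + weight Y) a3))
       (T (fst z + weight W) a1)))"
proof (induction Y arbitrary: \<phi> as)
  case Nil
  show ?case by simp
next
  case (Cons y Y)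
  let ?e = "fst y" and ?g = "snd y"
  let ?k = "fst z + weight W"
  define P where "P p = T (?e + weight Y + ?k) p" for p
  define v where "v q = ?g (T (weight Y + ?k) q)" for q
  define H where "H p q s1 s2 s3 =
     ins Y (\<lambda>L1. ins W (\<lambda>L3. \<phi> (P p @ v q # L1 @ snd z (T (weight W) (B (weight Y) (B ?e s2))) # L3))
       (B (fst z + weight Y) (B ?e s3))) (T ?k (B ?e s1))" for p q s1 s2 s3
  have "ins ((y # Y) @ z # W) \<phi> as =
     cuts as (\<lambda>p r. cuts r (\<lambda>q s. cuts s (\<lambda>s1 t. cuts t (\<lambda>s2 s3. H p q s1 s2 s3))))"
    by (simp add: Cons.IH H_def P_def v_def cuts_map ac_simps del: map_map)
  also have "\<dots> = cuts as (\<lambda>a1 t. cuts t (\<lambda>s2 s3. cuts a1 (\<lambda>p r. cuts r (\<lambda>q s1. H p q s1 s2 s3))))"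
  proof -
    define C where "C p q s1 t = cuts t (\<lambda>s2 s3. H p q s1 s2 s3)" for p q s1 t
    have "cuts as (\<lambda>p r. cuts r (\<lambda>q s. cuts s (\<lambda>s1 t. C p q s1 t)))
        = cuts as (\<lambda>a1 t. cuts a1 (\<lambda>p r. cuts r (\<lambda>q s1. C p q s1 t)))"
      by (simp only: cuts_assoc)
    moreover have "cuts a1 (\<lambda>p r. cuts r (\<lambda>q s1. C p q s1 t))
        = cuts t (\<lambda>s2 s3. cuts a1 (\<lambda>p r. cuts r (\<lambda>q s1. H p q s1 s2 s3)))" for a1 t
      unfolding C_def by (subst cuts_swap, subst (2) cuts_swap, rule refl)
    ultimately show ?thesis by (simp only: C_def)
  qed
  also have "\<dots> = cuts as (\<lambda>a1 r. cuts r (\<lambda>a2 a3.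
     ins (y # Y) (\<lambda>L1. ins W (\<lambda>L3. \<phi> (L1 @ snd z (T (weight W) (B (weight (y # Y)) a2)) # L3)) (B (fst z + weight (y # Y)) a3))
       (T (fst z + weight W) a1)))"
    by (simp add: H_def cuts_map P_def v_def TT TB BB ac_simps del: map_map)
  finally show ?case .
qed

text \<open>
  Equivariance with respect to $\beta$ is strict, but $\tau = -\alpha$ passes a multilinear map of
  $e+1$ arguments only up to the sign $(-1)^e$.
\<close>

definition block :: "nat \<times> ('a list \<Rightarrow> 'a) \<Rightarrow> bool" where
  "block x \<longleftrightarrow> multiadditive (snd x) \<and> (\<forall>as. length as \<noteq> Suc (fst x) \<longrightarrow> snd x as = 0) \<and>
     (\<forall>as. snd x (map \<tau> as) = sg (fst x) (\<tau> (snd x as))) \<and>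
     (\<forall>as. snd x (map \<beta> as) = \<beta> (snd x as))"

lemma tau_sg: "\<tau> (sg k x) = sg k (\<tau> x)"
  by (rule additive_minus(4)) (rule tau_add)

lemma block_T:
  assumes "block x"
  shows "snd x (T k as) = sg (k * fst x) ((\<tau> ^^ k) (snd x as))"
proof (induction k arbitrary: as)
  case (Suc k)
  have "T (Suc k) as = map \<tau> (T k as)" by simp
  then have "snd x (T (Suc k) as) = sg (fst x) (\<tau> (snd x (T k as)))"
    using assms unfolding block_def by metis
  then show ?case by (simp add: Suc tau_sg sg_sg comp_def)
qed simp

lemma block_B:
  assumes "block x"
  shows "snd x (B k as) = (\<beta> ^^ k) (snd x as)"
proof (induction k arbitrary: as)
  case (Suc k)
  have "B (Suc k) as = map \<beta> (B k as)" by simp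
  then have "snd x (B (Suc k) as) = \<beta> (snd x (B k as))"
    using assms unfolding block_def by metis
  then show ?case by (simp add: Suc comp_def)
qed simp

text \<open>
  Moving $\tau^k$ past all blocks of \<open>G\<close> is the sole source of signs in the brace relation.
\<close>

lemma ins_T:
  assumes "\<And>y. y \<in> set G \<Longrightarrow> block y" and "multiadditive \<phi>"
  shows "ins G \<phi> (T k as) = sg (k * weight G) (ins G (\<lambda>L. \<phi> (T k L)) as)"
  using assms
proof (induction G arbitrary: \<phi> as)
  case (Cons x G)
  have IH: "ins G (\<lambda>L. \<phi> (p @ v # L)) (T k s) = sg (k * weight G) (ins G (\<lambda>L. \<phi> (p @ v # T k L)) s)" for p v s
  proof -
    have "multiadditive (\<lambda>L. \<phi> ((p @ [v]) @ L))"
      by (rule multiadditive_shift) (rule Cons.prems)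
    then show ?thesis using Cons.IH[of "\<lambda>L. \<phi> ((p @ [v]) @ L)"] Cons.prems(1) by simp
  qed
  have "block x" using Cons.prems by simp
  note bT = block_T[OF this]
  have comm: "snd x (T l (T k q)) = sg (k * fst x) ((\<tau> ^^ k) (snd x (T l q)))" for l q
    by (metis TT add.commute bT)
  have "ins (x # G) \<phi> (T k as) = cuts as (\<lambda>p r. cuts r (\<lambda>q s.
     ins G (\<lambda>L. \<phi> (T (fst x + weight G) (T k p) @ snd x (T (weight G) (T k q)) # L)) (T k (B (fst x) s))))"
    by (simp add: cuts_map TB del: map_map)
  also have "\<dots> = cuts as (\<lambda>p r. cuts r (\<lambda>q s. sg (k * weight (x # G))
     (ins G (\<lambda>L. \<phi> (T k (T (fst x + weight G) p @ snd x (T (weight G) q) # L))) (B (fst x) s))))"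
    unfolding IH comm multiadditive_sg[OF Cons.prems(2)] ins_sg
    by (simp add: sg_sg TT ac_simps algebra_simps del: map_map)
  also have "\<dots> = sg (k * weight (x # G)) (ins (x # G) (\<lambda>L. \<phi> (T k L)) as)"
    by (simp only: ins_Cons additive_cuts[of "sg _", OF sg_add])
  finally show ?case .
qed simp

lemma ins_map:
  fixes \<phi> :: "'a list \<Rightarrow> 'b::ab_group_add"
  assumes "\<And>y as. y \<in> set G \<Longrightarrow> snd y (map h as) = h (snd y as)"
    and tau: "\<And>k x. (\<tau> ^^ k) (h x) = h ((\<tau> ^^ k) x)" and beta: "\<And>k x. (\<beta> ^^ k) (h x) = h ((\<beta> ^^ k) x)"
  shows "ins G \<phi> (map h as) = ins G (\<lambda>L. \<phi> (map h L)) as"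
  using assms(1)
proof (induction G arbitrary: \<phi> as)
  case (Cons x G)
  have T: "T k (map h q) = map h (T k q)" and B: "B k (map h q) = map h (B k q)" for k q
    by (simp_all add: tau beta)
  have x: "snd x (map h q) = h (snd x q)" for q
    using Cons.prems by simp
  have IH: "ins G \<psi> (map h s) = ins G (\<lambda>L. \<psi> (map h L)) s" for \<psi> :: "'a list \<Rightarrow> 'b" and s
    using Cons by simp
  show ?case
    unfolding ins_Cons cuts_map T B x IH by (simp only: map_append list.map)
qed simp

lemma ins_B:
  assumes "\<And>y. y \<in> set G \<Longrightarrow> block y"
  shows "ins G \<phi> (B k as) = ins G (\<lambda>L. \<phi> (B k L)) as"
proof (rule ins_map)
  show "snd y (B k as) = (\<beta> ^^ k) (snd y as)" if "y \<in> set G" for y as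
    using block_B assms that by blast
  show "(\<beta> ^^ l) ((\<beta> ^^ k) x) = (\<beta> ^^ k) ((\<beta> ^^ l) x)" for l x
    by (simp add: funpow_add[symmetric, THEN fun_cong, simplified] add.commute)
qed (rule tau_pow_beta_pow)

definition block_brace :: "nat \<times> ('a list \<Rightarrow> 'a) \<Rightarrow> (nat \<times> ('a list \<Rightarrow> 'a)) list \<Rightarrow> nat \<times> ('a list \<Rightarrow> 'a)" where
  "block_brace x Y = (fst x + weight Y, ins Y (snd x))"

text \<open>
  The right-hand side of the brace relation, as a sum over the lists
  $Y_1, \{x_1\}\{Y_2\}, Y_3, \{x_2\}\{Y_4\}, \dots$ built from a splitting of \<open>Y\<close>.  Applied to
  \<open>x # H\<close>, the blocks \<open>Y1\<close> are passed by \<open>x\<close> and by all of \<open>H\<close>, the blocks \<open>Y2\<close> only by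
  \<open>H\<close>; this gives the exponent.
\<close>

fun brace_sum :: "(nat \<times> ('a list \<Rightarrow> 'a)) list \<Rightarrow> (nat \<times> ('a list \<Rightarrow> 'a)) list \<Rightarrow>
    ((nat \<times> ('a list \<Rightarrow> 'a)) list \<Rightarrow> 'b::ab_group_add) \<Rightarrow> 'b" where
  "brace_sum [] Y \<Phi> = \<Phi> Y"
| "brace_sum (x # H) Y \<Phi> = cuts Y (\<lambda>Y1 R. cuts R (\<lambda>Y2 Y3. brace_sum H Y3 (\<lambda>W.
     sg (fst x * weight Y1 + weight H * (weight Y1 + weight Y2)) (\<Phi> (Y1 @ block_brace x Y2 # W)))))"

lemma brace_sum_cong:
  assumes "\<And>W :: (nat \<times> ('a list \<Rightarrow> 'a)) list. weight W = weight H + weight Y \<Longrightarrow> \<Phi> W = \<Psi> W"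
  shows "brace_sum H Y \<Phi> = brace_sum H Y \<Psi>"
  using assms
proof (induction H arbitrary: Y \<Phi> \<Psi>)
  case (Cons x H)
  show ?case
  proof (simp, rule cuts_cong, rule cuts_cong, rule Cons.IH)
    fix Y1 R Y2 Y3 and W :: "(nat \<times> ('a list \<Rightarrow> 'a)) list"
    assume *: "Y1 @ R = Y" "Y2 @ Y3 = R" "weight W = weight H + weight Y3"
    have "weight (Y1 @ block_brace x Y2 # W) = weight (x # H) + weight Y"
      using * by (auto simp: block_brace_def)
    then have "\<Phi> (Y1 @ block_brace x Y2 # W) = \<Psi> (Y1 @ block_brace x Y2 # W)"
      by (rule Cons.prems)
    then show "sg (fst x * weight Y1 + weight H * (weight Y1 + weight Y2)) (\<Phi> (Y1 @ block_brace x Y2 # W))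
      = sg (fst x * weight Y1 + weight H * (weight Y1 + weight Y2)) (\<Psi> (Y1 @ block_brace x Y2 # W))" by simp
  qed
qed simp

text \<open>
  Additivity of $\mathit{Op}$ forces it to commute with negation.
\<close>

lemma operator_sg:
  assumes "\<And>f g. Op (\<lambda>m. f m + g m) = Op f + Op g"
  shows "Op (\<lambda>m. sg k (f m)) = sg k (Op f)"
proof -
  have "Op (\<lambda>m. 0 + 0) = Op (\<lambda>m. 0) + Op (\<lambda>m. 0)" by (rule assms)
  then have "Op (\<lambda>m. 0) = 0" by simp
  moreover have "Op (\<lambda>m. f m + - f m) = Op f + Op (\<lambda>m. - f m)" by (rule assms)
  ultimately have "Op f + Op (\<lambda>m. - f m) = 0" by (simp only: add.right_inverse)
  then have "Op (\<lambda>m. - f m) = - Op f" by (simp only: add_eq_0_iff)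
  then show ?thesis by (simp add: sg_def)
qed

lemma operator_brace_sum:
  assumes "\<And>f g. Op (\<lambda>m. f m + g m) = Op f + Op g"
  shows "Op (\<lambda>m. brace_sum H Y (F m)) = brace_sum H Y (\<lambda>W. Op (\<lambda>m. F m W))"
  by (induction H arbitrary: Y F)
    (simp_all add: operator_cuts[of Op, OF assms] operator_sg[of Op, OF assms])

text \<open>
  The brace relation.  By \<open>ins_cuts\<close>, cutting the list obtained from inserting \<open>Y\<close> at the
  place of the first block \<open>x\<close> of \<open>H\<close> cuts \<open>Y\<close> into three parts \<open>Y1\<close>, \<open>Y2\<close>, \<open>Y3\<close>:
  the part \<open>Y2\<close> is inserted into the arguments of \<open>x\<close> and yields \<open>block_brace x Y2\<close>, the other
  two are inserted around it.  On the right, \<open>ins_node\<close> isolates \<open>block_brace x Y2\<close>.  After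
  the twists are moved through \<open>Y1\<close> and \<open>Y2\<close> with \<open>ins_T\<close>, which produces the sign
  \<open>s\<close>, the two sides differ by the induction hypothesis for \<open>Y3\<close>.
\<close>

theorem ins_ins:
  assumes "\<And>y. y \<in> set Y \<Longrightarrow> block y" and "\<And>x. x \<in> set H \<Longrightarrow> multiadditive (snd x)" and "multiadditive \<phi>"
  shows "ins Y (ins H \<phi>) as = brace_sum H Y (\<lambda>W. ins W \<phi> as)"
  using assms
proof (induction H arbitrary: Y \<phi> as)
  case (Cons x H)
  let ?e = "fst x"
  define k where "k = ?e + weight H"
  define K where "K L1 v L3 = ins H (\<lambda>M. \<phi> (L1 @ v # M)) L3" for L1 v L3
  have multi: "multiadditive (\<lambda>M. \<phi> (L1 @ v # M))" for L1 v
    using multiadditive_shift(1)[OF Cons.prems(3), of "L1 @ [v]"] by simp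
  have multi1: "multiadditive (\<lambda>L1. K L1 v L3)" for v L3
    unfolding K_def by (rule multiadditive_ins) (rule multiadditive_shift(3)[OF Cons.prems(3)])
  have K_add: "K L1 (v + w) L3 = K L1 v L3 + K L1 w L3" for L1 v w L3
    unfolding K_def by (simp add: ins_add[symmetric] multiadditive_slot[OF Cons.prems(3)])
  have xm: "multiadditive (snd x)" using Cons.prems by simp
  define l where "l Y1 Y2 Y3 a1 a2 a3 =
    ins Y1 (\<lambda>L1. ins Y2 (\<lambda>L2. ins Y3 (\<lambda>L3. K (T k L1) (snd x (T (weight H) L2)) (B ?e L3))
      (B (weight Y2) (B (weight Y1) a3))) (T (weight Y3) (B (weight Y1) a2))) (T (weight Y2 + weight Y3) a1)"
    for Y1 Y2 Y3 a1 a2 a3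
  define r where "r Y1 Y2 Y3 a1 a2 a3 =
    ins Y1 (\<lambda>L1. ins Y3 (K L1 (ins Y2 (snd x) (T (weight H + weight Y3) (B (weight Y1) a2))))
      (B (?e + weight Y2 + weight Y1) a3)) (T (k + weight Y2 + weight Y3) a1)"
    for Y1 Y2 Y3 a1 a2 a3
  define s where "s Y1 Y2 = ?e * weight Y1 + weight H * (weight Y1 + weight Y2)"
    for Y1 Y2 :: "(nat \<times> ('a list \<Rightarrow> 'a)) list"
  \<comment> \<open>\<open>l\<close> and \<open>r\<close> are the contributions of one splitting to the two sides\<close>
  have lr: "l Y1 Y2 Y3 a1 a2 a3 = sg (s Y1 Y2) (r Y1 Y2 Y3 a1 a2 a3)"
    if Y: "Y = Y1 @ Y2 @ Y3" for Y1 Y2 Y3 a1 a2 a3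
  proof -
    have b: "\<And>y. y \<in> set Y1 \<Longrightarrow> block y" "\<And>y. y \<in> set Y2 \<Longrightarrow> block y" "\<And>y. y \<in> set Y3 \<Longrightarrow> block y"
      using Cons.prems(1) Y by auto
    define J where "J L1 v = ins Y3 (K L1 v) (B (?e + weight Y2 + weight Y1) a3)" for L1 v
    have J_add: "J L1 (v + w) = J L1 v + J L1 w" for L1 v w
    proof -
      have "K L1 (v + w) = (\<lambda>L. K L1 v L + K L1 w L)" by (rule ext) (rule K_add)
      then show ?thesis unfolding J_def by (simp add: ins_add)
    qed
    have mJ: "multiadditive (\<lambda>L1. J L1 v)" for v
      unfolding J_def by (rule multiadditive_ins) (rule multi1)
    have "l Y1 Y2 Y3 a1 a2 a3 =
      ins Y1 (\<lambda>L1. ins Y2 (\<lambda>L2. J (T k L1) (snd x (T (weight H) L2))) (T (weight Y3) (B (weight Y1) a2))) (T (weight Y2 + weight Y3) a1)"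
      unfolding l_def J_def by (simp add: ins_B[OF b(3), symmetric] BB ac_simps del: map_map)
    also have "\<dots> = ins Y1 (\<lambda>L1. J (T k L1) (ins Y2 (\<lambda>L2. snd x (T (weight H) L2)) (T (weight Y3) (B (weight Y1) a2)))) (T (weight Y2 + weight Y3) a1)"
      by (simp only: additive_ins[of "J _", OF J_add])
    also have "(\<lambda>L1. J (T k L1) (ins Y2 (\<lambda>L2. snd x (T (weight H) L2)) (T (weight Y3) (B (weight Y1) a2)))) =
      (\<lambda>L1. sg (weight H * weight Y2) (J (T k L1) (ins Y2 (snd x) (T (weight H + weight Y3) (B (weight Y1) a2)))))"
    proof
      fix L1
      have "ins Y2 (snd x) (T (weight H) c) = sg (weight H * weight Y2) (ins Y2 (\<lambda>L2. snd x (T (weight H) L2)) c)" for c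
        by (rule ins_T[OF b(2) xm])
      then have "ins Y2 (\<lambda>L2. snd x (T (weight H) L2)) c = sg (weight H * weight Y2) (ins Y2 (snd x) (T (weight H) c))" for c
        by (simp add: sg_sg) (simp add: sg_def)
      then show "J (T k L1) (ins Y2 (\<lambda>L2. snd x (T (weight H) L2)) (T (weight Y3) (B (weight Y1) a2))) =
        sg (weight H * weight Y2) (J (T k L1) (ins Y2 (snd x) (T (weight H + weight Y3) (B (weight Y1) a2))))"
        by (simp add: additive_minus(4)[of "J _", OF J_add] TT del: map_map)
    qed
    also have "ins Y1 (\<lambda>L1. sg (weight H * weight Y2) (J (T k L1) (ins Y2 (snd x) (T (weight H + weight Y3) (B (weight Y1) a2))))) (T (weight Y2 + weight Y3) a1)
      = sg (weight H * weight Y2) (ins Y1 (\<lambda>L1. J (T k L1) (ins Y2 (snd x) (T (weight H + weight Y3) (B (weight Y1) a2)))) (T (weight Y2 + weight Y3) a1))"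
      by (rule ins_sg)
    also have "\<dots> = sg (weight H * weight Y2) (sg (k * weight Y1)
       (ins Y1 (\<lambda>L1. J L1 (ins Y2 (snd x) (T (weight H + weight Y3) (B (weight Y1) a2)))) (T k (T (weight Y2 + weight Y3) a1))))"
      by (subst ins_T[OF b(1) mJ]) (simp_all add: sg_sg, simp add: sg_def)
    also have "\<dots> = sg (s Y1 Y2) (r Y1 Y2 Y3 a1 a2 a3)"
      by (simp add: sg_sg s_def r_def J_def TT k_def algebra_simps del: map_map)
    finally show ?thesis .
  qed
  have "ins Y (ins (x # H) \<phi>) as =
      ins Y (\<lambda>L. cuts L (\<lambda>L1 R. cuts R (\<lambda>L2 L3. K (T k L1) (snd x (T (weight H) L2)) (B ?e L3)))) as"
    by (simp add: K_def k_def)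
  also have "\<dots> = cuts Y (\<lambda>Y1 R. cuts R (\<lambda>Y2 Y3. cuts as (\<lambda>a1 t. cuts t (\<lambda>a2 a3. l Y1 Y2 Y3 a1 a2 a3))))"
  proof -
    have "ins Y (\<lambda>L. cuts L (\<lambda>L1 R. cuts R (\<lambda>L2 L3. K (T k L1) (snd x (T (weight H) L2)) (B ?e L3)))) as
      = cuts Y (\<lambda>Y1 R. cuts as (\<lambda>a1 t. ins Y1 (\<lambda>L1. cuts R (\<lambda>Y2 Y3. cuts t (\<lambda>a2 a3.
          ins Y2 (\<lambda>L2. ins Y3 (\<lambda>L3. K (T k L1) (snd x (T (weight H) L2)) (B ?e L3))
           (B (weight Y2) (B (weight Y1) a3))) (T (weight Y3) (B (weight Y1) a2))))) (T (weight R) a1)))"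
      by (simp add: ins_cuts cuts_map del: map_map)
    also have "\<dots> = cuts Y (\<lambda>Y1 R. cuts R (\<lambda>Y2 Y3. cuts as (\<lambda>a1 t. cuts t (\<lambda>a2 a3.
       ins Y1 (\<lambda>L1.
          ins Y2 (\<lambda>L2. ins Y3 (\<lambda>L3. K (T k L1) (snd x (T (weight H) L2)) (B ?e L3))
           (B (weight Y2) (B (weight Y1) a3))) (T (weight Y3) (B (weight Y1) a2))) (T (weight R) a1)))))"
      by (simp only: ins_cuts_swap) (subst cuts_swap, rule refl)
    also have "\<dots> = cuts Y (\<lambda>Y1 R. cuts R (\<lambda>Y2 Y3. cuts as (\<lambda>a1 t. cuts t (\<lambda>a2 a3. l Y1 Y2 Y3 a1 a2 a3))))"
      by (intro cuts_cong) (auto simp: l_def)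
    finally show ?thesis .
  qed
  also have "\<dots> = cuts Y (\<lambda>Y1 R. cuts R (\<lambda>Y2 Y3. sg (s Y1 Y2) (cuts as (\<lambda>a1 t. cuts t (\<lambda>a2 a3. r Y1 Y2 Y3 a1 a2 a3)))))"
    by (intro cuts_cong, unfold additive_cuts[of "sg _", OF sg_add], intro cuts_cong) (auto intro!: lr)
  also have "\<dots> = brace_sum (x # H) Y (\<lambda>W. ins W \<phi> as)"
  proof (simp, intro cuts_cong)
    fix Y1 R Y2 Y3 assume "Y1 @ R = Y" and "Y2 @ Y3 = R"
    then have IH: "brace_sum H Y3 (\<lambda>W. ins W (\<lambda>M. \<phi> (L1 @ v # M)) b) = ins Y3 (K L1 v) b" for L1 v b
      using Cons.IH[OF _ _ multi] Cons.prems unfolding K_def by auto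
    have "brace_sum H Y3 (\<lambda>W. sg (s Y1 Y2) (ins (Y1 @ block_brace x Y2 # W) \<phi> as))
      = brace_sum H Y3 (\<lambda>W. sg (s Y1 Y2) (cuts as (\<lambda>a1 r. cuts r (\<lambda>a2 a3.
           ins Y1 (\<lambda>L1. ins W (\<lambda>L3. \<phi> (L1 @ ins Y2 (snd x) (T (weight H + weight Y3) (B (weight Y1) a2)) # L3))
             (B (?e + weight Y2 + weight Y1) a3)) (T (k + weight Y2 + weight Y3) a1)))))"
      by (rule brace_sum_cong) (simp add: ins_node block_brace_def k_def ac_simps)
    also have "\<dots> = sg (s Y1 Y2) (cuts as (\<lambda>a1 r. cuts r (\<lambda>a2 a3.
           ins Y1 (\<lambda>L1. brace_sum H Y3 (\<lambda>W. ins W (\<lambda>L3. \<phi> (L1 @ ins Y2 (snd x) (T (weight H + weight Y3) (B (weight Y1) a2)) # L3))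
             (B (?e + weight Y2 + weight Y1) a3))) (T (k + weight Y2 + weight Y3) a1))))"
    proof -
      \<comment> \<open>one application of \<open>operator_brace_sum\<close>, to the operator that binds all four variables at once\<close>
      define R where "R W L1 a1 a2 a3 = ins W (\<lambda>L3. \<phi> (L1 @ ins Y2 (snd x) (T (weight H + weight Y3) (B (weight Y1) a2)) # L3))
             (B (?e + weight Y2 + weight Y1) a3)" for W L1 and a1 a2 a3 :: "'a list"
      have "(\<lambda>f. sg (s Y1 Y2) (cuts as (\<lambda>a1 r. cuts r (\<lambda>a2 a3.
          ins Y1 (\<lambda>L1. f (L1, a1, a2, a3)) (T (k + weight Y2 + weight Y3) a1)))))
          (\<lambda>m. brace_sum H Y3 (\<lambda>W. R W (fst m) (fst (snd m)) (fst (snd (snd m))) (snd (snd (snd m)))))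
        = brace_sum H Y3 (\<lambda>W. (\<lambda>f. sg (s Y1 Y2) (cuts as (\<lambda>a1 r. cuts r (\<lambda>a2 a3.
          ins Y1 (\<lambda>L1. f (L1, a1, a2, a3)) (T (k + weight Y2 + weight Y3) a1)))))
          (\<lambda>m. R W (fst m) (fst (snd m)) (fst (snd (snd m))) (snd (snd (snd m)))))"
        by (rule operator_brace_sum) (simp only: ins_add cuts_add sg_add)
      then show ?thesis by (simp only: R_def fst_conv snd_conv)
    qed
    also have "\<dots> = sg (s Y1 Y2) (cuts as (\<lambda>a1 t. cuts t (\<lambda>a2 a3. r Y1 Y2 Y3 a1 a2 a3)))"
      by (simp only: IH r_def)
    finally show "sg (s Y1 Y2) (cuts as (\<lambda>a1 t. cuts t (\<lambda>a2 a3. r Y1 Y2 Y3 a1 a2 a3))) =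
      brace_sum H Y3 (\<lambda>W. sg (?e * weight Y1 + weight H * (weight Y1 + weight Y2)) (ins (Y1 @ block_brace x Y2 # W) \<phi> as))"
      by (simp only: s_def)
  qed
  finally show ?case .
qed simp

end

section \<open>Cochains of a bihom-associative algebra\<close>

text \<open>
  Only the tail of the list is negated; this is the form needed to compare $\tau^i$ with
  $\alpha^i$ on a part of the arguments.
\<close>

lemma multiadditive_uminus:
  assumes "multiadditive \<phi>"
  shows "\<phi> (p @ map uminus as) = sg (length as) (\<phi> (p @ as))"
proof (induction as arbitrary: p)
  case (Cons a as)
  have neg: "\<phi> (q @ (- a) # r) = - \<phi> (q @ a # r)" for q r
    using multiadditive_sg[OF assms, of q 1 a r] by (simp add: sg_def)
  show ?case
    using Cons.IH[of "p @ [- a]"] by (simp add: neg) (simp add: sg_def)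
qed simp

context bihom_associative_algebra
begin

definition lin :: "('a \<Rightarrow> 'a) \<Rightarrow> bool" where
  "lin h \<longleftrightarrow> (\<forall>x y. h (x + y) = h x + h y) \<and> (\<forall>c x. h (scale c x) = scale c (h x))"

lemma linear_iff_lin: "Vector_Spaces.linear scale scale h \<longleftrightarrow> lin h"
  unfolding Vector_Spaces.linear_iff lin_def using vector_space_axioms by auto

lemma lin_add: "lin h \<Longrightarrow> h (x + y) = h x + h y"
  and lin_scale: "lin h \<Longrightarrow> h (scale c x) = scale c (h x)"
  by (simp_all add: lin_def)

lemma lin_zero: "lin h \<Longrightarrow> h 0 = 0" and lin_uminus: "lin h \<Longrightarrow> h (- x) = - h x"
  using additive_minus[of h] by (simp_all add: lin_def)

lemma lin_alpha: "lin \<alpha>" and lin_beta: "lin \<beta>" and lin_mu: "lin (\<mu> a)" "lin (\<lambda>x. \<mu> x b)"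
  using alpha_linear beta_linear mu_linear_right mu_linear_left by (simp_all add: linear_iff_lin)

lemma lin_compose: "lin f \<Longrightarrow> lin g \<Longrightarrow> lin (\<lambda>x. f (g x))"
  by (simp add: lin_def)

lemma lin_sum2: "lin f \<Longrightarrow> lin g \<Longrightarrow> lin (\<lambda>x. f x + g x)"
  by (simp add: lin_def scale_right_distrib)

lemma lin_const_zero: "lin (\<lambda>x. 0)"
  by (simp add: lin_def)

lemma lin_neg: "lin f \<Longrightarrow> lin (\<lambda>x. - f x)"
  by (simp add: lin_def)

lemma lin_scaled: "lin f \<Longrightarrow> lin (\<lambda>x. scale c (f x))"
  by (simp add: lin_def scale_right_distrib mult.commute)

lemma lin_pow: "lin h \<Longrightarrow> lin (h ^^ k)"
  by (induction k) (simp_all add: lin_def)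

definition multilin :: "('a list \<Rightarrow> 'a) \<Rightarrow> bool" where
  "multilin \<phi> \<longleftrightarrow> (\<forall>p q. lin (\<lambda>x. \<phi> (p @ x # q)))"

lemma multilin_multiadditive: "multilin \<phi> \<Longrightarrow> multiadditive \<phi>"
  by (simp add: multilin_def multiadditive_def lin_def)

lemma multilin_shift: "multilin \<phi> \<Longrightarrow> multilin (\<lambda>L. \<phi> (p @ L))" "multilin \<phi> \<Longrightarrow> multilin (\<lambda>L. \<phi> (L @ p))"
proof -
  assume "multilin \<phi>"
  then have "lin (\<lambda>x. \<phi> ((p @ p') @ x # q))" for p' q
    unfolding multilin_def by blast
  then show "multilin (\<lambda>L. \<phi> (p @ L))" by (simp add: multilin_def)
qed (simp add: multilin_def)

lemma multilin_Cons: "multilin \<phi> \<Longrightarrow> multilin (\<lambda>L. \<phi> (z # L))"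
  using multilin_shift(1)[of \<phi> "[z]"] by simp

lemma multilin_map: "multilin \<phi> \<Longrightarrow> lin h \<Longrightarrow> multilin (\<lambda>L. \<phi> (map h L))"
  unfolding multilin_def by (auto intro: lin_compose[of "\<lambda>x. \<phi> (_ @ x # _)" h])

lemma cuts_scale: "scale c (cuts as F) = cuts as (\<lambda>p q. scale c (F p q))"
  by (rule additive_cuts) (rule scale_right_distrib)

lemma multilin_cuts:
  assumes "\<And>s. multilin (\<lambda>p. F p s)" and "\<And>p. multilin (F p)"
  shows "multilin (\<lambda>as. cuts as F)"
  using assms unfolding multilin_def lin_def
  by (simp add: cuts_append_node cuts_add cuts_scale scale_right_distrib algebra_simps)

sublocale twisted_insertion "\<lambda>x. - \<alpha> x" \<beta>
  by unfold_locales
    (simp_all add: alpha_beta_commute lin_add[OF lin_alpha] lin_uminus[OF lin_beta])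

lemma lin_tau: "lin (\<lambda>x. - \<alpha> x)"
  by (rule lin_neg) (rule lin_alpha)

lemma ins_scale: "scale c (ins G \<phi> as) = ins G (\<lambda>L. scale c (\<phi> L)) as"
  by (rule additive_ins) (rule scale_right_distrib)

text \<open>
  In \<open>ins (x # G) \<phi> as\<close> the varied argument lies in front of the piece consumed by \<open>x\<close>, in it, or
  behind it; by \<open>multilin_cuts\<close> it suffices to treat the three parts separately.
\<close>

lemma multilin_ins:
  assumes "\<And>y. y \<in> set G \<Longrightarrow> multilin (snd y)" and "multilin \<phi>"
  shows "multilin (ins G \<phi>)"
  using assms
proof (induction G arbitrary: \<phi>)
  case (Cons x G)
  have slot: "lin (\<lambda>z. ins G (\<lambda>L. \<phi> (P @ z # L)) s)" for P s
    using Cons.prems(2) unfolding multilin_def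
    by (simp add: lin_def ins_add[symmetric] ins_scale)
  show ?case
    unfolding ins_Cons
  proof (intro multilin_cuts)
    fix s
    show "multilin (\<lambda>p. cuts s (\<lambda>q s. ins G (\<lambda>L. \<phi> (T (fst x + weight G) p @ snd x (T (weight G) q) # L)) (B (fst x) s)))"
    proof -
      have "multilin (\<lambda>p. \<phi> (T k p @ M))" for k M
        using multilin_map[OF multilin_shift(2)[OF Cons.prems(2)] lin_pow[OF lin_tau]] .
      then show ?thesis
        unfolding multilin_def lin_def
        by (simp add: ins_add[symmetric] ins_scale cuts_add[symmetric] cuts_scale)
    qed
  next
    fix p s
    have "multilin (\<lambda>q. snd x (T k q))" for k
      using multilin_map[OF _ lin_pow[OF lin_tau]] Cons.prems(1) by simp
    then show "multilin (\<lambda>q. ins G (\<lambda>L. \<phi> (T (fst x + weight G) p @ snd x (T (weight G) q) # L)) (B (fst x) s))"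
      using slot unfolding multilin_def by (simp add: lin_compose[where f = "\<lambda>z. ins _ (\<lambda>L. \<phi> (_ @ z # L)) _"])
  next
    fix p q
    have "multilin (\<lambda>L. \<phi> ((T (fst x + weight G) p @ [snd x (T (weight G) q)]) @ L))"
      by (rule multilin_shift) (rule Cons.prems)
    then have "multilin (ins G (\<lambda>L. \<phi> (T (fst x + weight G) p @ snd x (T (weight G) q) # L)))"
      using Cons.IH Cons.prems(1) by simp
    then show "multilin (\<lambda>s. ins G (\<lambda>L. \<phi> (T (fst x + weight G) p @ snd x (T (weight G) q) # L)) (B (fst x) s))"
      by (rule multilin_map) (rule lin_pow[OF lin_beta])
  qed
qed simp

text \<open>
  An insertion shortens lists by the total shifted degree.  The length \<open>n\<close> is an integer because
  the induction passes to the remaining arguments of $\varphi$, whose number can become negative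
  when the prefix is too long.
\<close>

lemma ins_support:
  assumes "\<And>y as. y \<in> set G \<Longrightarrow> length as \<noteq> Suc (fst y) \<Longrightarrow> snd y as = 0"
    and "\<And>L. int (length L) \<noteq> n \<Longrightarrow> \<phi> L = 0" and "multiadditive \<phi>" and "int (length as) \<noteq> n + int (weight G)"
  shows "ins G \<phi> as = 0"
  using assms
proof (induction G arbitrary: \<phi> as n)
  case (Cons x G)
  have "ins G (\<lambda>L. \<phi> (T (fst x + weight G) p @ snd x (T (weight G) q) # L)) (B (fst x) s) = 0" (is "ins G ?\<psi> _ = 0")
    if as: "as = p @ q @ s" for p q s
  proof (cases "length q = Suc (fst x)")
    case True
    show ?thesis
    proof (rule Cons.IH[of "n - int (length p) - 1"])
      show "?\<psi> L = 0" if "int (length L) \<noteq> n - int (length p) - 1" for L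
        using that by (intro Cons.prems(2)) simp
      show "multiadditive ?\<psi>"
        using multiadditive_shift(1)[OF Cons.prems(3), of "_ @ [_]"] by simp
      show "int (length (B (fst x) s)) \<noteq> n - int (length p) - 1 + int (weight G)"
        using Cons.prems(4) True as by simp
    qed (use Cons.prems(1) in simp)
  next
    case False
    then have "snd x (T (weight G) q) = 0" using Cons.prems(1) by simp
    moreover have "\<phi> (P @ 0 # L) = 0" for P L
      using multiadditive_sg[OF Cons.prems(3), of P 0 0 L] multiadditive_slot[OF Cons.prems(3), of P 0 0 L] by simp
    ultimately show ?thesis by simp
  qed
  then have "cuts as (\<lambda>p r. cuts r (\<lambda>q s. ins G (\<lambda>L. \<phi> (T (fst x + weight G) p @ snd x (T (weight G) q) # L)) (B (fst x) s)))
     = cuts as (\<lambda>p r. cuts r (\<lambda>q s. 0))"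
    by (intro cuts_cong) auto
  then show ?case by (simp only: ins_Cons cuts_zero)
qed simp

lemma multilin_iff_linear_slots:
  assumes "\<And>xs. length xs \<noteq> n \<Longrightarrow> f xs = 0"
  shows "multilin f \<longleftrightarrow> (\<forall>xs i. length xs = n \<and> i < n \<longrightarrow> lin (\<lambda>x. f (xs[i := x])))"
proof
  assume f: "multilin f"
  show "\<forall>xs i. length xs = n \<and> i < n \<longrightarrow> lin (\<lambda>x. f (xs[i := x]))"
    using f unfolding multilin_def by (auto simp: upd_conv_take_nth_drop)
next
  assume *: "\<forall>xs i. length xs = n \<and> i < n \<longrightarrow> lin (\<lambda>x. f (xs[i := x]))"
  show "multilin f"
    unfolding multilin_def
  proof (intro allI)
    fix p q
    show "lin (\<lambda>x. f (p @ x # q))"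
    proof (cases "length p + length q + 1 = n")
      case True
      have "lin (\<lambda>x. f ((p @ 0 # q)[length p := x]))"
        using True by (intro *[rule_format]) simp
      then show ?thesis by simp
    next
      case False
      then show ?thesis by (simp add: assms lin_const_zero)
    qed
  qed
qed

text \<open>
  Extension by zero makes equivariance and linearity hold on lists of every length.
\<close>

lemma cochains_iff:
  "f \<in> cochains scale \<alpha> \<beta> n \<longleftrightarrow> (\<forall>xs. length xs \<noteq> n \<longrightarrow> f xs = 0) \<and> multilin f \<and>
     (\<forall>xs. f (map \<alpha> xs) = \<alpha> (f xs)) \<and> (\<forall>xs. f (map \<beta> xs) = \<beta> (f xs))"
proof -
  have "f (map h xs) = h (f xs)" if "\<forall>xs. length xs \<noteq> n \<longrightarrow> f xs = 0" "\<forall>xs. length xs = n \<longrightarrow> h (f xs) = f (map h xs)" "lin h" for h xs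
    using that by (cases "length xs = n") (auto simp: lin_zero)
  from this[of \<alpha>] this[of \<beta>] show ?thesis
    unfolding cochains_def linear_iff_lin
    using multilin_iff_linear_slots[of n f] lin_alpha lin_beta by auto
qed

abbreviation C where "C \<equiv> cochains scale \<alpha> \<beta>"

lemma cochain_block:
  assumes "f \<in> C (Suc e)"
  shows "block (e, f)"
proof -
  have f: "length xs \<noteq> Suc e \<Longrightarrow> f xs = 0" "multilin f" "f (map \<alpha> xs) = \<alpha> (f xs)" "f (map \<beta> xs) = \<beta> (f xs)" for xs
    using assms by (auto simp: cochains_iff)
  have "f (map (\<lambda>x. - \<alpha> x) xs) = sg e (- \<alpha> (f xs))" for xs
  proof (cases "length xs = Suc e")
    case True
    have "map (\<lambda>x. - \<alpha> x) xs = [] @ map uminus (map \<alpha> xs)" by simp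
    then have "f (map (\<lambda>x. - \<alpha> x) xs) = sg (Suc e) (f (map \<alpha> xs))"
      using multiadditive_uminus[OF multilin_multiadditive[OF f(2)], of "[]" "map \<alpha> xs"] True by (simp add: comp_def)
    then show ?thesis by (simp add: f sg_def)
  next
    case False
    then show ?thesis by (simp add: f lin_zero[OF lin_alpha])
  qed
  then show ?thesis
    using f multilin_multiadditive by (simp add: block_def)
qed

definition cochain_block where
  "cochain_block x \<longleftrightarrow> snd x \<in> C (Suc (fst x))"

lemma cochain_blockD:
  assumes "cochain_block x"
  shows "block x" "multilin (snd x)" "multiadditive (snd x)"
    "length xs \<noteq> Suc (fst x) \<Longrightarrow> snd x xs = 0" "snd x (map \<alpha> xs) = \<alpha> (snd x xs)" "snd x (map \<beta> xs) = \<beta> (snd x xs)"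
  using assms cochain_block[of "snd x" "fst x"] by (auto simp: cochain_block_def cochains_iff multilin_multiadditive)

lemma ins_cochain:
  assumes "\<And>y. y \<in> set G \<Longrightarrow> cochain_block y" and f: "f \<in> C k"
  shows "ins G f \<in> C (k + weight G)"
  unfolding cochains_iff
proof (intro conjI allI impI)
  have f': "length xs \<noteq> k \<Longrightarrow> f xs = 0" "multilin f" "f (map \<alpha> xs) = \<alpha> (f xs)" "f (map \<beta> xs) = \<beta> (f xs)" for xs
    using f by (auto simp: cochains_iff)
  show "multilin (ins G f)"
    by (rule multilin_ins) (use f' assms(1) cochain_blockD in auto)
  fix xs
  show "ins G f xs = 0" if "length xs \<noteq> k + weight G"
    by (rule ins_support[where n = "int k"]) (use that f' assms(1) cochain_blockD multilin_multiadditive in auto)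
  have c: "((\<lambda>x. - \<alpha> x) ^^ l) (\<alpha> x) = \<alpha> (((\<lambda>x. - \<alpha> x) ^^ l) x)" "(\<beta> ^^ l) (\<beta> x) = \<beta> ((\<beta> ^^ l) x)"
     "(\<beta> ^^ l) (\<alpha> x) = \<alpha> ((\<beta> ^^ l) x)" "((\<lambda>x. - \<alpha> x) ^^ l) (\<beta> x) = \<beta> (((\<lambda>x. - \<alpha> x) ^^ l) x)" for l x
    by (induction l; simp add: lin_uminus[OF lin_alpha] lin_uminus[OF lin_beta] alpha_beta_commute)+
  have "ins G f (map \<alpha> xs) = ins G (\<lambda>L. f (map \<alpha> L)) xs"
    by (rule ins_map) (use assms(1) cochain_blockD c in auto)
  also have "\<dots> = \<alpha> (ins G f xs)"
    unfolding f' by (rule additive_ins[symmetric]) (rule lin_add[OF lin_alpha])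
  finally show "ins G f (map \<alpha> xs) = \<alpha> (ins G f xs)" .
  have "ins G f (map \<beta> xs) = ins G (\<lambda>L. f (map \<beta> L)) xs"
    by (rule ins_map) (use assms(1) cochain_blockD c in auto)
  also have "\<dots> = \<beta> (ins G f xs)"
    unfolding f' by (rule additive_ins[symmetric]) (rule lin_add[OF lin_beta])
  finally show "ins G f (map \<beta> xs) = \<beta> (ins G f xs)" .
qed

end

section \<open>Braces of homogeneous cochains as insertions\<close>

context bihom_associative_algebra
begin

lemma sg_scale: "scale ((-1) ^ k) x = sg k x"
  by (simp add: sg_def uminus_power_if)

definition excess :: "(nat \<times> 'a cochain) list \<Rightarrow> nat" where
  "excess hs = (\<Sum>h\<leftarrow>hs. fst h - 1)"

lemma excess_simps [simp]: "excess [] = 0" "excess (h # hs) = fst h - 1 + excess hs"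
  by (simp_all add: excess_def)

text \<open>
  All lists of length \<open>k\<close> that arise by shuffling the members of \<open>gs\<close>, in order, with
  copies of the identity; a recursive counterpart of \<open>substitution\<close> over all position sets.
\<close>

fun substitutions :: "nat \<Rightarrow> (nat \<times> 'a cochain) list \<Rightarrow> (nat \<times> 'a cochain) list list" where
  "substitutions 0 [] = [[]]"
| "substitutions 0 (g # gs) = []"
| "substitutions (Suc k) [] = map (Cons (1, id_cochain)) (substitutions k [])"
| "substitutions (Suc k) (g # gs) = map (Cons (1, id_cochain)) (substitutions k (g # gs)) @ map (Cons g) (substitutions k gs)"

definition positions :: "nat \<Rightarrow> nat \<Rightarrow> nat set set" where
  "positions k n = {S. S \<subseteq> {..<k} \<and> card S = n}"

lemma finite_positions [simp]: "finite (positions k n)"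
  unfolding positions_def by (rule finite_subset[of _ "Pow {..<k}"]) auto

text \<open>
  Pascal's recursion: position $0$ is occupied or not, and the other positions are shifted by one.
\<close>

lemma positions_Suc:
  "positions (Suc k) n = (\<lambda>S. Suc ` S) ` positions k n \<union>
     (case n of 0 \<Rightarrow> {} | Suc m \<Rightarrow> (\<lambda>S. insert 0 (Suc ` S)) ` positions k m)"
proof (rule Set.set_eqI)
  fix S
  define S' where "S' = {j. Suc j \<in> S}"
  have S: "S = (if 0 \<in> S then insert 0 (Suc ` S') else Suc ` S')"
    unfolding S'_def by (auto simp: image_iff) (metis not0_implies_Suc)+
  have sub: "S \<subseteq> {..<Suc k} \<longleftrightarrow> S' \<subseteq> {..<k}"
  proof
    assume "S \<subseteq> {..<Suc k}"
    then show "S' \<subseteq> {..<k}" by (auto simp: S'_def)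
  next
    assume *: "S' \<subseteq> {..<k}"
    show "S \<subseteq> {..<Suc k}"
    proof
      fix x assume "x \<in> S"
      then show "x \<in> {..<Suc k}" using * by (cases x) (auto simp: S'_def)
    qed
  qed
  have card: "card (Suc ` A) = card A" for A by (rule card_image) simp
  show "S \<in> positions (Suc k) n \<longleftrightarrow> S \<in> (\<lambda>S. Suc ` S) ` positions k n \<union>
     (case n of 0 \<Rightarrow> {} | Suc m \<Rightarrow> (\<lambda>S. insert 0 (Suc ` S)) ` positions k m)"
  proof
    assume L: "S \<in> positions (Suc k) n"
    then have fin: "finite S'" using sub finite_subset unfolding positions_def by blast
    show "S \<in> (\<lambda>S. Suc ` S) ` positions k n \<union>
     (case n of 0 \<Rightarrow> {} | Suc m \<Rightarrow> (\<lambda>S. insert 0 (Suc ` S)) ` positions k m)"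
    proof (cases "0 \<in> S")
      case True
      then have "S = insert 0 (Suc ` S')" using S by simp
      moreover from this have "n = Suc (card S')"
        using L fin by (simp add: positions_def card card_insert_if)
      ultimately show ?thesis using L sub by (auto simp: positions_def)
    next
      case False
      then have "S = Suc ` S'" using S by simp
      moreover from this have "n = card S'" using L card by (simp add: positions_def)
      ultimately show ?thesis using L sub by (auto simp: positions_def)
    qed
  next
    assume R: "S \<in> (\<lambda>S. Suc ` S) ` positions k n \<union>
     (case n of 0 \<Rightarrow> {} | Suc m \<Rightarrow> (\<lambda>S. insert 0 (Suc ` S)) ` positions k m)"
    then consider A where "S = Suc ` A" "A \<in> positions k n" |
      A m where "n = Suc m" "S = insert 0 (Suc ` A)" "A \<in> positions k m"
      by (auto split: nat.splits)
    then show "S \<in> positions (Suc k) n"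
    proof cases
      case 2
      then have "finite A" using finite_subset unfolding positions_def by blast
      then show ?thesis using 2 by (auto simp: positions_def card card_insert_if)
    qed (auto simp: positions_def card)
  qed
qed

lemma substitution_Suc:
  "substitution (Suc k) gs (Suc ` S) = (1, id_cochain) # substitution k gs S"
  "finite S \<Longrightarrow> substitution (Suc k) (g # gs) (insert 0 (Suc ` S)) = g # substitution k gs S"
proof -
  have sh: "[0..<Suc k] = 0 # map Suc [0..<k]"
    by (metis map_Suc_upt upt_conv_Cons zero_less_Suc)
  have *: "{s \<in> Suc ` S. s < Suc j} = Suc ` {s \<in> S. s < j}" for j by auto
  have c: "card (Suc ` A) = card A" for A by (rule card_image) simp
  show "substitution (Suc k) gs (Suc ` S) = (1, id_cochain) # substitution k gs S"
    unfolding substitution_def sh using * c by (auto simp: image_iff)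
  assume fin: "finite S"
  have **: "{s \<in> insert 0 (Suc ` S). s < Suc j} = insert 0 (Suc ` {s \<in> S. s < j})" for j by auto
  have "card {s \<in> insert 0 (Suc ` S). s < Suc j} = Suc (card {s \<in> S. s < j})" for j
    unfolding ** using fin by (subst card_insert_disjoint) (auto simp: c)
  then show "substitution (Suc k) (g # gs) (insert 0 (Suc ` S)) = g # substitution k gs S"
    unfolding substitution_def sh by (auto simp: image_iff)
qed

text \<open>
  Distinguish whether position $0$ receives one of the $g_p$ or the identity.
\<close>

lemma sum_positions:
  fixes F :: "(nat \<times> 'a cochain) list \<Rightarrow> 'a"
  shows "(\<Sum>S\<in>positions k (length gs). F (substitution k gs S)) = (\<Sum>hs\<leftarrow>substitutions k gs. F hs)"
proof (induction k gs arbitrary: F rule: substitutions.induct)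
  case 1
  have "positions 0 0 = {{}}" by (auto simp: positions_def)
  then show ?case by (simp add: substitution_def)
next
  case (2 g gs)
  have "positions 0 (Suc (length gs)) = {}" by (auto simp: positions_def)
  then show ?case by simp
next
  case (3 k)
  have "(\<Sum>S\<in>positions (Suc k) 0. F (substitution (Suc k) [] S))
      = (\<Sum>S\<in>positions k 0. F (substitution (Suc k) [] (Suc ` S)))"
    by (simp add: positions_Suc sum.reindex inj_on_def inj_image_eq_iff)
  then show ?case using 3[of "\<lambda>hs. F ((1, id_cochain) # hs)"] by (simp add: substitution_Suc comp_def)
next
  case (4 k g gs)
  have inj: "inj_on (\<lambda>S. insert 0 (Suc ` S)) A" for A
    by (rule inj_onI) (auto simp: insert_eq_iff inj_image_eq_iff)
  have "(\<Sum>S\<in>positions (Suc k) (Suc (length gs)). F (substitution (Suc k) (g # gs) S))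
      = (\<Sum>S\<in>positions k (Suc (length gs)). F (substitution (Suc k) (g # gs) (Suc ` S)))
      + (\<Sum>S\<in>positions k (length gs). F (substitution (Suc k) (g # gs) (insert 0 (Suc ` S))))"
    unfolding positions_Suc nat.case
    by (subst sum.union_disjoint) (auto simp: sum.reindex inj inj_on_def inj_image_eq_iff)
  also have "(\<Sum>S\<in>positions k (length gs). F (substitution (Suc k) (g # gs) (insert 0 (Suc ` S))))
     = (\<Sum>S\<in>positions k (length gs). F (g # substitution k gs S))"
  proof (rule sum.cong[OF refl])
    fix S assume "S \<in> positions k (length gs)"
    then have "finite S" using finite_subset unfolding positions_def by blast
    then show "F (substitution (Suc k) (g # gs) (insert 0 (Suc ` S))) = F (g # substitution k gs S)"
      by (simp only: substitution_Suc)
  qed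
  finally show ?case using 4(1)[of "\<lambda>hs. F ((1, id_cochain) # hs)"] 4(2)[of "\<lambda>hs. F (g # hs)"]
    by (simp add: substitution_Suc comp_def)
qed

lemma substitutions_properties:
  assumes "hs \<in> set (substitutions k gs)"
  shows "excess hs = excess gs" and "h \<in> set hs \<Longrightarrow> h = (1, id_cochain) \<or> h \<in> set gs"
proof -
  show "excess hs = excess gs"
    using assms by (induction k gs arbitrary: hs rule: substitutions.induct) auto
  show "h = (1, id_cochain) \<or> h \<in> set gs" if "h \<in> set hs"
    using that assms by (induction k gs arbitrary: hs rule: substitutions.induct) (auto, blast+)
qed

text \<open>
  \<open>substitution_sign\<close> as a function of the substituted list alone: the identities have shifted
  degree $0$ and do not contribute.
\<close>

definition block_sign :: "(nat \<times> 'a cochain) list \<Rightarrow> nat" where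
  "block_sign hs = (\<Sum>j<length hs. (fst (hs ! j) - 1) * (\<Sum>l<j. fst (hs ! l)))"

lemma substitution_sign_eq:
  assumes "S \<subseteq> {..<k}"
  shows "substitution_sign k gs S = block_sign (substitution k gs S)"
proof -
  have "(\<Sum>j<k. (fst (substitution k gs S ! j) - 1) * (\<Sum>l<j. fst (substitution k gs S ! l)))
     = (\<Sum>j\<in>S. (fst (substitution k gs S ! j) - 1) * (\<Sum>l<j. fst (substitution k gs S ! l)))"
    by (rule sum.mono_neutral_right) (use assms in \<open>auto simp: substitution_def\<close>)
  then show ?thesis
    unfolding block_sign_def substitution_sign_def Let_def by (simp add: substitution_def)
qed

lemma excess_nth: "excess hs = (\<Sum>j<length hs. fst (hs ! j) - 1)"
  by (simp add: excess_def sum_list_sum_nth atLeast0LessThan)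

lemma block_sign_Cons: "block_sign (h # hs) = fst h * excess hs + block_sign hs"
proof -
  have "block_sign (h # hs) = (\<Sum>j<length hs. (fst (hs ! j) - 1) * (fst h + (\<Sum>l<j. fst (hs ! l))))"
    unfolding block_sign_def by (simp add: sum.lessThan_Suc_shift del: sum.lessThan_Suc)
  then show ?thesis
    by (simp add: block_sign_def excess_nth distrib_left sum.distrib sum_distrib_left mult.commute)
qed

text \<open>
  The arguments that \<open>gamma\<close> passes to its first cochain.
\<close>

definition blocks :: "(nat \<times> 'a cochain) list \<Rightarrow> 'a list \<Rightarrow> 'a list" where
  "blocks gs xs = map (\<lambda>i.
           (\<alpha> ^^ (\<Sum>l\<in>{i<..<length gs}. fst (gs ! l) - 1))
           ((\<beta> ^^ (\<Sum>l<i. fst (gs ! l) - 1))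
             (snd (gs ! i) (slice (\<Sum>l<i. fst (gs ! l)) (\<Sum>l\<le>i. fst (gs ! l)) xs))))
         [0..<length gs]"

text \<open>
  Splitting off the first cochain: all later ones receive $\beta^{n-1}$ from it, $n$ being its arity,
  and equivariance lets this power act on their arguments.
\<close>

lemma blocks_Cons:
  assumes "\<And>h xs. h \<in> set hs \<Longrightarrow> snd h (map \<beta> xs) = \<beta> (snd h xs)"
  shows "blocks (h # hs) xs =
    (\<alpha> ^^ excess hs) (snd h (take (fst h) xs)) # blocks hs (B (fst h - 1) (drop (fst h) xs))"
proof -
  have sh: "[0..<length (h # hs)] = 0 # map Suc [0..<length hs]"
    by (metis length_Cons map_Suc_upt upt_conv_Cons zero_less_Suc)
  have upper: "(\<Sum>l\<in>{Suc i<..<length (h # hs)}. fst ((h # hs) ! l) - 1) = (\<Sum>l\<in>{i<..<length hs}. fst (hs ! l) - 1)" for i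
    by (simp only: atLeastSucLessThan_greaterThanLessThan[symmetric] sum.shift_bounds_Suc_ivl nth_Cons_Suc length_Cons)
  have upper0: "(\<Sum>l\<in>{0<..<length (h # hs)}. fst ((h # hs) ! l) - 1) = excess hs"
    unfolding excess_nth
    by (simp only: atLeastSucLessThan_greaterThanLessThan[symmetric] sum.shift_bounds_Suc_ivl nth_Cons_Suc length_Cons
        atLeast0LessThan)
  have lower: "(\<Sum>l<Suc i. F ((h # hs) ! l)) = F h + (\<Sum>l<i. F (hs ! l))"
    "(\<Sum>l\<le>Suc i. F ((h # hs) ! l)) = F h + (\<Sum>l\<le>i. F (hs ! l))" for F :: "nat \<times> 'a cochain \<Rightarrow> nat" and i
    by (simp_all add: sum.lessThan_Suc_shift sum.atMost_Suc_shift del: sum.lessThan_Suc sum.atMost_Suc)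
  have slice: "slice (n + i) (n + j) xs = slice i j (drop n xs)" for n i j
    by (simp add: slice_def add.commute)
  have Bh: "snd (hs ! i) (B k ys) = (\<beta> ^^ k) (snd (hs ! i) ys)" if "i < length hs" for i k ys
  proof (induction k arbitrary: ys)
    case (Suc k)
    have "snd (hs ! i) (map \<beta> (B k ys)) = \<beta> (snd (hs ! i) (B k ys))"
      by (rule assms) (simp add: that)
    then show ?case using Suc by (simp add: comp_def)
  qed simp
  have sliceB: "slice i j (B k ys) = B k (slice i j ys)" for i j k ys
    by (simp add: slice_def take_map drop_map)
  have "blocks (h # hs) xs = (\<alpha> ^^ excess hs) (snd h (take (fst h) xs)) #
     map (\<lambda>i. (\<alpha> ^^ (\<Sum>l\<in>{i<..<length hs}. fst (hs ! l) - 1))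
           ((\<beta> ^^ (fst h - 1 + (\<Sum>l<i. fst (hs ! l) - 1)))
             (snd (hs ! i) (slice (\<Sum>l<i. fst (hs ! l)) (\<Sum>l\<le>i. fst (hs ! l)) (drop (fst h) xs))))) [0..<length hs]"
    unfolding blocks_def sh list.map map_map comp_def upper upper0 lower[of "\<lambda>h. fst h - 1"] lower[of fst] slice
    by (simp add: slice_def)
  also have "\<dots> = (\<alpha> ^^ excess hs) (snd h (take (fst h) xs)) # blocks hs (B (fst h - 1) (drop (fst h) xs))"
  proof -
    have "(\<beta> ^^ (k + l)) x = (\<beta> ^^ l) ((\<beta> ^^ k) x)" for k l x
      by (metis add.commute comp_apply funpow_add)
    then show ?thesis
      unfolding blocks_def by (auto simp: sliceB Bh)
  qed
  finally show ?thesis .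
qed

text \<open>
  The summand of \<open>ins\<close> belonging to a list of blocks that covers the whole argument list.
\<close>

fun block_value :: "(nat \<times> 'a cochain) list \<Rightarrow> ('a list \<Rightarrow> 'a) \<Rightarrow> 'a list \<Rightarrow> 'a" where
  "block_value [] \<phi> xs = (if xs = [] then \<phi> [] else 0)"
| "block_value (h # hs) \<phi> xs = cuts xs (\<lambda>q s. block_value hs (\<lambda>L. \<phi> (snd h (T (excess hs) q) # L)) (B (fst h - 1) s))"

lemma block_value_zero [simp]: "block_value hs (\<lambda>L. 0) xs = 0"
  by (induction hs arbitrary: xs) auto

lemma tau_pow: "((\<lambda>x. - \<alpha> x) ^^ k) x = sg k ((\<alpha> ^^ k) x)"
  by (induction k) (simp_all add: sg_def lin_uminus[OF lin_alpha])

lemma multilin_zero_slot: "multilin \<phi> \<Longrightarrow> \<phi> (p @ 0 # q) = 0"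
  unfolding multilin_def using lin_zero by blast

text \<open>
  Twisting the $n$ arguments of $g$ by $\tau^w$ instead of twisting its value by $\alpha^w$ yields the sign
  $(-1)^{nw}$; multiplied over all blocks these signs give \<open>block_sign\<close>.
\<close>

lemma block_value_eq_blocks:
  assumes "\<And>h. h \<in> set hs \<Longrightarrow> fst h \<ge> 1 \<and> snd h \<in> C (fst h)" and "multilin \<phi>"
  shows "block_value hs \<phi> xs = sg (block_sign hs) (if length xs = sum_list (map fst hs) then \<phi> (blocks hs xs) else 0)"
  using assms
proof (induction hs arbitrary: \<phi> xs)
  case Nil
  then show ?case by (simp add: blocks_def block_sign_def)
next
  case (Cons h hs)
  obtain n g where h: "h = (n, g)" by fastforce
  have g: "g \<in> C n" "n \<ge> 1" using Cons.prems(1)[of h] h by auto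
  have blk: "block (n - 1, g)" using cochain_block[of g "n - 1"] g by simp
  have gz: "length ys \<noteq> n \<Longrightarrow> g ys = 0" for ys using g by (simp add: cochains_iff)
  have beta: "snd h (map \<beta> xs) = \<beta> (snd h xs)" if "h \<in> set hs" for h xs
    using Cons.prems(1)[of h] that by (simp add: cochains_iff)
  have IH: "block_value hs (\<lambda>L. \<phi> (z # L)) ys =
     sg (block_sign hs) (if length ys = sum_list (map fst hs) then \<phi> (z # blocks hs ys) else 0)" for z ys
    by (rule Cons.IH) (use Cons.prems in \<open>auto intro: multilin_Cons\<close>)
  \<comment> \<open>\<open>g\<close> vanishes on lists of length other than \<open>n\<close>, so only one splitting contributes\<close>
  have off: "block_value hs (\<lambda>L. \<phi> (g (T (excess hs) (take i xs)) # L)) (B (n - 1) (drop i xs)) = 0" if "i \<noteq> n" "i \<le> length xs" for i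
    using that gz multilin_zero_slot[OF Cons.prems(2), of "[]"] by simp
  have "block_value (h # hs) \<phi> xs = (\<Sum>i\<le>length xs. block_value hs (\<lambda>L. \<phi> (g (T (excess hs) (take i xs)) # L)) (B (n - 1) (drop i xs)))"
    by (simp add: h cuts_eq_sum)
  also have "\<dots> = (if n \<le> length xs then block_value hs (\<lambda>L. \<phi> (g (T (excess hs) (take n xs)) # L)) (B (n - 1) (drop n xs)) else 0)"
  proof (cases "n \<le> length xs")
    case True
    then show ?thesis
      using sum.mono_neutral_right[of "{..length xs}" "{n}" "\<lambda>i. block_value hs (\<lambda>L. \<phi> (g (T (excess hs) (take i xs)) # L)) (B (n - 1) (drop i xs))"] off
      by auto
  next
    case False
    then show ?thesis using off by (intro trans[OF sum.neutral]) auto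
  qed
  also have "\<dots> = sg (block_sign (h # hs)) (if length xs = sum_list (map fst (h # hs)) then \<phi> (blocks (h # hs) xs) else 0)"
  proof (cases "n \<le> length xs")
    case True
    have "g (T (excess hs) (take n xs)) = sg (n * excess hs) ((\<alpha> ^^ excess hs) (g (take n xs)))"
    proof -
      have "g (T (excess hs) (take n xs)) = sg (excess hs * (n - 1)) (sg (excess hs) ((\<alpha> ^^ excess hs) (g (take n xs))))"
        using block_T[OF blk, of "excess hs" "take n xs"] by (simp add: tau_pow)
      then show ?thesis using g(2) by (simp add: sg_sg) (auto simp: sg_def)
    qed
    moreover have "block_value hs (\<lambda>L. \<phi> (sg k z # L)) ys = sg k (block_value hs (\<lambda>L. \<phi> (z # L)) ys)" for k z ys
      unfolding IH using multiadditive_sg[OF multilin_multiadditive[OF Cons.prems(2)], of "[]"]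
      by (simp add: sg_sg add.commute)
    ultimately have "block_value hs (\<lambda>L. \<phi> (g (T (excess hs) (take n xs)) # L)) (B (n - 1) (drop n xs))
      = sg (n * excess hs) (block_value hs (\<lambda>L. \<phi> ((\<alpha> ^^ excess hs) (g (take n xs)) # L)) (B (n - 1) (drop n xs)))"
      by simp
    also have "block_value hs (\<lambda>L. \<phi> ((\<alpha> ^^ excess hs) (g (take n xs)) # L)) (B (n - 1) (drop n xs))
      = sg (block_sign hs) (if length (drop n xs) = sum_list (map fst hs) then \<phi> ((\<alpha> ^^ excess hs) (g (take n xs)) # blocks hs (B (n - 1) (drop n xs))) else 0)"
      by (simp only: IH length_map)
    finally show ?thesis
      using True by (auto simp: h blocks_Cons[OF beta] block_sign_Cons sg_sg)
  next
    case False
    then show ?thesis by (simp add: h)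
  qed
  finally show ?case .
qed

lemma ins_peel:
  assumes "snd x [] = 0" and "\<phi> [] = 0" and "\<And>p q. \<phi> (p @ 0 # q) = 0"
  shows "ins (x # G) \<phi> [] = 0"
    "ins (x # G) \<phi> (a # as) = cuts (a # as) (\<lambda>q s. ins G (\<lambda>L. \<phi> (snd x (T (weight G) q) # L)) (B (fst x) s))
      + ins (x # G) (\<lambda>L. \<phi> (((\<lambda>x. - \<alpha> x) ^^ (fst x + weight G)) a # L)) as"
  using assms by (simp_all del: cuts.simps add: cuts.simps(2)[of a as "\<lambda>p r. cuts r (_ p)"] cuts.simps(1)[of "\<lambda>p r. cuts r (_ p)"])
    (use assms(3)[of "[]"] in simp)

definition shift_arity :: "nat \<times> 'a cochain \<Rightarrow> nat \<times> 'a cochain" where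
  "shift_arity g = (fst g - 1, snd g)"

lemma weight_map_shift_arity [simp]: "weight (map shift_arity gs) = excess gs"
  by (simp add: weight_def excess_def shift_arity_def comp_def)

lemma id_cochain_T: "cuts (a # as) (\<lambda>q s. F (id_cochain (T k q)) s) =
   F (((\<lambda>x. - \<alpha> x) ^^ k) a) as" if "\<And>s. F 0 s = 0"
proof -
  have F0: "F 0 = (\<lambda>s. 0)" by (rule ext) (rule that)
  have "cuts as (\<lambda>p q. F (id_cochain (T k (a # p))) q) = F (((\<lambda>x. - \<alpha> x) ^^ k) a) as"
  proof (cases as)
    case Nil
    then show ?thesis by (simp add: id_cochain_def)
  next
    case (Cons b bs)
    then have "cuts as (\<lambda>p q. F (id_cochain (T k (a # p))) q) = F (((\<lambda>x. - \<alpha> x) ^^ k) a) as + cuts bs (\<lambda>p q. 0)"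
      by (simp add: id_cochain_def F0 del: cuts_zero)
    then show ?thesis by simp
  qed
  moreover have "id_cochain (T k []) = (0 :: 'a)" by (simp add: id_cochain_def)
  ultimately show ?thesis by (simp only: cuts.simps that add_0)
qed

text \<open>
  An identity block consumes exactly one argument and leaves it in place.  So the first argument
  is either kept or consumed by the first proper block, and both \<open>ins\<close> and the sum over
  substitutions obey this recursion (\<open>ins_peel\<close>).
\<close>

lemma sum_block_value_eq_ins:
  assumes "\<And>g. g \<in> set gs \<Longrightarrow> snd g [] = 0" and "multilin \<phi>" and "\<And>L. length L \<noteq> k \<Longrightarrow> \<phi> L = 0"
  shows "(\<Sum>hs\<leftarrow>substitutions k gs. block_value hs \<phi> xs) = ins (map shift_arity gs) \<phi> xs"
  using assms
proof (induction k gs arbitrary: \<phi> xs rule: substitutions.induct)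
  case (1 \<phi> xs)
  then show ?case by auto
next
  case (2 g gs \<phi> xs)
  then have "\<phi> (P @ z # L) = 0" for P z L by simp
  then show ?case by simp
next
  case (3 k \<phi> xs)
  have z: "\<phi> (0 # L) = 0" for L using multilin_zero_slot[OF 3(3), of "[]"] by simp
  show ?case
  proof (cases xs)
    case Nil
    then show ?thesis using 3(4)[of "[]"] z by (simp add: comp_def id_cochain_def)
  next
    case (Cons a as)
    have "(\<Sum>hs\<leftarrow>substitutions (Suc k) []. block_value hs \<phi> xs) = (\<Sum>hs\<leftarrow>substitutions k []. block_value hs (\<lambda>L. \<phi> (a # L)) as)"
    proof -
      have "block_value ((1, id_cochain) # hs) \<phi> xs = block_value hs (\<lambda>L. \<phi> (a # L)) as" if "hs \<in> set (substitutions k [])" for hs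
        using substitutions_properties(1)[OF that] id_cochain_T[of "\<lambda>v s. block_value hs (\<lambda>L. \<phi> (v # L)) s" a as 0] z
        unfolding Cons by simp
      then show ?thesis by (simp add: comp_def cong: map_cong)
    qed
    also have "\<dots> = \<phi> (a # as)"
      using 3(1)[OF _ multilin_Cons[OF 3(3)], of a as] 3(4) by simp
    finally show ?thesis by (simp add: Cons)
  qed
next
  case (4 k g gs \<phi> xs)
  have z: "\<phi> (P @ 0 # L) = 0" for P L using multilin_zero_slot[OF 4(4)] by simp
  have z0: "\<phi> (0 # L) = 0" for L using z[of "[]"] by simp
  have g0: "snd (shift_arity g) [] = 0" using 4(3) by (simp add: shift_arity_def)
  have n: "\<phi> [] = 0" using 4(5) by simp
  have IH1: "(\<Sum>hs\<leftarrow>substitutions k (g # gs). block_value hs (\<lambda>L. \<phi> (a # L)) as) = ins (map shift_arity (g # gs)) (\<lambda>L. \<phi> (a # L)) as" for a as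
    by (rule 4(1)) (use 4(3-) in \<open>auto intro: multilin_Cons\<close>)
  have IH2: "(\<Sum>hs\<leftarrow>substitutions k gs. block_value hs (\<lambda>L. \<phi> (a # L)) as) = ins (map shift_arity gs) (\<lambda>L. \<phi> (a # L)) as" for a as
    by (rule 4(2)) (use 4(3-) in \<open>auto intro: multilin_Cons\<close>)
  \<comment> \<open>the substitutions that put the first proper block in the first position\<close>
  have b: "(\<Sum>hs\<leftarrow>map (Cons g) (substitutions k gs). block_value hs \<phi> xs) =
     cuts xs (\<lambda>q s. ins (map shift_arity gs) (\<lambda>L. \<phi> (snd g (T (excess gs) q) # L)) (B (fst g - 1) s))"
  proof -
    have "(\<Sum>hs\<leftarrow>map (Cons g) (substitutions k gs). block_value hs \<phi> xs) =
      (\<Sum>hs\<leftarrow>substitutions k gs. cuts xs (\<lambda>q s. block_value hs (\<lambda>L. \<phi> (snd g (T (excess gs) q) # L)) (B (fst g - 1) s)))"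
      by (simp add: comp_def substitutions_properties(1) cong: map_cong)
    also have "\<dots> = cuts xs (\<lambda>q s. \<Sum>hs\<leftarrow>substitutions k gs. block_value hs (\<lambda>L. \<phi> (snd g (T (excess gs) q) # L)) (B (fst g - 1) s))"
    proof -
      have "(\<Sum>hs\<leftarrow>hss. cuts xs (F hs)) = cuts xs (\<lambda>q s. \<Sum>hs\<leftarrow>hss. F hs q s)" for hss and F :: "_ \<Rightarrow> _ \<Rightarrow> _ \<Rightarrow> 'a"
        by (induction hss) (simp_all add: cuts_add)
      then show ?thesis .
    qed
    finally show ?thesis unfolding IH2 .
  qed
  show ?case
  proof (cases xs)
    case Nil
    have "block_value ((1, id_cochain) # hs) \<phi> [] = 0" for hs using z0 by (simp add: id_cochain_def)
    then show ?thesis using b ins_peel(1)[of "shift_arity g" \<phi> "map shift_arity gs", OF g0 n z] 4(3) z0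
      unfolding Nil by (simp add: comp_def)
  next
    case (Cons a as)
    have "(\<Sum>hs\<leftarrow>map (Cons (1, id_cochain)) (substitutions k (g # gs)). block_value hs \<phi> xs) =
       (\<Sum>hs\<leftarrow>substitutions k (g # gs). block_value hs (\<lambda>L. \<phi> (((\<lambda>x. - \<alpha> x) ^^ excess (g # gs)) a # L)) as)"
    proof -
      have "block_value ((1, id_cochain) # hs) \<phi> xs = block_value hs (\<lambda>L. \<phi> (((\<lambda>x. - \<alpha> x) ^^ excess (g # gs)) a # L)) as" if "hs \<in> set (substitutions k (g # gs))" for hs
        using substitutions_properties(1)[OF that] id_cochain_T[of "\<lambda>v s. block_value hs (\<lambda>L. \<phi> (v # L)) s" a as "excess (g # gs)"] z0
        unfolding Cons by simp
      then show ?thesis by (simp add: comp_def cong: map_cong)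
    qed
    then show ?thesis
      using b unfolding IH1 Cons substitutions.simps map_append sum_list_append list.map
      by (subst ins_peel(2)[of "shift_arity g" \<phi>, OF g0 n z]) (simp add: shift_arity_def add.commute del: ins_Cons cuts.simps)
  qed
qed

lemma id_cochain_in_C: "id_cochain \<in> C (Suc 0)"
proof -
  have "multilin id_cochain"
    unfolding multilin_def
  proof (intro allI)
    fix p q :: "'a list"
    show "lin (\<lambda>x. id_cochain (p @ x # q))"
      by (cases "p = [] \<and> q = []") (auto simp: lin_def id_cochain_def)
  qed
  then show ?thesis
    unfolding cochains_iff id_cochain_def
    by (auto simp: lin_zero lin_alpha lin_beta hd_map length_Suc_conv)
qed

text \<open>
  The signed sum over position sets becomes the sign-free insertion: the sign of every single
  substitution is the one absorbed into $\tau$ by \<open>block_value_eq_blocks\<close>, and \<open>sum_positions\<close> and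
  \<open>sum_block_value_eq_ins\<close> match the index sets.
\<close>

theorem homogeneous_brace_eq_ins:
  assumes "f \<in> C k" and "\<And>g. g \<in> set gs \<Longrightarrow> fst g \<ge> 1 \<and> snd g \<in> C (fst g)"
  shows "homogeneous_brace scale \<alpha> \<beta> (k, f) gs = ins (map shift_arity gs) f"
proof
  fix xs
  have f: "multilin f" "\<And>L. length L \<noteq> k \<Longrightarrow> f L = 0" using assms(1) by (auto simp: cochains_iff)
  have gamma: "gamma \<alpha> \<beta> f hs xs = (if length xs = sum_list (map fst hs) then f (blocks hs xs) else 0)" for hs
    unfolding gamma_def blocks_def by (simp add: sum_list_sum_nth atLeast0LessThan)
  have "scale ((-1) ^ block_sign hs) (gamma \<alpha> \<beta> f hs xs) = block_value hs f xs" if "hs \<in> set (substitutions k gs)" for hs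
  proof -
    have "fst h \<ge> 1 \<and> snd h \<in> C (fst h)" if "h \<in> set hs" for h
      using substitutions_properties(2)[OF \<open>hs \<in> set (substitutions k gs)\<close> that] assms(2)[of h] id_cochain_in_C by auto
    then show ?thesis
      by (subst block_value_eq_blocks) (simp_all only: gamma sg_scale f)
  qed
  note eq = this
  have "homogeneous_brace scale \<alpha> \<beta> (k, f) gs xs =
     (\<Sum>S\<in>positions k (length gs). scale ((-1) ^ block_sign (substitution k gs S)) (gamma \<alpha> \<beta> f (substitution k gs S) xs))"
    unfolding homogeneous_brace_def positions_def
    by (intro sum.cong) (auto simp: substitution_sign_eq)
  also have "\<dots> = (\<Sum>hs\<leftarrow>substitutions k gs. scale ((-1) ^ block_sign hs) (gamma \<alpha> \<beta> f hs xs))"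
    by (rule sum_positions)
  also have "\<dots> = (\<Sum>hs\<leftarrow>substitutions k gs. block_value hs f xs)"
    using eq by (simp cong: map_cong)
  also have "\<dots> = ins (map shift_arity gs) f xs"
  proof (rule sum_block_value_eq_ins)
    fix g assume "g \<in> set gs"
    then have "snd g \<in> C (fst g)" "fst g \<noteq> 0" using assms(2)[of g] by auto
    then show "snd g [] = 0" by (simp add: cochains_iff)
  qed (rule f, rule f)
  finally show "homogeneous_brace scale \<alpha> \<beta> (k, f) gs xs = ins (map shift_arity gs) f xs" .
qed

end

section \<open>Braces on the direct sum of all arities\<close>

lemma listset_iff: "xs \<in> listset As \<longleftrightarrow> list_all2 (\<lambda>x A. x \<in> A) xs As"
  by (induction As arbitrary: xs) (auto simp: set_Cons_def list_all2_Cons2)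

lemma finite_listset: "(\<And>A. A \<in> set As \<Longrightarrow> finite A) \<Longrightarrow> finite (listset As)"
proof (induction As)
  case (Cons A As)
  have "set_Cons A (listset As) = (\<lambda>(x, xs). x # xs) ` (A \<times> listset As)"
    by (auto simp: set_Cons_def)
  then show ?case using Cons by simp
qed simp

lemma component_outside: "n \<notin> arity_set f \<Longrightarrow> component n f = (\<lambda>_. 0)"
  unfolding component_def arity_set_def by auto

lemma component_add: "component n (f + g) = component n f + component n g"
  for f g :: "'a::ab_group_add cochain"
  by (auto simp: component_def)

lemma component_zero [simp]: "component n (0 :: 'a::ab_group_add cochain) = 0"
  by (auto simp: component_def)

lemma sum_fun_apply: "(\<Sum>i\<in>I. F i) x = (\<Sum>i\<in>I. F i x)"
  for F :: "'i \<Rightarrow> 'b \<Rightarrow> 'c::comm_monoid_add"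
  by (induction I rule: infinite_finite_induct) simp_all

context bihom_associative_algebra
begin

abbreviation M where "M \<equiv> hoch_complex scale \<alpha> \<beta>"
abbreviation CC where "CC \<equiv> carrier M"

definition fscale :: "'k \<Rightarrow> 'a cochain \<Rightarrow> 'a cochain" where
  "fscale c f = (\<lambda>xs. scale c (f xs))"

lemma fscale_apply: "fscale c f xs = scale c (f xs)"
  by (simp add: fscale_def)

lemma CC_iff: "f \<in> CC \<longleftrightarrow> f [] = 0 \<and> finite (arity_set f) \<and> (\<forall>n\<ge>1. component n f \<in> C n)"
  by (simp add: hoch_complex_def)

lemma C_zero: "0 \<in> C n" and C_add: "f \<in> C n \<Longrightarrow> g \<in> C n \<Longrightarrow> f + g \<in> C n"
  and C_scale: "f \<in> C n \<Longrightarrow> fscale c f \<in> C n" and C_uminus: "f \<in> C n \<Longrightarrow> - f \<in> C n"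
  unfolding cochains_iff multilin_def
  by (auto simp: lin_const_zero lin_sum2 lin_neg lin_scaled lin_zero lin_alpha lin_beta lin_add[OF lin_alpha] lin_add[OF lin_beta]
      lin_uminus[OF lin_alpha] lin_uminus[OF lin_beta] lin_scale[OF lin_alpha] lin_scale[OF lin_beta] fscale_def)

lemma C_diff: "f \<in> C n \<Longrightarrow> g \<in> C n \<Longrightarrow> f - g \<in> C n"
  using C_add[of f n "- g"] C_uminus[of g n] by simp

lemma C_sg: "f \<in> C n \<Longrightarrow> sg k f \<in> C n"
  by (simp add: sg_def C_uminus)

lemma component_fscale: "component n (fscale c f) = fscale c (component n f)"
  by (auto simp: component_def fscale_def)

lemma component_uminus: "component n (- f) = - component n f"
  for f :: "'a cochain"
  by (auto simp: component_def)

lemma arity_set_add: "arity_set (f + g) \<subseteq> arity_set f \<union> arity_set g" for f g :: "'a cochain"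
  by (auto simp: arity_set_def)

lemma arity_set_scale: "arity_set (fscale c f) \<subseteq> arity_set f"
  by (auto simp: arity_set_def fscale_def)

lemma CC_zero: "0 \<in> CC" and CC_add: "f \<in> CC \<Longrightarrow> g \<in> CC \<Longrightarrow> f + g \<in> CC"
  and CC_scale: "f \<in> CC \<Longrightarrow> fscale c f \<in> CC" and CC_uminus: "f \<in> CC \<Longrightarrow> - f \<in> CC"
proof -
  show "0 \<in> CC" by (simp add: CC_iff C_zero arity_set_def)
  show "f + g \<in> CC" if "f \<in> CC" "g \<in> CC"
    using that arity_set_add[of f g] by (auto simp: CC_iff component_add C_add intro: finite_subset)
  show "fscale c f \<in> CC" if "f \<in> CC"
    using that arity_set_scale[of c f] by (auto simp: CC_iff component_fscale C_scale fscale_apply intro: finite_subset)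
  show "- f \<in> CC" if "f \<in> CC"
    using that by (auto simp: CC_iff component_uminus C_uminus arity_set_def)
qed

lemma CC_diff: "f \<in> CC \<Longrightarrow> g \<in> CC \<Longrightarrow> f - g \<in> CC"
  using CC_add[of f "- g"] CC_uminus[of g] by simp

lemma CC_sg: "f \<in> CC \<Longrightarrow> sg k f \<in> CC"
  by (simp add: sg_def CC_uminus)

lemma CC_sum: "(\<And>i. i \<in> I \<Longrightarrow> F i \<in> CC) \<Longrightarrow> (\<Sum>i\<in>I. F i) \<in> CC"
  by (induction I rule: infinite_finite_induct) (auto intro: CC_zero CC_add)

lemma component_C: "f \<in> C n \<Longrightarrow> component m f = (if m = n then f else 0)"
  unfolding cochains_iff component_def by (auto simp: fun_eq_iff)

lemma arity_set_C: "f \<in> C n \<Longrightarrow> arity_set f \<subseteq> {n}"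
  unfolding cochains_iff arity_set_def by auto

lemma C_subset_CC: "f \<in> C (Suc e) \<Longrightarrow> f \<in> CC"
proof -
  assume f: "f \<in> C (Suc e)"
  then have "f [] = 0" by (simp add: cochains_iff)
  moreover have "finite (arity_set f)" by (rule finite_subset[OF arity_set_C[OF f]]) simp
  ultimately show "f \<in> CC" using f by (auto simp: CC_iff component_C C_zero)
qed

lemma CC_arity: "f \<in> CC \<Longrightarrow> 0 \<notin> arity_set f" "f \<in> CC \<Longrightarrow> finite (arity_set f)"
  by (auto simp: CC_iff arity_set_def)

lemma CC_component: "f \<in> CC \<Longrightarrow> n \<noteq> 0 \<Longrightarrow> component n f \<in> C n"
  by (simp add: CC_iff)

definition comp_block :: "nat \<Rightarrow> 'a cochain \<Rightarrow> nat \<times> 'a cochain" where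
  "comp_block n g = (n - 1, component n g)"

lemma ins_zero_block:
  assumes "multilin \<phi>" and "x \<in> set G" and "snd x = (\<lambda>_. 0)"
  shows "ins G \<phi> as = 0"
proof -
  obtain Y W where "G = Y @ x # W" using assms(2) by (meson split_list)
  then show ?thesis
    using assms(3) multilin_zero_slot[OF assms(1)] by (simp add: ins_node)
qed

text \<open>
  The arity sets may be replaced by larger finite sets, since components of other arities vanish.
  With a common superset for several cochains, multilinearity can be read off summand by summand.
\<close>

lemma hoch_brace_eq_sum:
  assumes f: "f \<in> CC" and gs: "set gs \<subseteq> CC"
    and A: "finite A" "arity_set f \<subseteq> A" "0 \<notin> A"
    and As: "list_all2 (\<lambda>A g. finite A \<and> arity_set g \<subseteq> A \<and> 0 \<notin> A) As gs"
  shows "hoch_brace scale \<alpha> \<beta> f gs =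
    (\<lambda>xs. \<Sum>k\<in>A. \<Sum>ns\<in>listset As. ins (map2 comp_block ns gs) (component k f) xs)"
proof
  fix xs
  have hb: "homogeneous_brace scale \<alpha> \<beta> (k, component k f) (map2 (\<lambda>n g. (n, component n g)) ns gs) =
      ins (map2 comp_block ns gs) (component k f)"
    if "k \<in> A" "ns \<in> listset As" for k ns
  proof -
    have l: "length ns = length gs"
      using that As unfolding listset_iff by (auto dest!: list_all2_lengthD)
    have nz: "ns ! i \<noteq> 0" "gs ! i \<in> CC" if "i < length gs" for i
      using that \<open>ns \<in> listset As\<close> As gs l unfolding listset_iff list_all2_conv_all_nth by (metis, auto)
    have "homogeneous_brace scale \<alpha> \<beta> (k, component k f) (map2 (\<lambda>n g. (n, component n g)) ns gs) =
      ins (map shift_arity (map2 (\<lambda>n g. (n, component n g)) ns gs)) (component k f)"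
    proof (rule homogeneous_brace_eq_ins)
      have "k \<noteq> 0" using that A(3) by (cases k) auto
      then show "component k f \<in> C k" by (rule CC_component[OF f])
      fix g assume "g \<in> set (map2 (\<lambda>n g. (n, component n g)) ns gs)"
      then obtain i where i: "i < length gs" "g = (ns ! i, component (ns ! i) (gs ! i))"
        using l by (auto simp: set_zip)
      then show "fst g \<ge> 1 \<and> snd g \<in> C (fst g)"
        using nz[of i] CC_component by auto
    qed
    also have "map shift_arity (map2 (\<lambda>n g. (n, component n g)) ns gs) = map2 comp_block ns gs"
      by (auto simp: shift_arity_def comp_block_def)
    finally show ?thesis .
  qed
  have fin: "finite (listset As)"
    by (rule finite_listset) (use As in \<open>auto simp: list_all2_conv_all_nth in_set_conv_nth\<close>)
  have sub: "listset (map arity_set gs) \<subseteq> listset As"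
    using As unfolding listset_iff list_all2_conv_all_nth subset_iff by (auto simp: listset_iff list_all2_conv_all_nth)
  have "hoch_brace scale \<alpha> \<beta> f gs xs =
    (\<Sum>k\<in>arity_set f. \<Sum>ns\<in>listset (map arity_set gs). ins (map2 comp_block ns gs) (component k f) xs)"
    unfolding hoch_brace_def
  proof (intro sum.cong refl)
    fix k ns assume "k \<in> arity_set f" "ns \<in> listset (map arity_set gs)"
    then show "homogeneous_brace scale \<alpha> \<beta> (k, component k f) (map2 (\<lambda>n g. (n, component n g)) ns gs) xs
      = ins (map2 comp_block ns gs) (component k f) xs"
      using hb[OF subsetD[OF A(2)] subsetD[OF sub]] by simp
  qed
  also have "\<dots> = (\<Sum>k\<in>arity_set f. \<Sum>ns\<in>listset As. ins (map2 comp_block ns gs) (component k f) xs)"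
  proof (rule sum.cong[OF refl], rule sum.mono_neutral_left[OF fin sub], rule ballI)
    fix k ns assume k: "k \<in> arity_set f" and ns: "ns \<in> listset As - listset (map arity_set gs)"
    have "multilin (component k f)"
      using CC_component[OF f, of k] k CC_arity[OF f] by (cases k) (auto simp: cochains_iff)
    moreover have l: "length ns = length gs"
      using ns list_all2_lengthD[OF As] unfolding listset_iff by (metis DiffD1 list_all2_lengthD listset_iff)
    moreover obtain i where i: "i < length gs" "ns ! i \<notin> arity_set (gs ! i)"
      using ns l by (auto simp: listset_iff list_all2_conv_all_nth)
    moreover have "map2 comp_block ns gs ! i \<in> set (map2 comp_block ns gs)"
      using i l by (intro nth_mem) simp
    ultimately show "ins (map2 comp_block ns gs) (component k f) xs = 0"
      by (intro ins_zero_block) (auto simp: comp_block_def component_outside)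
  qed
  also have "\<dots> = (\<Sum>k\<in>A. \<Sum>ns\<in>listset As. ins (map2 comp_block ns gs) (component k f) xs)"
    by (intro sum.mono_neutral_left A ballI sum.neutral) (auto simp: component_outside)
  finally show "hoch_brace scale \<alpha> \<beta> f gs xs =
    (\<Sum>k\<in>A. \<Sum>ns\<in>listset As. ins (map2 comp_block ns gs) (component k f) xs)" .
qed

definition homogeneous :: "nat list \<Rightarrow> 'a cochain list \<Rightarrow> bool" where
  "homogeneous es gs \<longleftrightarrow> list_all2 (\<lambda>e g. g \<in> C (Suc e)) es gs"

lemma homogeneous_cochain_block:
  assumes "homogeneous es gs" "x \<in> set (zip es gs)" shows "cochain_block x"
  using assms by (cases x) (auto simp: homogeneous_def list_all2_iff cochain_block_def)

lemma homogeneous_CC: "homogeneous es gs \<Longrightarrow> set gs \<subseteq> CC"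
  unfolding homogeneous_def list_all2_conv_all_nth by (metis C_subset_CC in_set_conv_nth subsetI)

theorem hoch_brace_eq_ins:
  assumes f: "f \<in> C (Suc e)" and gs: "homogeneous es gs"
  shows "hoch_brace scale \<alpha> \<beta> f gs = ins (zip es gs) f"
proof -
  let ?As = "map (\<lambda>e. {Suc e}) es"
  have ls: "listset ?As = {map Suc es}"
    by (induction es) (auto simp: set_Cons_def)
  have len: "length es = length gs" using gs by (auto simp: homogeneous_def list_all2_lengthD)
  have z: "map2 comp_block (map Suc es) gs = zip es gs"
    using gs len by (intro nth_equalityI) (auto simp: comp_block_def component_C homogeneous_def list_all2_conv_all_nth)
  have "hoch_brace scale \<alpha> \<beta> f gs =
    (\<lambda>xs. \<Sum>k\<in>{Suc e}. \<Sum>ns\<in>listset ?As. ins (map2 comp_block ns gs) (component k f) xs)"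
  proof (rule hoch_brace_eq_sum)
    show "list_all2 (\<lambda>A g. finite A \<and> arity_set g \<subseteq> A \<and> 0 \<notin> A) ?As gs"
      using gs arity_set_C unfolding homogeneous_def list_all2_conv_all_nth by fastforce
  qed (use arity_set_C[OF f] C_subset_CC[OF f] homogeneous_CC[OF gs] in auto)
  then show ?thesis using f by (simp add: ls z component_C)
qed

text \<open>
  A common set of arities for all arguments, as needed by \<open>hoch_brace_eq_sum\<close>; it must avoid
  $0$, since blocks have arity at least one.
\<close>

lemma common_bound:
  assumes "set gs \<subseteq> CC"
  obtains N where "list_all2 (\<lambda>A g. finite A \<and> arity_set g \<subseteq> A \<and> 0 \<notin> A) (replicate (length gs) {1..N}) gs"
proof -
  have fin: "finite (\<Union>g\<in>set gs. arity_set g)" using assms CC_arity by auto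
  have N: "n \<le> Max (\<Union>g\<in>set gs. arity_set g)" if "n \<in> (\<Union>g\<in>set gs. arity_set g)" for n
    using fin that by (rule Max_ge)
  define N where "N = Max (\<Union>g\<in>set gs. arity_set g)"
  note N = N[folded N_def]
  show ?thesis
  proof (rule that[of N])
    show "list_all2 (\<lambda>A g. finite A \<and> arity_set g \<subseteq> A \<and> 0 \<notin> A) (replicate (length gs) {1..N}) gs"
      unfolding list_all2_conv_all_nth
    proof (intro conjI allI impI)
      fix i assume "i < length (replicate (length gs) {1..N})"
      then have i: "i < length gs" by simp
      have "gs ! i \<in> CC" using assms nth_mem[OF i] by blast
      then have "0 \<notin> arity_set (gs ! i)" by (rule CC_arity)
      moreover have "n \<le> N" if "n \<in> arity_set (gs ! i)" for n
        using N that nth_mem[OF i] by blast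
      ultimately have "arity_set (gs ! i) \<subseteq> {1..N}"
        by (metis atLeastAtMost_iff less_one not_less subsetI)
      then show "arity_set (gs ! i) \<subseteq> replicate (length gs) {1..N} ! i"
        using i by simp
    qed auto
  qed
qed

lemma hoch_brace_CC:
  assumes f: "f \<in> CC" and gs: "set gs \<subseteq> CC"
  shows "hoch_brace scale \<alpha> \<beta> f gs \<in> CC"
proof -
  obtain N where As: "list_all2 (\<lambda>A g. finite A \<and> arity_set g \<subseteq> A \<and> 0 \<notin> A) (replicate (length gs) {1..N}) gs"
    using common_bound[OF gs] .
  let ?As = "replicate (length gs) {1..N}"
  have "hoch_brace scale \<alpha> \<beta> f gs =
    (\<Sum>k\<in>arity_set f. \<Sum>ns\<in>listset ?As. ins (map2 comp_block ns gs) (component k f))"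
    using hoch_brace_eq_sum[OF f gs CC_arity(2)[OF f] order_refl CC_arity(1)[OF f] As]
    by (simp add: fun_eq_iff sum_fun_apply)
  also have "\<dots> \<in> CC"
  proof (intro CC_sum)
    fix k ns assume k: "k \<in> arity_set f" and ns: "ns \<in> listset ?As"
    then have k0: "k \<noteq> 0" using CC_arity(1)[OF f] by (cases k) auto
    have "ins (map2 comp_block ns gs) (component k f) \<in> C (k + weight (map2 comp_block ns gs))"
    proof (rule ins_cochain)
      show "component k f \<in> C k" by (rule CC_component[OF f k0])
      fix y assume "y \<in> set (map2 comp_block ns gs)"
      then obtain i where i: "i < length gs" "i < length ns" "y = comp_block (ns ! i) (gs ! i)"
        by (auto simp: set_zip)
      then have "ns ! i \<noteq> 0" using ns by (auto simp: listset_iff list_all2_conv_all_nth)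
      moreover have "gs ! i \<in> CC" using gs nth_mem[OF i(1)] by blast
      ultimately have "component (ns ! i) (gs ! i) \<in> C (ns ! i)" by (intro CC_component)
      then show "cochain_block y"
        using i \<open>ns ! i \<noteq> 0\<close> by (simp add: cochain_block_def comp_block_def)
    qed
    then show "ins (map2 comp_block ns gs) (component k f) \<in> CC"
      using k0 C_subset_CC by (cases k) auto
  qed
  finally show ?thesis .
qed

lemma ins_plus: "ins G (\<phi> + \<psi>) as = ins G \<phi> as + ins G \<psi> as"
  by (simp add: plus_fun_def ins_add)

lemma ins_fscale: "ins G (fscale c \<phi>) as = scale c (ins G \<phi> as)"
  by (simp add: fscale_def ins_scale)

lemma hoch_brace_linear_head:
  assumes f: "f \<in> CC" "f' \<in> CC" and gs: "set gs \<subseteq> CC"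
  shows "hoch_brace scale \<alpha> \<beta> (f + f') gs = hoch_brace scale \<alpha> \<beta> f gs + hoch_brace scale \<alpha> \<beta> f' gs" (is ?add)
    and "hoch_brace scale \<alpha> \<beta> (fscale c f) gs = fscale c (hoch_brace scale \<alpha> \<beta> f gs)" (is ?scale)
proof -
  obtain N where As: "list_all2 (\<lambda>A g. finite A \<and> arity_set g \<subseteq> A \<and> 0 \<notin> A) (replicate (length gs) {1..N}) gs"
    using common_bound[OF gs] .
  let ?A = "arity_set f \<union> arity_set f'"
  have A: "finite ?A" "0 \<notin> ?A" using f CC_arity by auto
  note eq = hoch_brace_eq_sum[OF _ gs A(1) _ A(2) As]
  show ?add
    unfolding eq[OF CC_add[OF f] arity_set_add] eq[OF f(1) Un_upper1] eq[OF f(2) Un_upper2]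
    by (auto simp: fun_eq_iff component_add ins_plus sum.distrib)
  have "arity_set (fscale c f) \<subseteq> ?A" using arity_set_scale[of c f] by auto
  note eq' = eq[OF CC_scale[OF f(1)] this]
  show ?scale
    unfolding eq' eq[OF f(1) Un_upper1]
    by (auto simp: fun_eq_iff component_fscale ins_fscale fscale_apply scale_sum_right)
qed

lemma ins_block_linear:
  assumes "multilin \<phi>"
  shows "ins (Y @ (e, g + g') # W) \<phi> as = ins (Y @ (e, g) # W) \<phi> as + ins (Y @ (e, g') # W) \<phi> as"
    and "ins (Y @ (e, fscale c g) # W) \<phi> as = scale c (ins (Y @ (e, g) # W) \<phi> as)"
proof -
  have "\<phi> (p @ (x + y) # q) = \<phi> (p @ x # q) + \<phi> (p @ y # q)" "\<phi> (p @ scale c x # q) = scale c (\<phi> (p @ x # q))" for p x y q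
    using assms by (auto simp: multilin_def lin_def)
  then show "ins (Y @ (e, g + g') # W) \<phi> as = ins (Y @ (e, g) # W) \<phi> as + ins (Y @ (e, g') # W) \<phi> as"
    "ins (Y @ (e, fscale c g) # W) \<phi> as = scale c (ins (Y @ (e, g) # W) \<phi> as)"
    by (simp_all add: ins_node ins_add cuts_add fscale_apply ins_scale[symmetric] cuts_scale[symmetric])
qed

lemma hoch_brace_linear_arg:
  assumes f: "f \<in> CC" and gs: "set gs1 \<subseteq> CC" "set gs2 \<subseteq> CC" and g: "g \<in> CC" "g' \<in> CC"
  shows "hoch_brace scale \<alpha> \<beta> f (gs1 @ (g + g') # gs2) =
      hoch_brace scale \<alpha> \<beta> f (gs1 @ g # gs2) + hoch_brace scale \<alpha> \<beta> f (gs1 @ g' # gs2)" (is ?add)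
    and "hoch_brace scale \<alpha> \<beta> f (gs1 @ fscale c g # gs2) = fscale c (hoch_brace scale \<alpha> \<beta> f (gs1 @ g # gs2))" (is ?scale)
proof -
  let ?gs = "\<lambda>g. gs1 @ g # gs2"
  have "set (gs1 @ gs2) \<subseteq> CC" using gs by simp
  then obtain N where N: "list_all2 (\<lambda>A g. finite A \<and> arity_set g \<subseteq> A \<and> 0 \<notin> A) (replicate (length (gs1 @ gs2)) {1..N}) (gs1 @ gs2)"
    using common_bound by blast
  let ?A = "arity_set g \<union> arity_set g'"
  let ?As = "replicate (length gs1) {1..N} @ ?A # replicate (length gs2) {1..N}"
  have A: "finite ?A" "0 \<notin> ?A" using g CC_arity by auto
  have As: "list_all2 (\<lambda>A g. finite A \<and> arity_set g \<subseteq> A \<and> 0 \<notin> A) ?As (?gs h)" if "arity_set h \<subseteq> ?A" for h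
  proof -
    have "list_all2 (\<lambda>A g. finite A \<and> arity_set g \<subseteq> A \<and> 0 \<notin> A) (replicate (length gs1) {1..N}) gs1"
      "list_all2 (\<lambda>A g. finite A \<and> arity_set g \<subseteq> A \<and> 0 \<notin> A) (replicate (length gs2) {1..N}) gs2"
      using N by (auto simp: replicate_add list_all2_append)
    then show ?thesis using that A by (simp add: list_all2_appendI)
  qed
  have eq: "hoch_brace scale \<alpha> \<beta> f (?gs h) =
    (\<lambda>xs. \<Sum>k\<in>arity_set f. \<Sum>ns\<in>listset ?As. ins (map2 comp_block ns (?gs h)) (component k f) xs)"
    if "h \<in> CC" "arity_set h \<subseteq> ?A" for h
    by (rule hoch_brace_eq_sum[OF f _ CC_arity(2)[OF f] order_refl CC_arity(1)[OF f] As]) (use gs that in auto)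
  have m: "multilin (component k f)" if "k \<in> arity_set f" for k
    using CC_component[OF f, of k] that CC_arity[OF f] by (cases k) (auto simp: cochains_iff)
  have split: "map2 comp_block ns (?gs h) = map2 comp_block (take (length gs1) ns) gs1 @
     (ns ! length gs1 - 1, component (ns ! length gs1) h) # map2 comp_block (drop (Suc (length gs1)) ns) gs2"
    if "ns \<in> listset ?As" for ns h
  proof -
    have l: "length ns = length gs1 + Suc (length gs2)"
      using that by (auto simp: listset_iff dest!: list_all2_lengthD)
    have "zip ns (?gs h) = zip (take (length gs1) ns) gs1 @ zip (drop (length gs1) ns) (h # gs2)"
      by (rule zip_append2)
    also have "drop (length gs1) ns = ns ! length gs1 # drop (Suc (length gs1)) ns"
      using l by (simp add: Cons_nth_drop_Suc)
    finally show ?thesis by (simp add: comp_block_def)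
  qed
  show ?add
    unfolding eq[OF CC_add[OF g] arity_set_add] eq[OF g(1) Un_upper1] eq[OF g(2) Un_upper2]
    by (auto simp: fun_eq_iff split component_add ins_block_linear m sum.distrib intro!: sum.cong)
  have "arity_set (fscale c g) \<subseteq> ?A" using arity_set_scale[of c g] by auto
  note eq' = eq[OF CC_scale[OF g(1)] this]
  show ?scale
    unfolding eq' eq[OF g(1) Un_upper1]
    by (auto simp: fun_eq_iff split component_fscale fscale_apply ins_block_linear m scale_sum_right)
qed

end

section \<open>Insertions involving the multiplication cochain\<close>

lemma cuts_eq_first: "(\<And>p q. p \<noteq> [] \<Longrightarrow> F p q = 0) \<Longrightarrow> cuts xs F = F [] xs"
proof (cases xs)
  case (Cons x ys)
  assume "\<And>p q. p \<noteq> [] \<Longrightarrow> F p q = 0"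
  then have "cuts ys (\<lambda>p q. F (x # p) q) = cuts ys (\<lambda>p q. 0)" by (intro cuts_cong) simp
  then show ?thesis by (simp add: Cons)
qed simp

lemma cuts_eq_last: "(\<And>p q. q \<noteq> [] \<Longrightarrow> F p q = 0) \<Longrightarrow> cuts xs F = F xs []"
  by (induction xs arbitrary: F) simp_all

lemma cuts_eq_last_two:
  assumes "\<And>p q. length q > 1 \<Longrightarrow> F p q = 0" and "xs \<noteq> []"
  shows "cuts xs F = F xs [] + F (butlast xs) [last xs]"
  using assms
proof (induction xs arbitrary: F)
  case (Cons x xs)
  show ?case
  proof (cases xs)
    case Nil
    then show ?thesis by (simp add: add.commute)
  next
    case (Cons y ys)
    then show ?thesis using Cons.IH[of "\<lambda>p q. F (x # p) q"] Cons.prems by simp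
  qed
qed simp

text \<open>
  The splittings that survive for $\{m\}\{\dots\}$: at most one entry remains outside the middle
  part.
\<close>

lemma cuts3_outer_short:
  assumes F: "\<And>p q r. length p + length r > 1 \<Longrightarrow> F p q r = 0" and "xs \<noteq> []"
  shows "cuts xs (\<lambda>p t. cuts t (\<lambda>q r. F p q r)) = F [] xs [] + F [hd xs] (tl xs) [] + F [] (butlast xs) [last xs]"
proof -
  obtain x ys where xs: "xs = x # ys" using assms(2) by (cases xs) auto
  have "cuts xs (\<lambda>p t. cuts t (\<lambda>q r. F p q r)) =
     cuts xs (\<lambda>q r. F [] q r) + cuts ys (\<lambda>p t. cuts t (\<lambda>q r. F (x # p) q r))"
    by (simp add: xs)
  also have "cuts xs (\<lambda>q r. F [] q r) = F [] xs [] + F [] (butlast xs) [last xs]"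
    using assms by (intro cuts_eq_last_two) auto
  also have "cuts ys (\<lambda>p t. cuts t (\<lambda>q r. F (x # p) q r)) = cuts ys (\<lambda>q r. F [x] q r)"
  proof (rule cuts_eq_first)
    fix p t :: "'a list" assume "p \<noteq> []"
    then have "cuts t (\<lambda>q r. F (x # p) q r) = cuts t (\<lambda>q r. 0)"
      by (intro cuts_cong F) (cases p; simp)
    then show "cuts t (\<lambda>q r. F (x # p) q r) = 0" by simp
  qed
  also have "\<dots> = F [x] ys []"
    by (rule cuts_eq_last) (rule F, simp)
  finally show ?thesis by (simp add: xs ac_simps)
qed

text \<open>
  The splittings that survive when the middle part is inserted into $m$: it has at most two
  entries.
\<close>

lemma cuts3_middle_short:
  assumes F: "\<And>p q r. length q > 2 \<Longrightarrow> F p q r = 0"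
  shows "cuts xs (\<lambda>p t. cuts t (\<lambda>q r. F p q r)) =
    (\<Sum>i\<le>length xs. F (take i xs) [] (drop i xs))
    + (\<Sum>i<length xs. F (take i xs) [xs ! i] (drop (Suc i) xs))
    + (\<Sum>i<length xs - 1. F (take i xs) [xs ! i, xs ! Suc i] (drop (i + 2) xs))"
  using assms
proof (induction xs arbitrary: F)
  case (Cons x xs)
  have IH: "cuts xs (\<lambda>p t. cuts t (\<lambda>q r. F (x # p) q r)) =
    (\<Sum>i\<le>length xs. F (x # take i xs) [] (drop i xs))
    + (\<Sum>i<length xs. F (x # take i xs) [xs ! i] (drop (Suc i) xs))
    + (\<Sum>i<length xs - 1. F (x # take i xs) [xs ! i, xs ! Suc i] (drop (i + 2) xs))"
    by (rule Cons.IH) (rule Cons.prems)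
  have one: "(\<Sum>i\<le>Suc (length xs). F (take i (x # xs)) [] (drop i (x # xs))) =
     F [] [] (x # xs) + (\<Sum>i\<le>length xs. F (x # take i xs) [] (drop i xs))"
    "(\<Sum>i<Suc (length xs). F (take i (x # xs)) [(x # xs) ! i] (drop (Suc i) (x # xs))) =
     F [] [x] xs + (\<Sum>i<length xs. F (x # take i xs) [xs ! i] (drop (Suc i) xs))"
    by (simp_all add: sum.atMost_Suc_shift sum.lessThan_Suc_shift del: sum.atMost_Suc sum.lessThan_Suc)
  show ?case
  proof (cases xs)
    case Nil
    then show ?thesis by (simp add: add.commute add.left_commute)
  next
    case (Cons y ys)
    have three: "cuts ys (\<lambda>q r. F [] (x # y # q) r) = F [] [x, y] ys"
      by (rule cuts_eq_first) (rule Cons.prems, simp)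
    have two: "(\<Sum>i<length xs. F (take i (x # xs)) [(x # xs) ! i, (x # xs) ! Suc i] (drop (i + 2) (x # xs))) =
      F [] [x, y] ys + (\<Sum>i<length xs - 1. F (x # take i xs) [xs ! i, xs ! Suc i] (drop (i + 2) xs))"
      by (simp add: Cons sum.lessThan_Suc_shift del: sum.lessThan_Suc)
    have "cuts (x # xs) (\<lambda>p t. cuts t (\<lambda>q r. F p q r)) =
      F [] [] (x # xs) + (F [] [x] xs + F [] [x, y] ys) + cuts xs (\<lambda>p t. cuts t (\<lambda>q r. F (x # p) q r))"
      by (simp add: Cons three)
    then show ?thesis
      unfolding IH length_Cons one diff_Suc_1 two by (simp add: ac_simps)
  qed
qed simp

context twisted_insertion
begin

declare ins_Cons [simp del]

lemma block_brace_Nil [simp]: "block_brace x [] = x"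
  by (simp add: block_brace_def)

lemma brace_sum_Nil [simp]: "brace_sum H [] \<Phi> = \<Phi> H"
  by (induction H arbitrary: \<Phi>) simp_all

lemma brace_sum_single_left:
  "brace_sum [x] Y \<Phi> = cuts Y (\<lambda>Y1 R. cuts R (\<lambda>Y2 Y3. sg (fst x * weight Y1) (\<Phi> (Y1 @ block_brace x Y2 # Y3))))"
  by simp

text \<open>
  A single block \<open>y\<close> is either placed between two members of \<open>H\<close> or inserted into one of
  them.
\<close>

lemma brace_sum_single_right:
  "brace_sum H [y] \<Phi> =
     (\<Sum>i\<le>length H. sg (fst y * weight (drop i H)) (\<Phi> (take i H @ y # drop i H)))
     + (\<Sum>i<length H. sg (fst y * weight (drop (Suc i) H)) (\<Phi> (take i H @ block_brace (H ! i) [y] # drop (Suc i) H)))"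
proof (induction H arbitrary: \<Phi>)
  case (Cons x H)
  show ?case
    by (simp add: Cons.IH sum.atMost_Suc_shift sum.lessThan_Suc_shift algebra_simps del: sum.atMost_Suc sum.lessThan_Suc)
qed simp

lemma additive_brace_sum:
  assumes "\<And>x y. h (x + y) = h x + h y"
  shows "h (brace_sum H Y \<Phi>) = brace_sum H Y (\<lambda>W. h (\<Phi> W))"
  by (induction H arbitrary: Y \<Phi>) (simp_all add: additive_cuts[of h, OF assms] additive_minus(4)[of h, OF assms])

lemma brace_sum_apply: "brace_sum H Y \<Phi> as = brace_sum H Y (\<lambda>W. \<Phi> W as)"
  by (rule additive_brace_sum[of "\<lambda>f. f as"]) simp

lemma ins_ins_fun:
  assumes "\<And>y. y \<in> set Y \<Longrightarrow> block y" and "\<And>x. x \<in> set H \<Longrightarrow> multiadditive (snd x)" and "multiadditive \<phi>"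
  shows "ins Y (ins H \<phi>) = brace_sum H Y (\<lambda>W. ins W \<phi>)"
  by (rule ext) (simp only: brace_sum_apply ins_ins[OF assms])

text \<open>
  Every block contributes one entry to the resulting lists, so these are at least as long as the
  list of blocks.
\<close>

lemma ins_too_many:
  assumes "\<And>L. length L \<ge> length Z \<Longrightarrow> \<phi> L = 0"
  shows "ins Z \<phi> = (\<lambda>as. 0)"
  using assms
proof (induction Z arbitrary: \<phi>)
  case (Cons x Z)
  have "ins Z (\<lambda>L. \<phi> (T (fst x + weight Z) p @ snd x (T (weight Z) q) # L)) = (\<lambda>as. 0)" for p q
    by (rule Cons.IH) (rule Cons.prems, simp)
  then show ?case by (simp add: ins_Cons)
qed auto

lemma sum_sg: "(\<Sum>i\<in>A. sg k (F i)) = sg k (\<Sum>i\<in>A. F i)"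
  by (simp add: sg_def sum_negf)

lemma brace_sum_eq_0:
  assumes "\<And>W. length W \<ge> length H \<Longrightarrow> \<Phi> W = 0"
  shows "brace_sum H Y \<Phi> = 0"
  using assms
proof (induction H arbitrary: Y \<Phi>)
  case (Cons x H)
  have "brace_sum H Y3 (\<lambda>W. sg k (\<Phi> (Y1 @ z # W))) = 0" for Y3 k Y1 z
    by (rule Cons.IH) (simp add: Cons.prems)
  then show ?case by simp
qed simp

lemma brace_sum_single_short:
  assumes "\<And>W. length W > 1 \<Longrightarrow> \<Phi> W = 0"
  shows "brace_sum [x] Y \<Phi> = \<Phi> [block_brace x Y]"
proof -
  have "brace_sum [x] Y \<Phi> = cuts Y (\<lambda>Y2 Y3. \<Phi> (block_brace x Y2 # Y3))"
    unfolding brace_sum_single_left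
  proof (subst cuts_eq_first)
    fix Y1 R :: "(nat \<times> ('a list \<Rightarrow> 'a)) list" assume "Y1 \<noteq> []"
    then have "\<Phi> (Y1 @ z # Y3) = 0" for z Y3
      by (intro assms) (cases Y1; simp)
    then show "cuts R (\<lambda>Y2 Y3. sg (fst x * weight Y1) (\<Phi> (Y1 @ block_brace x Y2 # Y3))) = 0" by simp
  qed simp
  also have "\<dots> = \<Phi> [block_brace x Y]"
    by (rule cuts_eq_last) (rule assms, simp)
  finally show ?thesis .
qed

end

context bihom_associative_algebra
begin

definition m where "m = mult_cochain \<mu>"

lemma m_apply: "m xs = (if length xs = 2 then \<mu> (xs ! 0) (xs ! 1) else 0)"
  by (simp add: m_def mult_cochain_def)

lemma mu_zero [simp]: "\<mu> 0 b = 0" "\<mu> a 0 = 0"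
  using lin_zero[OF lin_mu(1)] lin_zero[OF lin_mu(2)] by auto

lemma mu_uminus: "\<mu> (- a) b = - \<mu> a b" "\<mu> a (- b) = - \<mu> a b"
  using lin_uminus[OF lin_mu(1)] lin_uminus[OF lin_mu(2)] by auto

lemma m_in_C: "m \<in> C (Suc (Suc 0))"
proof -
  have "lin (\<lambda>x. m (p @ x # q))" for p q
  proof (cases "length p + length q = 1")
    case True
    then consider a where "p = [a]" "q = []" | b where "p = []" "q = [b]"
      by (cases p; cases q) auto
    then show ?thesis by cases (simp_all add: m_apply lin_mu)
  next
    case False
    then show ?thesis by (simp add: m_apply lin_const_zero)
  qed
  then have "multilin m" by (simp add: multilin_def)
  then show ?thesis
    unfolding cochains_iff by (auto simp: m_apply alpha_mu beta_mu lin_zero lin_alpha lin_beta)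
qed

abbreviation mb where "mb \<equiv> (Suc 0, m)"

lemma mb_block: "cochain_block mb"
  using m_in_C by (simp add: cochain_block_def)

lemma m_multi: "multilin m" "multiadditive m"
  using cochain_blockD[OF mb_block] by auto

lemma ins_m_zero: "length Z > 2 \<Longrightarrow> ins Z m = 0"
  by (rule trans[OF ins_too_many]) (auto simp: m_apply)

lemma ins_block_zero: "multilin \<phi> \<Longrightarrow> ins (Y @ (e, 0) # W) \<phi> = 0"
  using ins_zero_block[of \<phi> "(e, 0)" "Y @ (e, 0) # W"] by (auto simp: fun_eq_iff)

text \<open>
  On three arguments the two insertions of $m$ into $m$ give $\mu(\mu(a,b),\beta c)$ and
  $\mu(-\alpha a,\mu(b,c))$, which cancel by bihom-associativity.
\<close>

lemma m_m_zero: "ins [mb] m = 0"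
proof
  fix as
  show "ins [mb] m as = 0 as"
  proof (cases "length as = 3")
    case True
    then obtain a b c where "as = [a, b, c]" by (auto simp: length_Suc_conv numeral_3_eq_3)
    then show ?thesis
      by (simp add: ins_Cons m_apply mu_uminus bihom_assoc)
  next
    case False
    have "ins [mb] m as = 0"
      by (rule ins_support[where n = 2]) (use False m_multi in \<open>auto simp: m_apply\<close>)
    then show ?thesis by simp
  qed
qed

lemma blocks_ins_ins:
  assumes "\<And>y. y \<in> set Y \<Longrightarrow> cochain_block y" and "\<And>x. x \<in> set H \<Longrightarrow> cochain_block x" and "multilin f"
  shows "ins Y (ins H f) = brace_sum H Y (\<lambda>W. ins W f)"
  using assms cochain_blockD multilin_multiadditive by (intro ins_ins_fun) auto

lemma block_brace_cochain:
  assumes "cochain_block x" and "\<And>y. y \<in> set Y \<Longrightarrow> cochain_block y"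
  shows "cochain_block (block_brace x Y)"
  using ins_cochain[OF assms(2), of Y "snd x" "Suc (fst x)"] assms(1) by (simp add: cochain_block_def block_brace_def)

lemma ins_block_add:
  assumes "multilin \<phi>"
  shows "ins (Y @ (e, g + g') # W) \<phi> = ins (Y @ (e, g) # W) \<phi> + ins (Y @ (e, g') # W) \<phi>"
    and "ins (Y @ (e, sg k g) # W) \<phi> = sg k (ins (Y @ (e, g) # W) \<phi>)"
    and "ins (Y @ (e, g - g') # W) \<phi> = ins (Y @ (e, g) # W) \<phi> - ins (Y @ (e, g') # W) \<phi>"
proof -
  have add: "ins (Y @ (e, g + g') # W) \<phi> = ins (Y @ (e, g) # W) \<phi> + ins (Y @ (e, g') # W) \<phi>" for g g'
    by (rule ext) (simp add: ins_block_linear[OF assms])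
  show "ins (Y @ (e, g + g') # W) \<phi> = ins (Y @ (e, g) # W) \<phi> + ins (Y @ (e, g') # W) \<phi>"
    by (rule add)
  show "ins (Y @ (e, sg k g) # W) \<phi> = sg k (ins (Y @ (e, g) # W) \<phi>)"
    "ins (Y @ (e, g - g') # W) \<phi> = ins (Y @ (e, g) # W) \<phi> - ins (Y @ (e, g') # W) \<phi>"
    by (rule additive_minus[of "\<lambda>g. ins (Y @ (e, g) # W) \<phi>", OF add])+
qed

lemma ins_zero_fun: "ins G (0 :: 'a cochain) = 0"
  by (simp add: zero_fun_def fun_eq_iff)

lemma ins_sg_fun: "ins G (sg k \<phi>) = sg k (ins G \<phi>)"
  by (rule additive_minus(4)[of "ins G"]) (auto simp: fun_eq_iff ins_plus)

lemma ins_diff_fun: "ins G (\<phi> - \<psi>) = ins G \<phi> - ins G \<psi>"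
  by (rule additive_minus(3)[of "ins G"]) (auto simp: fun_eq_iff ins_plus)

text \<open>
  The differential $df = \{m\}\{f\} - (-1)^{|f|}\{f\}\{m\}$ of a block.
\<close>

definition block_d :: "nat \<times> 'a cochain \<Rightarrow> nat \<times> 'a cochain" where
  "block_d x = (Suc (fst x), ins [x] m - sg (fst x) (ins [mb] (snd x)))"

text \<open>
  The product $f \cup g = (-1)^{|f|+1}\{m\}\{f,g\}$ of two blocks.
\<close>

definition block_cup :: "nat \<times> 'a cochain \<Rightarrow> nat \<times> 'a cochain \<Rightarrow> nat \<times> 'a cochain" where
  "block_cup x y = (Suc (fst x + fst y), sg (Suc (fst x)) (ins [x, y] m))"

lemma block_d_cochain:
  assumes "cochain_block x" shows "cochain_block (block_d x)"
proof -
  have "ins [x] m \<in> C (Suc (Suc 0) + weight [x])" "ins [mb] (snd x) \<in> C (Suc (fst x) + weight [mb])"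
    using assms mb_block m_in_C by (intro ins_cochain; simp add: cochain_block_def)+
  then show ?thesis by (simp add: block_d_def cochain_block_def C_diff C_sg)
qed

lemma block_cup_cochain:
  assumes "cochain_block x" "cochain_block y" shows "cochain_block (block_cup x y)"
proof -
  have "ins [x, y] m \<in> C (Suc (Suc 0) + weight [x, y])"
    using assms m_in_C by (intro ins_cochain) auto
  then show ?thesis by (simp add: block_cup_def cochain_block_def C_sg)
qed

text \<open>
  The brace relation for $0 = \{\{m\}\{m\}\}\{x,y,z\}$; all other distributions of three entries put
  more than two of them into one $m$.
\<close>

lemma block_cup_assoc_aux:
  assumes "cochain_block x" "cochain_block y" "cochain_block z"
  shows "ins [block_brace mb [x, y], z] m + sg (fst x) (ins [x, block_brace mb [y, z]] m) = 0"
proof -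
  have z: "block_brace mb [x, y, z] = (1 + weight [x, y, z], 0)"
    by (simp add: block_brace_def ins_m_zero)
  have z0: "ins [(e, 0)] m = 0" for e using ins_block_zero[OF m_multi(1), of "[]"] by simp
  have "0 = ins [x, y, z] (ins [mb] m)"
    by (simp only: m_m_zero ins_zero_fun)
  also have "\<dots> = brace_sum [mb] [x, y, z] (\<lambda>W. ins W m)"
    by (rule blocks_ins_ins) (use assms mb_block m_multi in auto)
  also have "\<dots> = ins [block_brace mb [x, y], z] m + sg (fst x) (ins [x, block_brace mb [y, z]] m)"
    by (simp add: ins_m_zero z z0)
  finally show ?thesis by simp
qed

theorem block_cup_assoc:
  assumes "cochain_block x" "cochain_block y" "cochain_block z"
  shows "block_cup (block_cup x y) z = block_cup x (block_cup y z)"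
proof -
  have "ins [(e, sg k g), w] m = sg k (ins [(e, g), w] m)" "ins [w, (e, sg k g)] m = sg k (ins [w, (e, g)] m)" for e k g w
    using ins_block_add(2)[OF m_multi(1), of "[]" e k g "[w]"] ins_block_add(2)[OF m_multi(1), of "[w]" e k g "[]"]
    by (simp_all)
  then have l: "snd (block_cup (block_cup x y) z) = sg (fst y + 1) (ins [block_brace mb [x, y], z] m)"
    and r: "snd (block_cup x (block_cup y z)) = sg (fst x + fst y) (ins [x, block_brace mb [y, z]] m)"
    by (simp_all add: block_cup_def block_brace_def sg_sg) (simp_all add: sg_def)
  have "ins [block_brace mb [x, y], z] m = - sg (fst x) (ins [x, block_brace mb [y, z]] m)"
    using block_cup_assoc_aux[OF assms] by (simp add: add_eq_0_iff2)
  then have "snd (block_cup (block_cup x y) z) = snd (block_cup x (block_cup y z))"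
    unfolding l r by (simp add: sg_def)
  then show ?thesis by (intro prod_eqI) (simp_all add: block_cup_def)
qed

text \<open>
  Writing out $d(dx)$ gives $\{m\}\{\{m\}\{x\}\}$, $\{m\}\{\{x\}\{m\}\}$, $\{\{m\}\{x\}\}\{m\}$ and
  $\{\{x\}\{m\}\}\{m\}$.  In $\{\{x\}\{m\}\}\{m\}$ the two terms $\{x\}\{m,m\}$ cancel because $|m|$
  is odd; the rest is $\{\{m\}\{m\}\}\{x\} = 0$.
\<close>

theorem block_d_block_d:
  assumes x: "cochain_block x"
  shows "snd (block_d (block_d x)) = 0"
proof -
  let ?e = "fst x"
  have xm: "multilin (snd x)" using cochain_blockD[OF x] by simp
  have 1: "ins [mb] (ins [x] m) = ins [block_brace x [mb]] m + sg ?e (ins [mb, x] m) + ins [x, mb] m"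
    by (subst blocks_ins_ins) (use x mb_block m_multi in \<open>auto\<close>)
  have mm: "block_brace mb [mb] = (2, 0)" by (simp add: block_brace_def m_m_zero)
  have z0: "ins [(e, 0)] f = 0" if "multilin f" for e f using ins_block_zero[OF that, of "[]"] by simp
  have 2: "ins [mb] (ins [mb] (snd x)) = 0"
    by (subst blocks_ins_ins) (use xm mb_block in \<open>auto simp: mm z0 sg_def\<close>)
  have "0 = ins [x] (ins [mb] m)"
    by (simp only: m_m_zero ins_zero_fun)
  also have "\<dots> = ins [block_brace mb [x]] m + sg ?e (ins [x, mb] m) + ins [mb, x] m"
    by (subst blocks_ins_ins) (use x mb_block m_multi in \<open>auto\<close>)
  finally have 3: "ins [block_brace mb [x]] m = - sg ?e (ins [x, mb] m) - ins [mb, x] m"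
    by (simp add: eq_diff_eq eq_neg_iff_add_eq_0 algebra_simps)
  have lin: "ins [(e, g - sg k g')] m = ins [(e, g)] m - sg k (ins [(e, g')] m)" for e k g g'
    using ins_block_add(2,3)[OF m_multi(1), of "[]" e _ _ "[]"] by (simp)
  have "snd (block_d (block_d x)) = ins [block_brace mb [x]] m - sg ?e (ins [block_brace x [mb]] m)
     - sg (Suc ?e) (ins [mb] (ins [x] m) - sg ?e (ins [mb] (ins [mb] (snd x))))"
    by (simp add: block_d_def block_brace_def lin ins_diff_fun ins_sg_fun)
  also have "\<dots> = 0"
    unfolding 1 2 3 by (auto simp: sg_def)
  finally show ?thesis .
qed

text \<open>
  Only the distributions that leave no entry of \<open>Y\<close> outside of \<open>x1\<close> and \<open>x2\<close> survive,
  because $m$ has just two arguments.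
\<close>

theorem ins_block_cup:
  assumes x: "cochain_block x1" "cochain_block x2" and Y: "\<And>y. y \<in> set Y \<Longrightarrow> cochain_block y"
  shows "ins Y (snd (block_cup x1 x2)) =
    cuts Y (\<lambda>Y1 Y2. sg (Suc (fst x2) * weight Y1) (snd (block_cup (block_brace x1 Y1) (block_brace x2 Y2))))"
proof -
  let ?k = "\<lambda>Y1 Y2. fst x1 * weight Y1 + weight [x2] * (weight Y1 + weight Y2)"
  have "ins Y (ins [x1, x2] m) = brace_sum [x1, x2] Y (\<lambda>W. ins W m)"
    by (rule blocks_ins_ins) (use x Y m_multi in auto)
  also have "\<dots> = cuts Y (\<lambda>Y1 Y2. sg (fst x2 * weight Y1) (ins [block_brace x1 Y1, block_brace x2 Y2] m))"
  proof (subst brace_sum.simps(2), subst cuts_eq_first)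
    fix Y1 R :: "(nat \<times> 'a cochain) list" assume "Y1 \<noteq> []"
    then have "ins (Y1 @ block_brace x1 Y2 # W) m = 0" if "length W \<ge> length [x2]" for Y2 W
      using that by (intro ins_m_zero) (cases Y1; cases W; simp)
    then have "brace_sum [x2] Y3 (\<lambda>W. sg (?k Y1 Y2) (ins (Y1 @ block_brace x1 Y2 # W) m)) = 0" for Y2 Y3
      by (intro brace_sum_eq_0) simp
    then show "cuts R (\<lambda>Y2 Y3. brace_sum [x2] Y3 (\<lambda>W. sg (?k Y1 Y2) (ins (Y1 @ block_brace x1 Y2 # W) m))) = 0"
      by (simp only: cuts_zero)
  next
    have "brace_sum [x2] Y3 (\<lambda>W. sg (?k [] Y2) (ins ([] @ block_brace x1 Y2 # W) m)) =
        sg (?k [] Y2) (ins ([] @ block_brace x1 Y2 # [block_brace x2 Y3]) m)" for Y2 Y3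
      by (rule trans[OF brace_sum_single_short]) (simp_all add: ins_m_zero)
    then show "cuts Y (\<lambda>Y2 Y3. brace_sum [x2] Y3 (\<lambda>W. sg (?k [] Y2) (ins ([] @ block_brace x1 Y2 # W) m))) =
      cuts Y (\<lambda>Y1 Y2. sg (fst x2 * weight Y1) (ins [block_brace x1 Y1, block_brace x2 Y2] m))"
      by simp
  qed
  finally have "ins Y (snd (block_cup x1 x2)) = sg (Suc (fst x1))
     (cuts Y (\<lambda>Y1 Y2. sg (fst x2 * weight Y1) (ins [block_brace x1 Y1, block_brace x2 Y2] m)))"
    by (simp add: block_cup_def ins_sg_fun)
  then show ?thesis
    by (simp add: additive_cuts[of "sg _", OF sg_add] block_cup_def sg_sg block_brace_def)
      (intro cuts_cong, auto simp: sg_def)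
qed

text \<open>
  The homotopy formula.  Expand $\{\{m\}\{x\}\}\{H\}$, $\{\{x\}\{m\}\}\{H\}$ and $\{\{x\}\{H\}\}\{m\}$ by the
  brace relation (\<open>T1\<close>, \<open>T2\<close>, \<open>T3\<close>).  The terms \<open>I\<close> with $m$ between the entries of
  \<open>H\<close> cancel; $\{m\}\{h_i\}$ and $\{h_i\}\{m\}$ (\<open>K\<close> and \<open>J\<close>) combine to $dh_i$; the
  terms \<open>L\<close> with $\{m\}\{h_i,h_{i+1}\}$ are the products of neighbours; and the outer terms of
  \<open>T1\<close> are the products with the first and the last entry.
\<close>

theorem block_d_ins:
  assumes x: "cochain_block x" and H: "\<And>h. h \<in> set H \<Longrightarrow> cochain_block h" and "H \<noteq> []"
  shows "snd (block_d (block_brace x H)) - ins H (snd (block_d x))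
      - sg (fst x) (\<Sum>i<length H. sg (weight (take i H)) (ins (take i H @ block_d (H ! i) # drop (Suc i) H) (snd x)))
    = sg (Suc (fst x) * fst (hd H)) (snd (block_cup (hd H) (block_brace x (tl H))))
      - sg (fst x) (\<Sum>i<length H - 1. sg (weight (take (Suc i) H))
          (ins (take i H @ block_cup (H ! i) (H ! Suc i) # drop (i + 2) H) (snd x)))
      + sg (fst x + weight (butlast H)) (snd (block_cup (block_brace x (butlast H)) (last H)))"
proof -
  let ?e = "fst x" and ?f = "snd x"
  let ?s = "\<lambda>i. sg (weight (take i H)) :: 'a cochain \<Rightarrow> 'a cochain"
  have fm: "multilin ?f" using cochain_blockD[OF x] by simp
  have T1: "ins H (ins [x] m) = ins [block_brace x H] m + sg (?e * fst (hd H)) (ins [hd H, block_brace x (tl H)] m)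
     + ins [block_brace x (butlast H), last H] m"
  proof -
    have "ins H (ins [x] m) = brace_sum [x] H (\<lambda>W. ins W m)"
      by (rule blocks_ins_ins) (use x H m_multi in auto)
    also have "\<dots> = ins [block_brace x H] m + sg (?e * fst (hd H)) (ins [hd H, block_brace x (tl H)] m)
       + ins [block_brace x (butlast H), last H] m"
      unfolding brace_sum_single_left
      by (subst cuts3_outer_short) (simp_all add: ins_m_zero \<open>H \<noteq> []\<close>)
    finally show ?thesis .
  qed
  define I where "I i = ins (take i H @ mb # drop i H) ?f" for i
  define J where "J i = ins (take i H @ block_brace (H ! i) [mb] # drop (Suc i) H) ?f" for i
  define K where "K i = ins (take i H @ block_brace mb [H ! i] # drop (Suc i) H) ?f" for i
  define L where "L i = ins (take i H @ block_brace mb [H ! i, H ! Suc i] # drop (i + 2) H) ?f" for i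
  have T2: "ins H (ins [mb] ?f) = (\<Sum>i\<le>length H. ?s i (I i)) + (\<Sum>i<length H. ?s i (K i)) + (\<Sum>i<length H - 1. ?s i (L i))"
  proof -
    have "ins H (ins [mb] ?f) = brace_sum [mb] H (\<lambda>W. ins W ?f)"
      by (rule blocks_ins_ins) (use mb_block H fm in auto)
    also have "\<dots> = (\<Sum>i\<le>length H. ?s i (I i)) + (\<Sum>i<length H. ?s i (K i)) + (\<Sum>i<length H - 1. ?s i (L i))"
      unfolding brace_sum_single_left
    proof (subst cuts3_middle_short)
      fix p q r :: "(nat \<times> 'a cochain) list" assume "2 < length q"
      then show "sg (fst mb * weight p) (ins (p @ block_brace mb q # r) ?f) = 0"
        by (simp add: block_brace_def ins_m_zero ins_block_zero[OF fm])
    qed (simp add: I_def K_def L_def)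
    finally show ?thesis .
  qed
  have weight_drop: "weight H = weight (take i H) + weight (drop i H)" for i
    by (metis append_take_drop_id weight_simps(3))
  have T3: "ins [mb] (ins H ?f) = sg (weight H) ((\<Sum>i\<le>length H. ?s i (I i)) + (\<Sum>i<length H. ?s (Suc i) (J i)))"
  proof -
    have "ins [mb] (ins H ?f) = brace_sum H [mb] (\<lambda>W. ins W ?f)"
      by (rule blocks_ins_ins) (use mb_block H fm in auto)
    also have "\<dots> = (\<Sum>i\<le>length H. sg (weight (drop i H)) (I i)) + (\<Sum>i<length H. sg (weight (drop (Suc i) H)) (J i))"
      unfolding brace_sum_single_right by (simp add: I_def J_def)
    also have "\<dots> = (\<Sum>i\<le>length H. sg (weight H) (?s i (I i))) + (\<Sum>i<length H. sg (weight H) (?s (Suc i) (J i)))"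
    proof -
      have "sg (weight (drop i H)) g = sg (weight H) (?s i g)" for i g
        using weight_drop[of i] by (simp add: sg_sg) (simp add: sg_def)
      then show ?thesis by simp
    qed
    finally show ?thesis
      by (simp add: sum_sg sg_add)
  qed
  have D: "ins (take i H @ block_d (H ! i) # drop (Suc i) H) ?f = K i - sg (fst (H ! i)) (J i)" for i
    by (simp add: block_d_def K_def J_def block_brace_def ins_block_add[OF fm])
  have P: "ins (take i H @ block_cup (H ! i) (H ! Suc i) # drop (i + 2) H) ?f = sg (Suc (fst (H ! i))) (L i)" for i
    by (simp add: block_cup_def L_def block_brace_def ins_block_add[OF fm])
  have wS: "weight (take (Suc i) H) = weight (take i H) + fst (H ! i)" if "i < length H" for i
    using that by (simp add: take_Suc_conv_app_nth)
  have S1: "(\<Sum>i<length H. ?s i (ins (take i H @ block_d (H ! i) # drop (Suc i) H) ?f)) =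
      (\<Sum>i<length H. ?s i (K i)) - (\<Sum>i<length H. ?s (Suc i) (J i))"
    unfolding D sum_subtractf[symmetric]
    by (intro sum.cong) (auto simp: wS sg_def)
  have S2: "(\<Sum>i<length H - 1. ?s (Suc i) (ins (take i H @ block_cup (H ! i) (H ! Suc i) # drop (i + 2) H) ?f)) =
      - (\<Sum>i<length H - 1. ?s i (L i))"
    unfolding P sum_negf[symmetric]
    by (intro sum.cong) (auto simp: wS sg_def)
  have hd: "snd (block_cup (hd H) (block_brace x (tl H))) = sg (Suc (fst (hd H))) (ins [hd H, block_brace x (tl H)] m)"
    and last: "snd (block_cup (block_brace x (butlast H)) (last H)) = sg (Suc (?e + weight (butlast H))) (ins [block_brace x (butlast H), last H] m)"
    by (simp_all add: block_cup_def block_brace_def)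
  have l: "snd (block_d (block_brace x H)) = ins [block_brace x H] m - sg (?e + weight H) (ins [mb] (ins H ?f))"
    "ins H (snd (block_d x)) = ins H (ins [x] m) - sg ?e (ins H (ins [mb] ?f))"
    by (simp_all add: block_d_def block_brace_def ins_diff_fun ins_sg_fun)
  show ?thesis
    unfolding S1 S2 hd last l T1 T2 T3
    by (cases "even ?e"; cases "even (weight H)"; cases "even (fst (hd H))"; cases "even (weight (butlast H))")
      (simp_all add: sg_def algebra_simps)
qed

end

section \<open>The index set of the brace relation\<close>

lemma slice_map: "map h (slice i j xs) = slice i j (map h xs)"
  by (simp add: slice_def take_map drop_map)

lemma finite_brace_indices: "finite (brace_indices k n)"
proof (rule finite_subset)
  show "brace_indices k n \<subseteq> {xs. set xs \<subseteq> {..n} \<and> length xs = k} \<times> {xs. set xs \<subseteq> {..n} \<and> length xs = k}"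
    by (auto simp: brace_indices_def set_conv_nth intro: order_trans)
qed (intro finite_cartesian_product finite_lists_length_eq finite_atMost)

text \<open>
  The index sequences are monotone, so all later indices are at least \<open>j\<close>; subtracting \<open>j\<close>
  from them gives an index sequence for the remaining list.
\<close>

lemma brace_indices_Cons:
  "(i # is, j # js) \<in> brace_indices (Suc k) n \<longleftrightarrow>
     i \<le> j \<and> j \<le> n \<and> (\<forall>p<k. is ! p \<ge> j) \<and> (is, js) \<in> brace_indices k n"
proof (intro iffI conjI)
  assume A: "(i # is, j # js) \<in> brace_indices (Suc k) n"
  then have len: "length is = k" "length js = k"
    and le: "\<And>p. p < Suc k \<Longrightarrow> (i # is) ! p \<le> (j # js) ! p \<and> (j # js) ! p \<le> n"
    and step: "\<And>p. Suc p < Suc k \<Longrightarrow> (j # js) ! p \<le> (i # is) ! Suc p"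
    by (auto simp: brace_indices_def)
  show "i \<le> j" "j \<le> n" using le[of 0] by auto
  show "(is, js) \<in> brace_indices k n"
    using len le[of "Suc p" for p] step[of "Suc p" for p] by (auto simp: brace_indices_def)
  show "\<forall>p<k. is ! p \<ge> j"
  proof (intro allI impI)
    fix p assume "p < k"
    then show "is ! p \<ge> j"
    proof (induction p)
      case 0
      then show ?case using step[of 0] by simp
    next
      case (Suc p)
      then show ?case using le[of "Suc p"] step[of "Suc p"] by simp
    qed
  qed
next
  assume A: "i \<le> j \<and> j \<le> n \<and> (\<forall>p<k. is ! p \<ge> j) \<and> (is, js) \<in> brace_indices k n"
  show "(i # is, j # js) \<in> brace_indices (Suc k) n"
    unfolding brace_indices_def
  proof (safe, goal_cases)
    case (3 p) then show ?case using A by (cases p) (auto simp: brace_indices_def)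
  next
    case (4 p) then show ?case using A by (cases p) (auto simp: brace_indices_def)
  next
    case (5 p) then show ?case using A by (cases p) (auto simp: brace_indices_def)
  qed (use A in \<open>auto simp: brace_indices_def\<close>)
qed

lemma brace_indices_shift:
  "(map ((+) j) is, map ((+) j) js) \<in> brace_indices k (j + n) \<longleftrightarrow> (is, js) \<in> brace_indices k n"
  by (auto simp: brace_indices_def)

text \<open>
  The sum over the first pair $(i_1, j_1) = (i, i + d)$ is pulled out, in the form in which the
  recursion of \<open>brace_sum\<close> splits off two sublists.
\<close>

lemma sum_brace_indices_Suc:
  fixes F :: "nat list \<Rightarrow> nat list \<Rightarrow> 'b::comm_monoid_add"
  shows "(\<Sum>(is, js)\<in>brace_indices (Suc k) n. F is js) =
    (\<Sum>i\<le>n. \<Sum>d\<le>n - i. \<Sum>(is, js)\<in>brace_indices k (n - i - d).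
       F (i # map ((+) (i + d)) is) ((i + d) # map ((+) (i + d)) js))"
proof -
  let ?S = "SIGMA i:{..n}. SIGMA d:{..n - i}. brace_indices k (n - i - d)"
  let ?f = "\<lambda>(i, d, is, js). (i # map ((+) (i + d)) is, (i + d) # map ((+) (i + d)) js)"
  have "(\<Sum>i\<le>n. \<Sum>d\<le>n - i. \<Sum>(is, js)\<in>brace_indices k (n - i - d).
       F (i # map ((+) (i + d)) is) ((i + d) # map ((+) (i + d)) js))
    = (\<Sum>x\<in>?S. (\<lambda>(is, js). F is js) (?f x))"
    by (simp add: sum.Sigma finite_brace_indices finite_SigmaI split_def)
  also have "\<dots> = (\<Sum>(is, js)\<in>brace_indices (Suc k) n. F is js)"
  proof (rule sum.reindex_bij_betw)
    have inj: "inj (map ((+) c))" for c :: nat by (simp add: inj_mapI)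
    have "inj_on ?f ?S"
      by (rule inj_onI) (auto dest!: injD[OF inj])
    moreover have "?f ` ?S = brace_indices (Suc k) n"
    proof (intro equalityI subsetI)
      fix x assume "x \<in> ?f ` ?S"
      then obtain i d "is" js where x: "x = (i # map ((+) (i + d)) is, (i + d) # map ((+) (i + d)) js)"
        and i: "i \<le> n" "d \<le> n - i" and b: "(is, js) \<in> brace_indices k (n - i - d)" by auto
      have "n = (i + d) + (n - i - d)" using i by simp
      then have "(map ((+) (i + d)) is, map ((+) (i + d)) js) \<in> brace_indices k n"
        using brace_indices_shift[of "i + d" "is" js k "n - i - d"] b by metis
      moreover have "length is = k" using b by (simp add: brace_indices_def)
      ultimately show "x \<in> brace_indices (Suc k) n"
        unfolding x brace_indices_Cons using i by simp
    next
      fix x assume x: "x \<in> brace_indices (Suc k) n"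
      then obtain i j is' js' where x': "x = (i # is', j # js')"
        by (auto simp: brace_indices_def length_Suc_conv)
      have b: "i \<le> j" "j \<le> n" "\<forall>p<k. is' ! p \<ge> j" "(is', js') \<in> brace_indices k n"
        using x unfolding x' brace_indices_Cons by auto
      define "is" js where "is = map (\<lambda>a. a - j) is'" and "js = map (\<lambda>a. a - j) js'"
      have l: "length is' = k" "length js' = k" using b(4) by (auto simp: brace_indices_def)
      have "js' ! p \<ge> j" if "p < k" for p
        using b(3,4) that by (auto simp: brace_indices_def intro: order_trans)
      then have sh: "is' = map ((+) j) is" "js' = map ((+) j) js"
        using b(3) l by (auto simp: is_def js_def intro!: nth_equalityI)
      then have "(is, js) \<in> brace_indices k (n - j)"
        using b(2,4) brace_indices_shift[of j "is" js k "n - j"] by simp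
      then show "x \<in> ?f ` ?S"
        using b sh x' by (intro image_eqI[of _ _ "(i, j - i, is, js)"]) auto
    qed
    ultimately show "bij_betw ?f ?S (brace_indices (Suc k) n)" by (simp add: bij_betw_def)
  qed
  finally show ?thesis by simp
qed

lemma slice_drop: "slice (j + a) (j + b) ys = slice a b (drop j ys)"
  by (simp add: slice_def add.commute)

lemma brace_args_Cons:
  assumes "length is = length xs" and "length js = length xs"
  shows "brace_args br (x # xs) ys (i # map ((+) j) is) (j # map ((+) j) js) =
    slice 0 i ys @ br x (slice i j ys) # brace_args br xs (drop j ys) is js"
proof -
  have sh: "[0..<length (x # xs)] = 0 # map Suc [0..<length xs]"
    by (metis length_Cons map_Suc_upt upt_conv_Cons zero_less_Suc)
  have shift: "(j # map ((+) j) js) ! p = j + (0 # js) ! p" if "p < length xs" for p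
    using that assms by (cases p) simp_all
  have last: "last (0 # j # map ((+) j) js) = j + last (0 # js)"
    by (cases js rule: rev_cases) simp_all
  have eq: "map (\<lambda>p. slice ((j # map ((+) j) js) ! p) (map ((+) j) is ! p) ys @
         [br (xs ! p) (slice (map ((+) j) is ! p) (map ((+) j) js ! p) ys)]) [0..<length xs] =
      map (\<lambda>p. slice ((0 # js) ! p) (is ! p) (drop j ys) @
         [br (xs ! p) (slice (is ! p) (js ! p) (drop j ys))]) [0..<length xs]"
    using assms by (intro map_cong refl) (simp add: shift slice_drop)
  then show ?thesis
    unfolding brace_args_def sh last list.map concat.simps map_map comp_def nth_Cons_Suc nth_Cons_0 eq
    by (simp add: add.commute)
qed

context twisted_insertion
begin

lemma weight_take: "i \<le> length G \<Longrightarrow> weight (take i G) = (\<Sum>p<i. fst (G ! p))"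
  by (simp add: weight_def sum_list_sum_nth atLeast0LessThan min_def)

text \<open>
  Connects the recursion over splittings with the sum over index sequences.  It is stated
  for an arbitrary operation \<open>br\<close> that agrees with insertion on consecutive parts of \<open>Y\<close>.
\<close>

lemma brace_sum_eq_sum:
  fixes \<Psi> :: "('a list \<Rightarrow> 'a) list \<Rightarrow> 'b::ab_group_add"
  assumes "\<And>x i j. x \<in> set H \<Longrightarrow> br (snd x) (map snd (slice i j Y)) = ins (slice i j Y) (snd x)"
  shows "brace_sum H Y (\<lambda>W. \<Psi> (map snd W)) =
    (\<Sum>(is, js)\<in>brace_indices (length H) (length Y).
      sg (\<Sum>p<length H. fst (H ! p) * (\<Sum>q<is ! p. fst (Y ! q)))
        (\<Psi> (brace_args br (map snd H) (map snd Y) is js)))"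
  using assms
proof (induction H arbitrary: Y \<Psi>)
  case Nil
  have "brace_indices 0 (length Y) = {([], [])}" by (auto simp: brace_indices_def)
  then show ?case by (simp add: brace_args_def)
next
  case (Cons x H)
  let ?n = "length Y"
  have step: "brace_sum H (drop d (drop i Y)) (\<lambda>W. sg (fst x * weight (take i Y) + weight H * (weight (take i Y) + weight (take d (drop i Y))))
      (\<Psi> (map snd (take i Y @ block_brace x (take d (drop i Y)) # W)))) =
    (\<Sum>(is, js)\<in>brace_indices (length H) (?n - i - d).
      sg (\<Sum>p<length (x # H). fst ((x # H) ! p) * (\<Sum>q<(i # map ((+) (i + d)) is) ! p. fst (Y ! q)))
        (\<Psi> (brace_args br (map snd (x # H)) (map snd Y) (i # map ((+) (i + d)) is) ((i + d) # map ((+) (i + d)) js))))"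
    if i: "i \<le> ?n" and d: "d \<le> ?n - i" for i d
  proof -
    let ?Y = "drop (i + d) Y"
    have prem: "br (snd y) (map snd (slice k l ?Y)) = ins (slice k l ?Y) (snd y)" if "y \<in> set H" for y k l
      using Cons.prems[of y "i + d + k" "i + d + l"] that by (simp add: slice_drop)
    have tk: "take d (drop i Y) = slice i (i + d) Y" "take i Y = slice 0 i Y" "drop d (drop i Y) = ?Y"
      by (simp_all add: slice_def add.commute)
    have w: "weight (take i Y) + weight (take d (drop i Y)) = (\<Sum>q<i + d. fst (Y ! q))"
    proof -
      have "weight (take i Y) + weight (take d (drop i Y)) = weight (take (i + d) Y)"
        by (simp add: take_add)
      then show ?thesis using i d by (simp add: weight_take)
    qed
    have "brace_sum H ?Y (\<lambda>W. sg (fst x * weight (take i Y) + weight H * (weight (take i Y) + weight (take d (drop i Y))))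
       (\<Psi> (map snd (take i Y @ block_brace x (take d (drop i Y)) # W)))) =
     (\<Sum>(is, js)\<in>brace_indices (length H) (length ?Y).
      sg (\<Sum>p<length H. fst (H ! p) * (\<Sum>q<is ! p. fst (?Y ! q)))
        (sg (fst x * weight (take i Y) + weight H * (weight (take i Y) + weight (take d (drop i Y))))
          (\<Psi> (map snd (take i Y) @ ins (take d (drop i Y)) (snd x) # brace_args br (map snd H) (map snd ?Y) is js))))"
      using Cons.IH[of ?Y "\<lambda>L. sg (fst x * weight (take i Y) + weight H * (weight (take i Y) + weight (take d (drop i Y))))
          (\<Psi> (map snd (take i Y) @ ins (take d (drop i Y)) (snd x) # L))", OF prem]
      by (simp add: block_brace_def)
    also have "\<dots> = (\<Sum>(is, js)\<in>brace_indices (length H) (?n - i - d).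
      sg (\<Sum>p<length (x # H). fst ((x # H) ! p) * (\<Sum>q<(i # map ((+) (i + d)) is) ! p. fst (Y ! q)))
        (\<Psi> (brace_args br (map snd (x # H)) (map snd Y) (i # map ((+) (i + d)) is) ((i + d) # map ((+) (i + d)) js))))"
    proof (rule sum.cong)
      fix ij assume "ij \<in> brace_indices (length H) (?n - i - d)"
      then obtain "is" js where ij: "ij = (is, js)" and b: "(is, js) \<in> brace_indices (length H) (?n - i - d)"
        by (cases ij) auto
      have l: "length is = length H" "length js = length H" "\<And>p. p < length H \<Longrightarrow> is ! p \<le> ?n - i - d"
        using b by (auto simp: brace_indices_def intro: order_trans)
      have args: "brace_args br (map snd (x # H)) (map snd Y) (i # map ((+) (i + d)) is) ((i + d) # map ((+) (i + d)) js)
        = map snd (take i Y) @ ins (take d (drop i Y)) (snd x) # brace_args br (map snd H) (map snd ?Y) is js"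
        using Cons.prems[of x i "i + d"] l
        by (simp add: brace_args_Cons slice_map[symmetric] tk drop_map)
      have inner: "(\<Sum>q<i + d + a. fst (Y ! q)) = (\<Sum>q<i + d. fst (Y ! q)) + (\<Sum>q<a. fst (?Y ! q))" if "a \<le> ?n - i - d" for a
        using that i d by (induction a) (simp_all add: add.assoc)
      have "(\<Sum>p<length (x # H). fst ((x # H) ! p) * (\<Sum>q<(i # map ((+) (i + d)) is) ! p. fst (Y ! q)))
        = fst x * (\<Sum>q<i. fst (Y ! q)) + (\<Sum>p<length H. fst (H ! p) * (\<Sum>q<i + d + is ! p. fst (Y ! q)))"
        using l by (simp add: sum.lessThan_Suc_shift del: sum.lessThan_Suc)
      also have "(\<Sum>p<length H. fst (H ! p) * (\<Sum>q<i + d + is ! p. fst (Y ! q))) =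
         weight H * (\<Sum>q<i + d. fst (Y ! q)) + (\<Sum>p<length H. fst (H ! p) * (\<Sum>q<is ! p. fst (?Y ! q)))"
      proof -
        have "weight H = (\<Sum>p<length H. fst (H ! p))" using weight_take[of "length H" H] by simp
        then show ?thesis
          using l by (simp add: inner distrib_left sum.distrib sum_distrib_right)
      qed
      finally have expo: "(\<Sum>p<length (x # H). fst ((x # H) ! p) * (\<Sum>q<(i # map ((+) (i + d)) is) ! p. fst (Y ! q))) =
        fst x * (\<Sum>q<i. fst (Y ! q)) + (weight H * (\<Sum>q<i + d. fst (Y ! q)) + (\<Sum>p<length H. fst (H ! p) * (\<Sum>q<is ! p. fst (?Y ! q))))" .
      show "(case ij of (is, js) \<Rightarrow> sg (\<Sum>p<length H. fst (H ! p) * (\<Sum>q<is ! p. fst (?Y ! q)))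
        (sg (fst x * weight (take i Y) + weight H * (weight (take i Y) + weight (take d (drop i Y))))
          (\<Psi> (map snd (take i Y) @ ins (take d (drop i Y)) (snd x) # brace_args br (map snd H) (map snd ?Y) is js))))
        = (case ij of (is, js) \<Rightarrow> sg (\<Sum>p<length (x # H). fst ((x # H) ! p) * (\<Sum>q<(i # map ((+) (i + d)) is) ! p. fst (Y ! q)))
        (\<Psi> (brace_args br (map snd (x # H)) (map snd Y) (i # map ((+) (i + d)) is) ((i + d) # map ((+) (i + d)) js))))"
        unfolding ij prod.case args w sg_sg expo unfolding weight_take[OF i] by (simp only: ac_simps)
    qed simp
    finally show ?thesis by (simp only: tk(3))
  qed
  show ?case
    unfolding length_Cons sum_brace_indices_Suc brace_sum.simps cuts_eq_sum length_drop
    using step by (intro sum.cong refl) (simp only: atMost_iff length_Cons)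
qed

end

section \<open>The graded space of cochains, its product and differential\<close>

context bihom_associative_algebra
begin

abbreviation KR :: "'k ring" where "KR \<equiv> ring_of_type_algebra"
abbreviation V where "V \<equiv> hoch_degree scale \<alpha> \<beta>"
abbreviation br where "br \<equiv> hoch_brace scale \<alpha> \<beta>"
abbreviation cup where "cup \<equiv> hoch_cup scale \<mu> \<alpha> \<beta>"
abbreviation dh where "dh \<equiv> hoch_d scale \<mu> \<alpha> \<beta>"

lemma M_simps [simp]: "\<zero>\<^bsub>M\<^esub> = 0" "f \<oplus>\<^bsub>M\<^esub> g = f + g" "c \<odot>\<^bsub>M\<^esub> f = fscale c f"
  by (simp_all add: hoch_complex_def zero_fun_def plus_fun_def fscale_def)

lemma KR_simps [simp]: "carrier KR = UNIV" "a \<oplus>\<^bsub>KR\<^esub> b = a + b" "a \<otimes>\<^bsub>KR\<^esub> b = a * b" "\<one>\<^bsub>KR\<^esub> = 1"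
  by (simp_all add: ring_of_type_algebra_def)

lemma fscale_laws:
  "fscale (a + b) f = fscale a f + fscale b f" "fscale a (f + g) = fscale a f + fscale a g"
  "fscale (a * b) f = fscale a (fscale b f)" "fscale 1 f = f" "fscale a 0 = 0"
  "fscale a (f - g) = fscale a f - fscale a g" "fscale a (sg k f) = sg k (fscale a f)"
  by (simp_all add: fscale_def fun_eq_iff scale_left_distrib scale_right_distrib scale_right_diff_distrib sg_def)

lemma sg_apply: "sg k f x = sg k (f x)" for f :: "'b \<Rightarrow> 'a"
  by (simp add: sg_def)

lemma abelian_group_M: "abelian_group M"
proof (rule abelian_groupI)
  show "\<exists>y\<in>CC. y \<oplus>\<^bsub>M\<^esub> x = \<zero>\<^bsub>M\<^esub>" if "x \<in> CC" for x
    using CC_uminus[OF that] by (intro bexI[of _ "- x"]) simp_all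
qed (auto simp: CC_add CC_zero ac_simps)

lemma module_M: "Module.module KR M"
proof (rule Module.moduleI)
  show "cring KR" by (rule cring_from_type_algebra)
qed (simp_all add: abelian_group_M CC_scale fscale_laws)

lemma a_inv_M: "f \<in> CC \<Longrightarrow> \<ominus>\<^bsub>M\<^esub> f = - f"
proof -
  interpret abelian_group M by (rule abelian_group_M)
  show "f \<in> CC \<Longrightarrow> \<ominus>\<^bsub>M\<^esub> f = - f"
    by (rule minus_equality) (simp_all add: CC_uminus)
qed

lemma a_minus_M: "g \<in> CC \<Longrightarrow> f \<ominus>\<^bsub>M\<^esub> g = f - g"
  by (simp add: a_minus_def a_inv_M)

lemma signed_M: "f \<in> CC \<Longrightarrow> even k = even n \<Longrightarrow> signed M k f = sg n f"
  by (simp add: signed_def sg_def a_inv_M)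

lemma finsum_M: "finite A \<Longrightarrow> (\<And>i. i \<in> A \<Longrightarrow> F i \<in> CC) \<Longrightarrow> finsum M F A = (\<Sum>i\<in>A. F i)"
proof (induction A rule: finite_induct)
  case empty
  interpret abelian_group M by (rule abelian_group_M)
  show ?case by simp
next
  case (insert i A)
  interpret abelian_group M by (rule abelian_group_M)
  show ?case using insert by (simp add: Pi_def)
qed

lemma V_iff: "x \<in> V i \<longleftrightarrow> (if i \<ge> 1 then x \<in> C (nat i) else x = 0)"
  by (simp add: hoch_degree_def zero_fun_def)

lemma V_CC: "x \<in> V i \<Longrightarrow> x \<in> CC"
proof (cases "i \<ge> 1")
  case True
  then obtain e where "nat i = Suc e" by (cases "nat i") auto
  then show "x \<in> V i \<Longrightarrow> x \<in> CC" using True C_subset_CC by (simp add: V_iff)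
qed (simp add: V_iff CC_zero)

lemma V_apply: "x \<in> V i \<Longrightarrow> int (length xs) \<noteq> i \<Longrightarrow> x xs = 0"
  by (cases "i \<ge> 1") (auto simp: V_iff cochains_iff)

lemma component_V: "x \<in> CC \<Longrightarrow> component (nat i) x \<in> V i"
proof (cases "i \<ge> 1")
  case False
  assume "x \<in> CC"
  then have "component 0 x = 0" by (auto simp: CC_iff component_def fun_eq_iff)
  then show ?thesis using False by (simp add: V_iff)
qed (simp add: V_iff CC_iff)

lemma C_V: "x \<in> C (Suc e) \<Longrightarrow> x \<in> V (int e + 1)"
  by (simp add: V_iff nat_add_distrib)

text \<open>
  Cochains of different degrees have disjoint supports, so the value on a list of length $n$ determines
  the component of degree $n$.
\<close>

lemma graded_M: "graded_vector_space KR M V"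
proof (unfold graded_vector_space_def graded_vector_space_axioms_def, intro conjI allI impI)
  show "Module.module KR M" by (rule module_M)
  show "Ring.field KR" by (rule field_from_type_algebra)
  interpret module KR M by (rule module_M)
  show "submodule (V i) KR M" for i
  proof (rule submoduleI)
    show "V i \<subseteq> CC" using V_CC by blast
    show "\<ominus>\<^bsub>M\<^esub> a \<in> V i" if "a \<in> V i" for a
      using that V_CC[OF that] by (simp add: a_inv_M V_iff C_uminus split: if_splits)
  qed (auto simp: V_iff C_zero C_add C_scale fscale_laws split: if_splits)
  fix x assume x: "x \<in> CC"
  have sum_apply: "(\<Sum>i\<in>{i. c i \<noteq> 0}. c i) xs = c (int (length xs)) xs"
    if c: "\<forall>i. c i \<in> V i" "finite {i. c i \<noteq> 0}" for c xs
  proof -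
    have "(\<Sum>i\<in>{i. c i \<noteq> 0}. c i xs) = (\<Sum>i\<in>{i. c i \<noteq> 0} \<inter> {int (length xs)}. c i xs)"
    proof (rule sum.mono_neutral_right[OF c(2)], blast, rule ballI)
      fix i assume "i \<in> {i. c i \<noteq> 0} - {i. c i \<noteq> 0} \<inter> {int (length xs)}"
      then show "c i xs = 0" using c(1) by (intro V_apply[of "c i" i]) auto
    qed
    also have "\<dots> = c (int (length xs)) xs"
      by (cases "c (int (length xs)) = 0") simp_all
    finally show ?thesis by (simp add: sum_fun_apply)
  qed
  define c where "c i = (if i \<ge> 1 then component (nat i) x else 0)" for i
  have cV: "c i \<in> V i" for i using component_V[OF x] by (simp add: c_def V_iff)
  have fin: "finite {i. c i \<noteq> 0}"
  proof (rule finite_subset)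
    show "{i. c i \<noteq> 0} \<subseteq> int ` arity_set x"
    proof
      fix i assume "i \<in> {i. c i \<noteq> 0}"
      then have "i \<ge> 1" "component (nat i) x \<noteq> (\<lambda>_. 0)" by (auto simp: c_def zero_fun_def split: if_splits)
      then show "i \<in> int ` arity_set x" using component_outside[of "nat i" x] by (intro image_eqI[of _ _ "nat i"]) auto
    qed
    show "finite (int ` arity_set x)" using CC_arity(2)[OF x] by simp
  qed
  have xeq: "x = (\<Sum>i\<in>{i. c i \<noteq> 0}. c i)"
  proof
    fix xs
    have "x xs = c (int (length xs)) xs"
      using x by (auto simp: c_def component_def CC_iff Suc_le_eq)
    then show "x xs = (\<Sum>i\<in>{i. c i \<noteq> 0}. c i) xs"
      using sum_apply[of c xs] cV fin by simp
  qed
  have fs: "finsum M c' {i. c' i \<noteq> 0} = (\<Sum>i\<in>{i. c' i \<noteq> 0}. c' i)" if "\<forall>i. c' i \<in> V i" "finite {i. c' i \<noteq> 0}" for c'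
    by (rule finsum_M) (use that V_CC in blast)+
  show "\<exists>!c. (\<forall>i. c i \<in> V i) \<and> finite {i. c i \<noteq> \<zero>\<^bsub>M\<^esub>} \<and> x = (\<Oplus>\<^bsub>M\<^esub>i\<in>{i. c i \<noteq> \<zero>\<^bsub>M\<^esub>}. c i)"
  proof (rule ex1I[of _ c])
    show "(\<forall>i. c i \<in> V i) \<and> finite {i. c i \<noteq> \<zero>\<^bsub>M\<^esub>} \<and> x = (\<Oplus>\<^bsub>M\<^esub>i\<in>{i. c i \<noteq> \<zero>\<^bsub>M\<^esub>}. c i)"
      using cV fin fs[of c] xeq by simp
  next
    fix c' assume "(\<forall>i. c' i \<in> V i) \<and> finite {i. c' i \<noteq> \<zero>\<^bsub>M\<^esub>} \<and> x = (\<Oplus>\<^bsub>M\<^esub>i\<in>{i. c' i \<noteq> \<zero>\<^bsub>M\<^esub>}. c' i)"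
    then have c': "\<forall>i. c' i \<in> V i" "finite {i. c' i \<noteq> 0}" "x = (\<Sum>i\<in>{i. c' i \<noteq> 0}. c' i)"
      using fs[of c'] by auto
    have "x xs = c' (int (length xs)) xs" "x xs = c (int (length xs)) xs" for xs
      using sum_apply[OF c'(1,2)] sum_apply[of c] cV fin c'(3) xeq by (metis, metis)
    then have "c' i xs = c i xs" for i xs
      using V_apply[of "c i" i xs] V_apply[of "c' i" i xs] cV c'(1) by (cases "int (length xs) = i") auto
    then show "c' = c" by (simp add: fun_eq_iff)
  qed
qed

text \<open>
  Extends a family of operations on homogeneous cochains to the direct sum.
\<close>

definition arity_sum :: "(nat \<Rightarrow> 'a cochain \<Rightarrow> 'a cochain) \<Rightarrow> 'a cochain \<Rightarrow> 'a cochain" where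
  "arity_sum F f = (\<Sum>n\<in>arity_set f. F n (component n f))"

lemma arity_sum_superset:
  assumes "\<And>n. F n 0 = 0" and "finite A" and "arity_set f \<subseteq> A"
  shows "arity_sum F f = (\<Sum>n\<in>A. F n (component n f))"
  unfolding arity_sum_def
proof (rule sum.mono_neutral_left[OF assms(2,3)], rule ballI)
  fix n assume "n \<in> A - arity_set f"
  then have "component n f = 0" using component_outside[of n f] by (simp add: zero_fun_def)
  then show "F n (component n f) = 0" by (simp only: assms(1))
qed

lemma arity_sum_linear:
  assumes add: "\<And>n f g. n \<noteq> 0 \<Longrightarrow> f \<in> C n \<Longrightarrow> g \<in> C n \<Longrightarrow> F n (f + g) = F n f + F n g"
    and scale: "\<And>n c f. n \<noteq> 0 \<Longrightarrow> f \<in> C n \<Longrightarrow> F n (fscale c f) = fscale c (F n f)"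
    and zero: "\<And>n. F n 0 = 0"
    and f: "f \<in> CC" "g \<in> CC"
  shows "arity_sum F (f + g) = arity_sum F f + arity_sum F g" and "arity_sum F (fscale c f) = fscale c (arity_sum F f)"
proof -
  let ?A = "arity_set f \<union> arity_set g"
  have A: "finite ?A" "0 \<notin> ?A" using f CC_arity by auto
  have nz: "n \<noteq> 0" if "n \<in> ?A" for n using A(2) that by (cases n) auto
  note sup = arity_sum_superset[where F = F, OF zero A(1)]
  have "arity_sum F (f + g) = (\<Sum>n\<in>?A. F n (component n f) + F n (component n g))"
    unfolding sup[OF arity_set_add]
    by (intro sum.cong refl) (use nz f in \<open>simp add: component_add add CC_component\<close>)
  then show "arity_sum F (f + g) = arity_sum F f + arity_sum F g"
    using sup[of f] sup[of g] by (simp add: sum.distrib)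
  have "arity_set (fscale c f) \<subseteq> ?A" using arity_set_scale[of c f] by auto
  then have "arity_sum F (fscale c f) = (\<Sum>n\<in>?A. fscale c (F n (component n f)))"
    unfolding sup[OF \<open>arity_set (fscale c f) \<subseteq> ?A\<close>]
    by (intro sum.cong refl) (use nz f in \<open>simp add: component_fscale scale CC_component\<close>)
  then show "arity_sum F (fscale c f) = fscale c (arity_sum F f)"
    using sup[of f] by (simp add: fun_eq_iff fscale_apply sum_fun_apply scale_sum_right)
qed

lemma arity_sum_C: "F n 0 = 0 \<Longrightarrow> f \<in> C n \<Longrightarrow> arity_sum F f = F n f"
proof -
  assume F: "F n 0 = 0" and f: "f \<in> C n"
  show "arity_sum F f = F n f"
  proof (cases "arity_set f = {n}")
    case True
    then show ?thesis using f by (simp add: arity_sum_def component_C)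
  next
    case False
    then have "arity_set f = {}" using arity_set_C[OF f] by auto
    then have "f = 0" by (auto simp: arity_set_def fun_eq_iff)
    then show ?thesis using F by (simp add: arity_sum_def arity_set_def)
  qed
qed

lemma arity_sum_CC:
  assumes "\<And>n f. n \<noteq> 0 \<Longrightarrow> f \<in> C n \<Longrightarrow> F n f \<in> CC" and f: "f \<in> CC"
  shows "arity_sum F f \<in> CC"
  unfolding arity_sum_def
proof (intro CC_sum assms(1))
  fix n assume "n \<in> arity_set f"
  then show "n \<noteq> 0" using CC_arity(1)[OF f] by (cases n) auto
  then show "component n f \<in> C n" by (rule CC_component[OF f])
qed

lemma CC_decompose: "f = arity_sum (\<lambda>n f. f) f" if "f \<in> CC"
proof
  fix xs
  have "(\<Sum>n\<in>arity_set f. component n f xs) = (\<Sum>n\<in>arity_set f. if length xs = n then f xs else 0)"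
    by (simp add: component_def)
  also have "\<dots> = f xs"
    using CC_arity(2)[OF that] by (auto simp: sum.delta' arity_set_def)
  finally show "f xs = arity_sum (\<lambda>n f. f) f xs" by (simp add: arity_sum_def sum_fun_apply)
qed

lemma CC_induct [consumes 1, case_names zero homogeneous add]:
  assumes f: "f \<in> CC" and zero: "P 0"
    and hom: "\<And>n f. n \<noteq> 0 \<Longrightarrow> f \<in> C n \<Longrightarrow> P f"
    and add: "\<And>f g. f \<in> CC \<Longrightarrow> g \<in> CC \<Longrightarrow> P f \<Longrightarrow> P g \<Longrightarrow> P (f + g)"
  shows "P f"
proof -
  have "(\<Sum>n\<in>A. component n f) \<in> CC \<and> P (\<Sum>n\<in>A. component n f)" if "finite A" "A \<subseteq> arity_set f" for A
    using that
  proof (induction A rule: finite_induct)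
    case (insert n A)
    then have n0: "n \<noteq> 0" using CC_arity(1)[OF f] by (cases n) auto
    then have n: "component n f \<in> C n" by (rule CC_component[OF f])
    then have "component n f \<in> CC" using n0 C_subset_CC by (cases n) auto
    moreover have "(\<Sum>n\<in>A. component n f) \<in> CC" "P (\<Sum>n\<in>A. component n f)" using insert by auto
    moreover have "P (component n f)" by (rule hom[OF n0 n])
    ultimately show ?case
      unfolding sum.insert[OF insert(1,2)] by (intro conjI CC_add add)
  qed (simp add: zero CC_zero)
  from this[of "arity_set f"] have "P (\<Sum>n\<in>arity_set f. component n f)"
    using CC_arity(2)[OF f] by simp
  moreover have "(\<Sum>n\<in>arity_set f. component n f) = f"
    by (rule CC_decompose[OF f, unfolded arity_sum_def, symmetric])
  ultimately show ?thesis by simp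
qed

lemma br_blocks:
  assumes "cochain_block x" and "\<And>y. y \<in> set Y \<Longrightarrow> cochain_block y"
  shows "br (snd x) (map snd Y) = ins Y (snd x)"
proof -
  have "homogeneous (map fst Y) (map snd Y)"
    using assms(2) by (auto simp: homogeneous_def cochain_block_def list_all2_conv_all_nth)
  then show ?thesis
    using hoch_brace_eq_ins[of "snd x" "fst x"] assms(1) by (simp add: cochain_block_def zip_map_fst_snd)
qed

lemma m_CC: "m \<in> CC"
  using m_in_C by (rule C_subset_CC)

lemma br_add_head: "f \<in> CC \<Longrightarrow> f' \<in> CC \<Longrightarrow> set gs \<subseteq> CC \<Longrightarrow> br (f + f') gs = br f gs + br f' gs"
  by (rule hoch_brace_linear_head)

lemma br_scale_head: "f \<in> CC \<Longrightarrow> set gs \<subseteq> CC \<Longrightarrow> br (fscale c f) gs = fscale c (br f gs)"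
  by (rule hoch_brace_linear_head)

lemma br_zero_head: "br 0 gs = 0"
  by (simp add: hoch_brace_def arity_set_def fun_eq_iff)

lemma br_zero_arg: "f \<in> CC \<Longrightarrow> set gs1 \<subseteq> CC \<Longrightarrow> set gs2 \<subseteq> CC \<Longrightarrow> br f (gs1 @ 0 # gs2) = 0"
  using hoch_brace_linear_arg(1)[of f gs1 gs2 0 0] CC_zero by simp

lemma br_arg1:
  assumes "f \<in> CC"
  shows "g \<in> CC \<Longrightarrow> g' \<in> CC \<Longrightarrow> br f [g + g'] = br f [g] + br f [g']"
    "g \<in> CC \<Longrightarrow> br f [fscale c g] = fscale c (br f [g])" "br f [0] = 0"
  using hoch_brace_linear_arg[of f "[]" "[]" g g'] hoch_brace_linear_arg(2)[of f "[]" "[]" g g]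
    br_zero_arg[of f "[]" "[]"] assms by simp_all

lemma br_arg2:
  assumes "f \<in> CC" "h \<in> CC"
  shows "g \<in> CC \<Longrightarrow> g' \<in> CC \<Longrightarrow> br f [g + g', h] = br f [g, h] + br f [g', h]"
    "g \<in> CC \<Longrightarrow> br f [fscale c g, h] = fscale c (br f [g, h])" "br f [0, h] = 0"
    "g \<in> CC \<Longrightarrow> g' \<in> CC \<Longrightarrow> br f [h, g + g'] = br f [h, g] + br f [h, g']"
    "g \<in> CC \<Longrightarrow> br f [h, fscale c g] = fscale c (br f [h, g])" "br f [h, 0] = 0"
  using hoch_brace_linear_arg[of f "[]" "[h]" g g'] hoch_brace_linear_arg(2)[of f "[]" "[h]" g g]
    br_zero_arg[of f "[]" "[h]"] hoch_brace_linear_arg[of f "[h]" "[]" g g']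
    hoch_brace_linear_arg(2)[of f "[h]" "[]" g g] br_zero_arg[of f "[h]" "[]"] assms by simp_all

lemma C_CC: "n \<noteq> 0 \<Longrightarrow> f \<in> C n \<Longrightarrow> f \<in> CC"
  using C_subset_CC by (cases n) auto

definition d_summand where "d_summand n f = br m [f] - sg (n - 1) (br f [m])"
definition cup_summand where "cup_summand g n f = sg n (br m [f, g])"

lemma dh_eq: "dh f = arity_sum d_summand f"
  by (simp add: hoch_d_def arity_sum_def d_summand_def m_def fun_eq_iff sum_fun_apply sg_scale sg_apply)

lemma cup_eq: "cup f g = arity_sum (cup_summand g) f"
  by (simp add: hoch_cup_def arity_sum_def cup_summand_def m_def fun_eq_iff sum_fun_apply sg_scale sg_apply)

lemma dh_CC: "f \<in> CC \<Longrightarrow> dh f \<in> CC"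
  unfolding dh_eq by (rule arity_sum_CC) (simp add: d_summand_def CC_diff CC_sg hoch_brace_CC C_CC m_CC)

lemma cup_CC: "f \<in> CC \<Longrightarrow> g \<in> CC \<Longrightarrow> cup f g \<in> CC"
  unfolding cup_eq by (rule arity_sum_CC) (simp add: cup_summand_def CC_sg hoch_brace_CC C_CC m_CC)

lemma d_summand_zero: "d_summand n 0 = 0"
  by (simp add: d_summand_def br_arg1(3)[OF m_CC] br_zero_head)

lemma cup_summand_zero: "g \<in> CC \<Longrightarrow> cup_summand g n 0 = 0"
  by (simp add: cup_summand_def br_arg2(3)[OF m_CC])

lemma dh_linear:
  assumes "f \<in> CC" "g \<in> CC"
  shows "dh (f + g) = dh f + dh g" "dh (fscale c f) = fscale c (dh f)"
  unfolding dh_eq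
  by (rule arity_sum_linear(1)[where F = d_summand, OF _ _ d_summand_zero assms] arity_sum_linear(2)[where F = d_summand, OF _ _ d_summand_zero assms];
      simp add: d_summand_def br_arg1[OF m_CC] br_add_head br_scale_head C_CC m_CC sg_add fscale_laws)+

lemma cup_linear_left:
  assumes "f \<in> CC" "g \<in> CC" "h \<in> CC"
  shows "cup (f + g) h = cup f h + cup g h" "cup (fscale c f) h = fscale c (cup f h)"
  unfolding cup_eq
  by (rule arity_sum_linear(1)[where F = "cup_summand h", OF _ _ cup_summand_zero[OF assms(3)] assms(1,2)] arity_sum_linear(2)[where F = "cup_summand h", OF _ _ cup_summand_zero[OF assms(3)] assms(1,2)];
      simp add: cup_summand_def br_arg2[OF m_CC] C_CC m_CC sg_add fscale_laws assms)+

lemma cup_linear_right: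
  assumes "f \<in> CC" "g \<in> CC" "h \<in> CC"
  shows "cup h (f + g) = cup h f + cup h g" "cup h (fscale c f) = fscale c (cup h f)"
proof -
  have h: "component n h \<in> CC" if "n \<in> arity_set h" for n
    using CC_component[OF assms(3), of n] CC_arity(1)[OF assms(3)] that C_CC by (cases n) auto
  show "cup h (f + g) = cup h f + cup h g"
    unfolding cup_eq arity_sum_def sum.distrib[symmetric]
    by (intro sum.cong refl) (simp add: cup_summand_def br_arg2[OF m_CC] h assms sg_add)
  have "fscale c (\<Sum>i\<in>A. F i) = (\<Sum>i\<in>A. fscale c (F i))" for A and F :: "nat \<Rightarrow> 'a cochain"
    by (simp add: fscale_def fun_eq_iff sum_fun_apply scale_sum_right)
  then show "cup h (fscale c f) = fscale c (cup h f)"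
    unfolding cup_eq arity_sum_def
    by (simp add: cup_summand_def br_arg2[OF m_CC] h assms fscale_laws)
qed

lemma dh_block:
  assumes "cochain_block x" shows "dh (snd x) = snd (block_d x)"
proof -
  have "dh (snd x) = d_summand (Suc (fst x)) (snd x)"
    unfolding dh_eq by (rule arity_sum_C) (use assms d_summand_zero in \<open>auto simp: cochain_block_def\<close>)
  moreover have "br (snd mb) (map snd [x]) = ins [x] (snd mb)" "br (snd x) (map snd [mb]) = ins [mb] (snd x)"
    by (rule br_blocks; use assms mb_block in auto)+
  ultimately show ?thesis by (simp add: d_summand_def block_d_def)
qed

lemma cup_block:
  assumes "cochain_block x" "cochain_block y" shows "cup (snd x) (snd y) = snd (block_cup x y)"
proof -
  have "snd y \<in> CC" using assms(2) C_subset_CC by (simp add: cochain_block_def)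
  then have "cup (snd x) (snd y) = cup_summand (snd y) (Suc (fst x)) (snd x)"
    unfolding cup_eq by (intro arity_sum_C) (use assms cup_summand_zero in \<open>auto simp: cochain_block_def\<close>)
  moreover have "br (snd mb) (map snd [x, y]) = ins [x, y] (snd mb)"
    by (rule br_blocks) (use assms mb_block in auto)
  ultimately show ?thesis by (simp add: cup_summand_def block_cup_def)
qed

text \<open>
  Elements of negative degree are zero, and the zero cochain is a block of every shifted degree.
  Choosing one with the right parity makes all sign computations uniform, with no case distinction
  on the degree.
\<close>

lemma shifted_block:
  assumes "x \<in> shifted V a"
  obtains h where "cochain_block h" "snd h = x" "even (fst h) = even a"
proof (cases "a \<ge> 0")
  case True
  then have "x \<in> C (Suc (nat a))" using assms by (simp add: shifted_def V_iff nat_add_distrib)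
  then show ?thesis using True that[of "(nat a, x)"] by (simp add: cochain_block_def even_nat_iff)
next
  case False
  then have "x = 0" using assms by (simp add: shifted_def V_iff)
  then show ?thesis
    using that[of "(nat (a mod 2), x)"] C_zero by (simp add: cochain_block_def even_nat_iff)
qed

lemma shifted_list_blocks:
  assumes "shifted_list V as xs"
  obtains H where "\<forall>h\<in>set H. cochain_block h" "map snd H = xs" "list_all2 (\<lambda>a h. even (fst h) = even a) as H"
proof -
  have "\<exists>H. (\<forall>h\<in>set H. cochain_block h) \<and> map snd H = xs \<and> list_all2 (\<lambda>a h. even (fst h) = even a) as H"
    using assms unfolding shifted_list_def
  proof (induction as xs rule: list_all2_induct)
    case (Cons a as x xs)
    then obtain H where H: "\<forall>h\<in>set H. cochain_block h" "map snd H = xs" "list_all2 (\<lambda>a h. even (fst h) = even a) as H"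
      by blast
    obtain h where "cochain_block h" "snd h = x" "even (fst h) = even a"
      using shifted_block[OF Cons(1)] .
    then show ?case using H by (intro exI[of _ "h # H"]) auto
  qed simp
  then show ?thesis using that by blast
qed

lemma even_sum_cong:
  assumes "\<And>p. p \<in> A \<Longrightarrow> even (f p :: int) = even (g p :: nat)"
  shows "even (\<Sum>p\<in>A. f p) = even (\<Sum>p\<in>A. g p)"
  using assms by (induction A rule: infinite_finite_induct) auto

lemma block_CC: "cochain_block h \<Longrightarrow> snd h \<in> CC"
  by (simp add: cochain_block_def C_subset_CC)

text \<open>
  All lists over which \<open>brace_sum\<close> ranges consist of cochains again.
\<close>

lemma brace_sum_blocks_cong:
  assumes "\<And>h. h \<in> set H \<Longrightarrow> cochain_block h" "\<And>y. y \<in> set Y \<Longrightarrow> cochain_block y"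
    and "\<And>W. (\<And>w. w \<in> set W \<Longrightarrow> cochain_block w) \<Longrightarrow> \<Phi> W = \<Psi> W"
  shows "brace_sum H Y \<Phi> = brace_sum H Y \<Psi>"
  using assms
proof (induction H arbitrary: Y \<Phi> \<Psi>)
  case (Cons x H)
  show ?case
    unfolding brace_sum.simps
  proof (rule cuts_cong, rule cuts_cong, rule Cons.IH)
    fix Y1 R Y2 Y3 and W :: "(nat \<times> 'a cochain) list"
    assume *: "Y1 @ R = Y" "Y2 @ Y3 = R" and W: "\<And>w. w \<in> set W \<Longrightarrow> cochain_block w"
    have Y: "\<And>y. y \<in> set Y1 \<union> set Y2 \<Longrightarrow> cochain_block y" using Cons.prems(2) * by auto
    have "\<Phi> (Y1 @ block_brace x Y2 # W) = \<Psi> (Y1 @ block_brace x Y2 # W)"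
    proof (rule Cons.prems(3))
      have "cochain_block (block_brace x Y2)"
        by (rule block_brace_cochain) (use Y Cons.prems(1) in auto)
      then show "cochain_block w" if "w \<in> set (Y1 @ block_brace x Y2 # W)" for w
        using that Y[of w] W[of w] by auto
    qed
    then show "sg (fst x * weight Y1 + weight H * (weight Y1 + weight Y2)) (\<Phi> (Y1 @ block_brace x Y2 # W))
      = sg (fst x * weight Y1 + weight H * (weight Y1 + weight Y2)) (\<Psi> (Y1 @ block_brace x Y2 # W))" by simp
  qed (use Cons.prems in auto)
qed simp

end

section \<open>The brace axioms\<close>

context bihom_associative_algebra
begin

lemma linear_on_M:
  "linear_on KR M F \<longleftrightarrow> (\<forall>x\<in>CC. F x \<in> CC) \<and> (\<forall>x\<in>CC. \<forall>y\<in>CC. F (x + y) = F x + F y) \<and>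
     (\<forall>c. \<forall>x\<in>CC. F (fscale c x) = fscale c (F x))"
  by (auto simp: linear_on_def Pi_iff)

lemma signed_CC: "f \<in> CC \<Longrightarrow> signed M k f \<in> CC"
  by (simp add: signed_def a_inv_M CC_uminus)

lemma homogeneous_block: "n \<noteq> 0 \<Longrightarrow> f \<in> C n \<Longrightarrow> cochain_block (n - 1, f)"
  by (simp add: cochain_block_def)

lemma dh_zero: "dh 0 = 0"
  using dh_linear(1)[OF CC_zero CC_zero] by simp

lemma dh_dh: "f \<in> CC \<Longrightarrow> dh (dh f) = 0"
proof (induction f rule: CC_induct)
  case zero
  show ?case by (simp only: dh_zero)
next
  case (homogeneous n f)
  then have b: "cochain_block (n - 1, f)" by (rule homogeneous_block)
  show ?case
    using dh_block[OF b] dh_block[OF block_d_cochain[OF b]] block_d_block_d[OF b] by simp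
next
  case (add f g)
  then show ?case by (simp add: dh_linear dh_CC del: plus_fun_apply zero_fun_apply)
qed

lemma cup_zero: "f \<in> CC \<Longrightarrow> cup 0 f = 0" "f \<in> CC \<Longrightarrow> cup f 0 = 0"
  using cup_linear_left(1)[OF CC_zero CC_zero] cup_linear_right(1)[OF CC_zero CC_zero] by auto

text \<open>
  By trilinearity it suffices to compare homogeneous cochains, that is, blocks.
\<close>

lemma cup_assoc:
  assumes "f \<in> CC" "g \<in> CC" "h \<in> CC"
  shows "cup (cup f g) h = cup f (cup g h)"
  using assms(1)
proof (induction f rule: CC_induct)
  case zero
  show ?case using assms by (simp only: cup_zero cup_CC)
next
  case (add f f')
  then show ?case using assms by (simp add: cup_linear_left cup_CC del: plus_fun_apply zero_fun_apply)
next
  case f: (homogeneous k f)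
  show ?case
    using assms(2)
  proof (induction g rule: CC_induct)
    case zero
    show ?case using assms C_CC[OF f] by (simp only: cup_zero)
  next
    case (add g g')
    then show ?case using assms C_CC[OF f] by (simp add: cup_linear_left cup_linear_right cup_CC del: plus_fun_apply zero_fun_apply)
  next
    case g: (homogeneous l g)
    show ?case
      using assms(3)
    proof (induction h rule: CC_induct)
      case zero
      show ?case using C_CC[OF f] C_CC[OF g] by (simp only: cup_zero cup_CC)
    next
      case (add h h')
      then show ?case using C_CC[OF f] C_CC[OF g] by (simp add: cup_linear_right cup_CC del: plus_fun_apply zero_fun_apply)
    next
      case h: (homogeneous r h)
      note b = homogeneous_block[OF f] homogeneous_block[OF g] homogeneous_block[OF h]
      show ?case
        using cup_block[OF b(1,2)] cup_block[OF b(2,3)] cup_block[OF block_cup_cochain[OF b(1,2)] b(3)]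
          cup_block[OF b(1) block_cup_cochain[OF b(2,3)]] block_cup_assoc[OF b] by simp
    qed
  qed
qed

lemma blocks_CC: "(\<And>h. h \<in> set H \<Longrightarrow> cochain_block h) \<Longrightarrow> set (map snd H) \<subseteq> CC"
  using block_CC by auto

text \<open>
  The elements are represented by blocks whose shifted degrees have the
  right parities; this suffices because the exponents of the signs are sums of products of degrees.
\<close>

lemma brace_brace_M:
  assumes "x \<in> shifted V a" "shifted_list V as xs" "shifted_list V bs ys"
  shows "br (br x xs) ys =
        finsum M (\<lambda>(is, js).
           signed M (\<Sum>p<length xs. as ! p * (\<Sum>q<is ! p. bs ! q)) (br x (brace_args br xs ys is js)))
          (brace_indices (length xs) (length ys))"
proof -
  obtain h where h: "cochain_block h" "snd h = x" using shifted_block[OF assms(1)] .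
  obtain H where H0: "\<forall>h\<in>set H. cochain_block h" "map snd H = xs" "list_all2 (\<lambda>a h. even (fst h) = even a) as H"
    using shifted_list_blocks[OF assms(2)] .
  have H: "\<And>h. h \<in> set H \<Longrightarrow> cochain_block h" "map snd H = xs" "list_all2 (\<lambda>a h. even (fst h) = even a) as H"
    using H0 by auto
  obtain Y where Y0: "\<forall>h\<in>set Y. cochain_block h" "map snd Y = ys" "list_all2 (\<lambda>a h. even (fst h) = even a) bs Y"
    using shifted_list_blocks[OF assms(3)] .
  have Y: "\<And>h. h \<in> set Y \<Longrightarrow> cochain_block h" "map snd Y = ys" "list_all2 (\<lambda>a h. even (fst h) = even a) bs Y"
    using Y0 by auto
  have len: "length H = length xs" "length Y = length ys" using H(2) Y(2) by auto
  have slice_sub: "set (slice i j Y) \<subseteq> set Y" for i j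
    unfolding slice_def using set_drop_subset set_take_subset by (metis order_trans)
  have args: "set (brace_args br xs ys is js) \<subseteq> CC" if "(is, js) \<in> brace_indices (length xs) (length ys)" for "is" js
  proof -
    have ys: "set ys \<subseteq> CC" unfolding Y(2)[symmetric] by (rule blocks_CC[OF Y(1)])
    have xs: "set xs \<subseteq> CC" unfolding H(2)[symmetric] by (rule blocks_CC[OF H(1)])
    have sl: "set (slice i j ys) \<subseteq> CC" for i j
      unfolding slice_def using ys by (meson order_trans set_drop_subset set_take_subset)
    have "set (drop i ys) \<subseteq> CC" for i
      using ys by (meson order_trans set_drop_subset)
    then show ?thesis
      using sl xs unfolding brace_args_def
      by (auto intro!: hoch_brace_CC sl dest: subsetD[OF sl] subsetD[OF \<open>\<And>i. set (drop i ys) \<subseteq> CC\<close>])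
  qed
  have xC: "x \<in> CC" using block_CC[OF h(1)] h(2) by simp
  have "br (br x xs) ys = ins Y (ins H (snd h))"
  proof -
    have "br (snd h) (map snd H) = ins H (snd h)"
      by (rule br_blocks[OF h(1)]) (rule H(1))
    moreover have "br (snd (block_brace h H)) (map snd Y) = ins Y (snd (block_brace h H))"
      by (rule br_blocks[OF block_brace_cochain[OF h(1)]]) (rule H(1), assumption, rule Y(1))
    ultimately show ?thesis using h(2) H(2) Y(2) by (simp add: block_brace_def)
  qed
  also have "\<dots> = brace_sum H Y (\<lambda>W. ins W (snd h))"
    by (rule blocks_ins_ins) (use H Y cochain_blockD[OF h(1)] in auto)
  also have "\<dots> = brace_sum H Y (\<lambda>W. br (snd h) (map snd W))"
    by (rule brace_sum_blocks_cong) (use H Y br_blocks[OF h(1)] in auto)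
  also have "\<dots> = (\<Sum>(is, js)\<in>brace_indices (length H) (length Y).
      sg (\<Sum>p<length H. fst (H ! p) * (\<Sum>q<is ! p. fst (Y ! q)))
        (br (snd h) (brace_args br (map snd H) (map snd Y) is js)))"
    by (rule brace_sum_eq_sum) (use H(1) Y(1) br_blocks slice_sub in blast)
  also have "\<dots> = (\<Sum>(is, js)\<in>brace_indices (length xs) (length ys).
      signed M (\<Sum>p<length xs. as ! p * (\<Sum>q<is ! p. bs ! q)) (br x (brace_args br xs ys is js)))"
    unfolding h(2) H(2) Y(2) len
  proof (rule sum.cong[OF refl])
    fix ij assume "ij \<in> brace_indices (length xs) (length ys)"
    then obtain "is" js where ij: "ij = (is, js)" "(is, js) \<in> brace_indices (length xs) (length ys)" by (cases ij) auto
    have "even (\<Sum>p<length xs. as ! p * (\<Sum>q<is ! p. bs ! q)) = even (\<Sum>p<length xs. fst (H ! p) * (\<Sum>q<is ! p. fst (Y ! q)))"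
    proof (rule even_sum_cong)
      fix p assume p: "p \<in> {..<length xs}"
      have "even (as ! p) = even (fst (H ! p))"
        using H(3) p len by (auto simp: list_all2_conv_all_nth)
      moreover have "is ! p \<le> length ys"
        using ij(2) p by (auto simp: brace_indices_def intro: order_trans)
      then have "even (\<Sum>q<is ! p. bs ! q) = even (\<Sum>q<is ! p. fst (Y ! q))"
        using Y(3) len by (intro even_sum_cong) (auto simp: list_all2_conv_all_nth)
      ultimately show "even (as ! p * (\<Sum>q<is ! p. bs ! q)) = even (fst (H ! p) * (\<Sum>q<is ! p. fst (Y ! q)))"
        by simp
    qed
    then show "(case ij of (is, js) \<Rightarrow> sg (\<Sum>p<length xs. fst (H ! p) * (\<Sum>q<is ! p. fst (Y ! q))) (br x (brace_args br xs ys is js)))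
      = (case ij of (is, js) \<Rightarrow> signed M (\<Sum>p<length xs. as ! p * (\<Sum>q<is ! p. bs ! q)) (br x (brace_args br xs ys is js)))"
      unfolding ij(1) prod.case by (intro signed_M[symmetric] hoch_brace_CC xC args ij(2))
  qed
  also have "\<dots> = finsum M (\<lambda>(is, js).
           signed M (\<Sum>p<length xs. as ! p * (\<Sum>q<is ! p. bs ! q)) (br x (brace_args br xs ys is js)))
          (brace_indices (length xs) (length ys))"
  proof (rule finsum_M[symmetric, OF finite_brace_indices])
    fix ij assume "ij \<in> brace_indices (length xs) (length ys)"
    then show "(case ij of (is, js) \<Rightarrow> signed M (\<Sum>p<length xs. as ! p * (\<Sum>q<is ! p. bs ! q)) (br x (brace_args br xs ys is js))) \<in> CC"
      using hoch_brace_CC[OF xC args] by (cases ij) (auto simp: signed_def a_inv_M CC_uminus)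
  qed
  finally show ?thesis .
qed

text \<open>
  The formula \<open>ins_block_cup\<close> for representing blocks.
\<close>

lemma brace_prd_M:
  assumes "x1 \<in> shifted V a1" "x2 \<in> shifted V a2" "shifted_list V bs ys"
  shows "br (cup x1 x2) ys =
        (\<Oplus>\<^bsub>M\<^esub>k\<in>{0..length ys}. signed M ((a2 + 1) * (\<Sum>p<k. bs ! p)) (cup (br x1 (take k ys)) (br x2 (drop k ys))))"
proof -
  obtain h1 where h1: "cochain_block h1" "snd h1 = x1" "even (fst h1) = even a1" using shifted_block[OF assms(1)] .
  obtain h2 where h2: "cochain_block h2" "snd h2 = x2" "even (fst h2) = even a2" using shifted_block[OF assms(2)] .
  obtain Y where Y0: "\<forall>h\<in>set Y. cochain_block h" "map snd Y = ys" "list_all2 (\<lambda>a h. even (fst h) = even a) bs Y"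
    using shifted_list_blocks[OF assms(3)] .
  have Y: "\<And>h. h \<in> set Y \<Longrightarrow> cochain_block h" "map snd Y = ys" "list_all2 (\<lambda>a h. even (fst h) = even a) bs Y"
    using Y0 by auto
  have len: "length Y = length ys" using Y(2) by auto
  have sub: "h \<in> set (take k Y) \<Longrightarrow> cochain_block h" "h \<in> set (drop k Y) \<Longrightarrow> cochain_block h" for h k
    using Y(1)[of h] by (auto dest: in_set_takeD in_set_dropD)
  have b: "br x1 (take k ys) = snd (block_brace h1 (take k Y))" "br x2 (drop k ys) = snd (block_brace h2 (drop k Y))" for k
    using br_blocks[OF h1(1), of "take k Y", OF sub(1)] br_blocks[OF h2(1), of "drop k Y", OF sub(2)] h1(2) h2(2) Y(2)[symmetric]
    by (simp_all add: block_brace_def take_map drop_map)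
  have bb: "cochain_block (block_brace h1 (take k Y))" "cochain_block (block_brace h2 (drop k Y))" for k
    using block_brace_cochain[OF h1(1), of "take k Y", OF sub(1)] block_brace_cochain[OF h2(1), of "drop k Y", OF sub(2)] by auto
  have "br (cup x1 x2) ys = ins Y (snd (block_cup h1 h2))"
    using br_blocks[OF block_cup_cochain[OF h1(1) h2(1)], of Y] Y(1) cup_block[OF h1(1) h2(1)] h1(2) h2(2) Y(2) by simp
  also have "\<dots> = (\<Sum>k\<le>length ys. sg (Suc (fst h2) * weight (take k Y)) (cup (br x1 (take k ys)) (br x2 (drop k ys))))"
    by (simp only: ins_block_cup[OF h1(1) h2(1) Y(1)] cuts_eq_sum len b cup_block[OF bb])
  also have "\<dots> = (\<Sum>k\<in>{0..length ys}. signed M ((a2 + 1) * (\<Sum>p<k. bs ! p)) (cup (br x1 (take k ys)) (br x2 (drop k ys))))"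
  proof (rule sum.cong)
    fix k assume k: "k \<in> {0..length ys}"
    have "even (\<Sum>p<k. bs ! p) = even (\<Sum>p<k. fst (Y ! p))"
      using Y(3) len k by (intro even_sum_cong) (auto simp: list_all2_conv_all_nth)
    then have "even ((a2 + 1) * (\<Sum>p<k. bs ! p)) = even (Suc (fst h2) * weight (take k Y))"
      using k len h2(3) by (simp add: weight_take) blast
    then show "sg (Suc (fst h2) * weight (take k Y)) (cup (br x1 (take k ys)) (br x2 (drop k ys))) =
      signed M ((a2 + 1) * (\<Sum>p<k. bs ! p)) (cup (br x1 (take k ys)) (br x2 (drop k ys)))"
      by (intro signed_M[symmetric]) (auto simp: b intro!: cup_CC block_CC bb)
  qed auto
  also have "\<dots> = (\<Oplus>\<^bsub>M\<^esub>k\<in>{0..length ys}. signed M ((a2 + 1) * (\<Sum>p<k. bs ! p)) (cup (br x1 (take k ys)) (br x2 (drop k ys))))"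
    by (rule finsum_M[symmetric]) (auto simp: b intro!: signed_CC cup_CC block_CC bb)
  finally show ?thesis .
qed

text \<open>
  The homotopy formula \<open>block_d_ins\<close> for representing blocks.  \<open>D\<close> and \<open>P\<close> identify the
  summands of its two sums, \<open>s1\<close>, \<open>s2\<close>, \<open>t1\<close> and \<open>t2\<close> the signs, which agree because the
  parities do.
\<close>

lemma d_brace_M:
  assumes "x \<in> shifted V a" "shifted_list V as xs" "N = length xs" "N \<ge> 1"
  shows "dh (br x xs) \<ominus>\<^bsub>M\<^esub> br (dh x) xs
        \<ominus>\<^bsub>M\<^esub> signed M a (\<Oplus>\<^bsub>M\<^esub>i\<in>{0..<N}. signed M (\<Sum>p<i. as ! p) (br x (xs[i := dh (xs ! i)])))
      = signed M ((a + 1) * as ! 0) (cup (xs ! 0) (br x (tl xs)))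
        \<ominus>\<^bsub>M\<^esub> signed M a (\<Oplus>\<^bsub>M\<^esub>i\<in>{0..<N - 1}. signed M (\<Sum>p\<le>i. as ! p)
             (br x (take i xs @ [cup (xs ! i) (xs ! Suc i)] @ drop (i + 2) xs)))
        \<oplus>\<^bsub>M\<^esub> signed M (a + (\<Sum>p<N - 1. as ! p)) (cup (br x (butlast xs)) (last xs))"
proof -
  obtain h where h: "cochain_block h" "snd h = x" "even (fst h) = even a" using shifted_block[OF assms(1)] .
  obtain H where H0: "\<forall>h\<in>set H. cochain_block h" "map snd H = xs" "list_all2 (\<lambda>a h. even (fst h) = even a) as H"
    using shifted_list_blocks[OF assms(2)] .
  have H: "\<And>h. h \<in> set H \<Longrightarrow> cochain_block h" "map snd H = xs" "list_all2 (\<lambda>a h. even (fst h) = even a) as H"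
    using H0 by auto
  have len: "length H = N" "length as = N" "H \<noteq> []" "xs \<noteq> []"
    using H(2,3) assms(3,4) by (auto simp: list_all2_lengthD)
  have Hi: "cochain_block (H ! i)" if "i < N" for i using H(1) len that by auto
  have par: "even (as ! i) = even (fst (H ! i))" if "i < N" for i
    using H(3) len that by (auto simp: list_all2_conv_all_nth)
  have xsi: "xs ! i = snd (H ! i)" if "i < N" for i using H(2) len that by auto
  have xC: "x \<in> CC" using block_CC[OF h(1)] h(2) by simp
  have xsC: "set xs \<subseteq> CC" unfolding H(2)[symmetric] by (rule blocks_CC[OF H(1)])
  have sums: "even (\<Sum>p<i. as ! p) = even (weight (take i H))" if "i \<le> N" for i
    using that len by (simp add: weight_take) (intro even_sum_cong par; simp)
  have sub: "set (take i xs) \<subseteq> CC" "set (drop i xs) \<subseteq> CC" for i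
    using xsC by (meson order_trans set_take_subset set_drop_subset)+
  have lists: "\<And>y. y \<in> set (take i H @ z # drop j H) \<Longrightarrow> cochain_block y" if "cochain_block z" for z i j
    using that H(1) by (auto dest: in_set_takeD in_set_dropD)
  have D: "br x (xs[i := dh (xs ! i)]) = ins (take i H @ block_d (H ! i) # drop (Suc i) H) (snd h)" if "i < N" for i
  proof -
    have "xs[i := dh (xs ! i)] = map snd (take i H @ block_d (H ! i) # drop (Suc i) H)"
    proof -
      have l: "i < length H" using that len by simp
      show ?thesis
        unfolding H(2)[symmetric] using l by (simp add: upd_conv_take_nth_drop dh_block[OF Hi[OF that]] take_map drop_map)
    qed
    moreover have "br (snd h) (map snd (take i H @ block_d (H ! i) # drop (Suc i) H)) = ins (take i H @ block_d (H ! i) # drop (Suc i) H) (snd h)"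
      by (rule br_blocks[OF h(1)]) (rule lists[OF block_d_cochain[OF Hi[OF that]]])
    ultimately show ?thesis using h(2) by simp
  qed
  have P: "br x (take i xs @ [cup (xs ! i) (xs ! Suc i)] @ drop (i + 2) xs) = ins (take i H @ block_cup (H ! i) (H ! Suc i) # drop (i + 2) H) (snd h)"
    if "i < N - 1" for i
  proof -
    have i: "i < N" "Suc i < N" using that by auto
    have "take i xs @ [cup (xs ! i) (xs ! Suc i)] @ drop (i + 2) xs = map snd (take i H @ block_cup (H ! i) (H ! Suc i) # drop (i + 2) H)"
    proof -
      have l: "i < length H" "Suc i < length H" using i len by simp_all
      show ?thesis
        unfolding H(2)[symmetric] using l by (simp add: cup_block[OF Hi[OF i(1)] Hi[OF i(2)]] take_map drop_map)
    qed
    moreover have "br (snd h) (map snd (take i H @ block_cup (H ! i) (H ! Suc i) # drop (i + 2) H)) = ins (take i H @ block_cup (H ! i) (H ! Suc i) # drop (i + 2) H) (snd h)"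
      by (rule br_blocks[OF h(1)]) (rule lists[OF block_cup_cochain[OF Hi[OF i(1)] Hi[OF i(2)]]])
    ultimately show ?thesis using h(2) by simp
  qed
  have DC: "br x (xs[i := dh (xs ! i)]) \<in> CC" if "i < N" for i
  proof (rule hoch_brace_CC[OF xC])
    have "xs ! i \<in> CC" using that assms(3) by (auto intro: subsetD[OF xsC])
    then show "set (xs[i := dh (xs ! i)]) \<subseteq> CC" by (intro set_update_subsetI xsC dh_CC)
  qed
  have PC: "br x (take i xs @ [cup (xs ! i) (xs ! Suc i)] @ drop (i + 2) xs) \<in> CC" if "i < N - 1" for i
  proof (rule hoch_brace_CC[OF xC])
    have "xs ! i \<in> CC" "xs ! Suc i \<in> CC" using that assms(3) xsC by (auto intro!: subsetD[OF xsC])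
    then show "set (take i xs @ [cup (xs ! i) (xs ! Suc i)] @ drop (i + 2) xs) \<subseteq> CC"
      using sub by (auto intro: cup_CC)
  qed
  have S1: "(\<Oplus>\<^bsub>M\<^esub>i\<in>{0..<N}. signed M (\<Sum>p<i. as ! p) (br x (xs[i := dh (xs ! i)]))) =
     (\<Sum>i<N. sg (weight (take i H)) (ins (take i H @ block_d (H ! i) # drop (Suc i) H) (snd h)))"
  proof (subst finsum_M)
    show "signed M (\<Sum>p<i. as ! p) (br x (xs[i := dh (xs ! i)])) \<in> CC" if "i \<in> {0..<N}" for i
      using that DC by (simp add: signed_def a_inv_M CC_uminus)
    show "(\<Sum>i\<in>{0..<N}. signed M (\<Sum>p<i. as ! p) (br x (xs[i := dh (xs ! i)]))) =
     (\<Sum>i<N. sg (weight (take i H)) (ins (take i H @ block_d (H ! i) # drop (Suc i) H) (snd h)))"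
      by (rule sum.cong) (auto simp: D[symmetric] DC signed_M[OF DC sums])
  qed simp
  have S2: "(\<Oplus>\<^bsub>M\<^esub>i\<in>{0..<N - 1}. signed M (\<Sum>p\<le>i. as ! p) (br x (take i xs @ [cup (xs ! i) (xs ! Suc i)] @ drop (i + 2) xs))) =
     (\<Sum>i<N - 1. sg (weight (take (Suc i) H)) (ins (take i H @ block_cup (H ! i) (H ! Suc i) # drop (i + 2) H) (snd h)))"
  proof (subst finsum_M)
    show "signed M (\<Sum>p\<le>i. as ! p) (br x (take i xs @ [cup (xs ! i) (xs ! Suc i)] @ drop (i + 2) xs)) \<in> CC" if "i \<in> {0..<N - 1}" for i
      using that PC by (simp add: signed_def a_inv_M CC_uminus)
    show "(\<Sum>i\<in>{0..<N - 1}. signed M (\<Sum>p\<le>i. as ! p) (br x (take i xs @ [cup (xs ! i) (xs ! Suc i)] @ drop (i + 2) xs))) =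
     (\<Sum>i<N - 1. sg (weight (take (Suc i) H)) (ins (take i H @ block_cup (H ! i) (H ! Suc i) # drop (i + 2) H) (snd h)))"
    proof (rule sum.cong)
      fix i assume "i \<in> {..<N - 1}"
      then have i: "i < N - 1" "Suc i \<le> N" by auto
      have "even (\<Sum>p\<le>i. as ! p) = even (weight (take (Suc i) H))"
        using sums[OF i(2)] by (simp add: lessThan_Suc_atMost)
      then show "signed M (\<Sum>p\<le>i. as ! p) (br x (take i xs @ [cup (xs ! i) (xs ! Suc i)] @ drop (i + 2) xs)) =
        sg (weight (take (Suc i) H)) (ins (take i H @ block_cup (H ! i) (H ! Suc i) # drop (i + 2) H) (snd h))"
        unfolding P[OF i(1), symmetric] by (rule signed_M[OF PC[OF i(1)]])
    qed auto
  qed simp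
  have blk: "cochain_block (block_brace h H)" "cochain_block (block_brace h (tl H))" "cochain_block (block_brace h (butlast H))"
    by (rule block_brace_cochain[OF h(1)]; use H(1) in \<open>auto dest: list.set_sel(2)[OF len(3)] in_set_butlastD\<close>)+
  have tl: "br x (tl xs) = snd (block_brace h (tl H))" and bl: "br x (butlast xs) = snd (block_brace h (butlast H))"
    and br: "br x xs = snd (block_brace h H)"
    using br_blocks[OF h(1), of "tl H"] br_blocks[OF h(1), of "butlast H"] br_blocks[OF h(1), of H] h(2) H(1) H(2)[symmetric]
    by (auto simp: block_brace_def map_tl map_butlast dest: list.set_sel(2)[OF len(3)] in_set_butlastD)
  have hd: "xs ! 0 = snd (hd H)" "cochain_block (hd H)" and last: "last xs = snd (last H)" "cochain_block (last H)"
    using len H(1) H(2)[symmetric] by (auto simp: hd_conv_nth[symmetric] hd_map last_map)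
  have c1: "cup (xs ! 0) (br x (tl xs)) = snd (block_cup (hd H) (block_brace h (tl H)))"
    unfolding hd(1) tl by (rule cup_block[OF hd(2) blk(2)])
  have c2: "cup (br x (butlast xs)) (last xs) = snd (block_cup (block_brace h (butlast H)) (last H))"
    unfolding last(1) bl by (rule cup_block[OF blk(3) last(2)])
  have c1C: "cup (xs ! 0) (br x (tl xs)) \<in> CC" and c2C: "cup (br x (butlast xs)) (last xs) \<in> CC"
    unfolding c1 c2 by (rule block_CC, rule block_cup_cochain, (rule hd blk last)+)+
  have s1: "signed M ((a + 1) * as ! 0) (cup (xs ! 0) (br x (tl xs))) = sg (Suc (fst h) * fst (hd H)) (snd (block_cup (hd H) (block_brace h (tl H))))"
    unfolding c1[symmetric] using h(3) par[of 0] assms(4) len by (intro signed_M[OF c1C]) (simp add: hd_conv_nth, blast)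
  have s2: "signed M (a + (\<Sum>p<N - 1. as ! p)) (cup (br x (butlast xs)) (last xs)) = sg (fst h + weight (butlast H)) (snd (block_cup (block_brace h (butlast H)) (last H)))"
    unfolding c2[symmetric] using h(3) sums[of "N - 1"] len by (intro signed_M[OF c2C]) (simp add: butlast_conv_take)
  let ?S1 = "\<Sum>i<N. sg (weight (take i H)) (ins (take i H @ block_d (H ! i) # drop (Suc i) H) (snd h))"
  let ?S2 = "\<Sum>i<N - 1. sg (weight (take (Suc i) H)) (ins (take i H @ block_cup (H ! i) (H ! Suc i) # drop (i + 2) H) (snd h))"
  have S1C: "?S1 \<in> CC" by (intro CC_sum CC_sg) (simp add: D[symmetric] DC)
  have S2C: "?S2 \<in> CC" by (intro CC_sum CC_sg) (simp only: lessThan_iff P[symmetric] PC)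
  have t1: "signed M a ?S1 = sg (fst h) ?S1" and t2: "signed M a ?S2 = sg (fst h) ?S2"
    by (rule signed_M[OF S1C h(3)[symmetric]], rule signed_M[OF S2C h(3)[symmetric]])
  have d1: "dh (br x xs) = snd (block_d (block_brace h H))" unfolding br by (rule dh_block[OF blk(1)])
  have d2: "br (dh x) xs = ins H (snd (block_d h))"
    using br_blocks[OF block_d_cochain[OF h(1)], of H] H(1) dh_block[OF h(1)] h(2) H(2) by simp
  have d2C: "br (dh x) xs \<in> CC" by (rule hoch_brace_CC[OF dh_CC[OF xC] xsC])
  show ?thesis
    unfolding S1 S2 s1 s2 t1 t2 a_minus_M[OF d2C] a_minus_M[OF CC_sg[OF S1C]] a_minus_M[OF CC_sg[OF S2C]] M_simps
    unfolding d1 d2 using block_d_ins[OF h(1) H(1) len(3)] by (simp only: len)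
qed

end

section \<open>The homotopy G-algebra of Hochschild cochains\<close>

context bihom_associative_algebra
begin

lemma snd_block_d_sg: "snd (block_d (e, sg k g)) = sg k (snd (block_d (e, g)))"
proof -
  have "ins [(e, sg k g)] m = sg k (ins [(e, g)] m)"
    using ins_block_add(2)[OF m_multi(1), of "[]" e k g "[]"] by simp
  moreover have "sg e (sg k u) = sg k (sg e u)" "sg k (u - v) = sg k u - sg k v" for u v :: "'a cochain"
    by (simp_all add: sg_def)
  ultimately show ?thesis by (simp add: block_d_def ins_sg_fun)
qed

text \<open>
  The Leibniz rule is the homotopy formula for $\{m\}\{x,y\}$: there $dm = 2\{m\}\{m\} = 0$, and the
  right-hand side is $-\{\{m\}\{m\}\}\{x,y\} = 0$.
\<close>

theorem block_d_block_cup: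
  assumes x: "cochain_block x" and y: "cochain_block y"
  shows "snd (block_d (block_cup x y)) = snd (block_cup (block_d x) y) + sg (Suc (fst x)) (snd (block_cup x (block_d y)))"
proof -
  let ?e = "fst x"
  have "snd (block_d mb) = 0" by (simp add: block_d_def m_m_zero)
  then have z: "ins [x, y] (snd (block_d mb)) = 0" by (simp add: ins_zero_fun)
  \<comment> \<open>the brace relation for $\{\{m\}\{m\}\}\{x,y\}$\<close>
  have "0 = ins [x, y] (ins [mb] m)" by (simp only: m_m_zero ins_zero_fun)
  also have "\<dots> = brace_sum [mb] [x, y] (\<lambda>W. ins W m)"
    by (rule blocks_ins_ins) (use x y mb_block m_multi in auto)
  also have "\<dots> = ins [block_brace mb [x, y]] m + ins [block_brace mb [x], y] m + sg ?e (ins [x, block_brace mb [y]] m)"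
    by (simp add: ins_m_zero ac_simps)
  finally have assoc: "ins [block_brace mb [x, y]] m = - ins [block_brace mb [x], y] m - sg ?e (ins [x, block_brace mb [y]] m)"
    by (simp add: eq_diff_eq eq_neg_iff_add_eq_0 ac_simps)
  have sgd: "ins [(e, sg k g)] m = sg k (ins [(e, g)] m)" for e k g
    using ins_block_add(2)[OF m_multi(1), of "[]" e k g "[]"] by simp
  have "snd (block_d (block_brace mb [x, y])) - ins [x, y] (snd (block_d mb))
      - sg 1 (ins [block_d x, y] m + sg ?e (ins [x, block_d y] m))
    = sg (2 * ?e) (snd (block_cup x (block_brace mb [y]))) - sg 1 (sg ?e (ins [block_cup x y] m))
      + sg (1 + ?e) (snd (block_cup (block_brace mb [x]) y))"
  proof -
    have "cochain_block h" if "h \<in> set [x, y]" for h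
      using that x y by auto
    then show ?thesis
      using block_d_ins[OF mb_block, of "[x, y]"] by (simp add: numeral_2_eq_2 lessThan_Suc ac_simps)
  qed
  also have "\<dots> = 0"
    using assoc by (simp add: block_cup_def block_brace_def sgd sg_sg) (simp add: sg_def)
  finally have "snd (block_d (block_brace mb [x, y])) = sg 1 (ins [block_d x, y] m + sg ?e (ins [x, block_d y] m))"
    by (simp add: z)
  then have "snd (block_d (block_cup x y)) = sg (Suc ?e) (sg 1 (ins [block_d x, y] m + sg ?e (ins [x, block_d y] m)))"
    by (simp add: block_cup_def snd_block_d_sg block_brace_def)
  also have "\<dots> = snd (block_cup (block_d x) y) + sg (Suc ?e) (snd (block_cup x (block_d y)))"
    by (simp add: block_cup_def block_d_def sg_sg) (simp add: sg_def)
  finally show ?thesis .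
qed

lemma V_zero: "0 \<in> V i"
  by (simp add: V_iff C_zero)

lemma V_add: "f \<in> V i \<Longrightarrow> g \<in> V i \<Longrightarrow> f + g \<in> V i"
  by (auto simp: V_iff C_add split: if_splits)

lemma V_sg: "f \<in> V i \<Longrightarrow> sg k f \<in> V i"
  by (auto simp: V_iff C_sg split: if_splits)

lemma V_diff: "f \<in> V i \<Longrightarrow> g \<in> V i \<Longrightarrow> f - g \<in> V i"
  by (auto simp: V_iff C_diff split: if_splits)

lemma br_Nil: "x \<in> CC \<Longrightarrow> br x [] = x"
proof (induction x rule: CC_induct)
  case zero
  show ?case by (simp only: br_zero_head)
next
  case (homogeneous n f)
  show ?case using br_blocks[OF homogeneous_block[OF homogeneous], of "[]"] by simp
next
  case (add f g)
  then show ?case by (simp add: br_add_head del: plus_fun_apply)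
qed

lemma shifted_cochain:
  assumes "x \<in> shifted V a"
  shows "a \<ge> 0 \<Longrightarrow> x \<in> C (Suc (nat a))" and "a < 0 \<Longrightarrow> x = 0"
  using assms by (auto simp: shifted_def V_iff nat_add_distrib)

text \<open>
  If one of the degrees is negative, the corresponding cochain and hence the brace is zero.
  Otherwise the insertion adds up the shifted degrees.
\<close>

lemma br_degree:
  assumes x: "x \<in> shifted V a" and xs: "shifted_list V as xs"
  shows "br x xs \<in> shifted V (a + sum_list as)"
proof (cases "a \<ge> 0 \<and> (\<forall>b\<in>set as. b \<ge> 0)")
  case True
  then have hom: "homogeneous (map nat as) xs"
    using xs shifted_cochain(1) unfolding homogeneous_def shifted_list_def
    by (auto simp: list_all2_conv_all_nth)
  have x': "x \<in> C (Suc (nat a))" using True shifted_cochain[OF x] by simp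
  have "ins (zip (map nat as) xs) x \<in> C (Suc (nat a) + weight (zip (map nat as) xs))"
    by (rule ins_cochain[OF homogeneous_cochain_block[OF hom] x'])
  then have "br x xs \<in> V (int (nat a + weight (zip (map nat as) xs)) + 1)"
    unfolding hoch_brace_eq_ins[OF x' hom] by (intro C_V) simp
  moreover have "int (weight (zip (map nat as) xs)) = sum_list as"
  proof -
    have "length as = length xs" using xs by (simp add: shifted_list_def list_all2_lengthD)
    then have "weight (zip (map nat as) xs) = sum_list (map nat as)" by (simp add: weight_def)
    moreover have "int (sum_list (map nat as)) = sum_list as" using True by (induction as) auto
    ultimately show ?thesis by simp
  qed
  ultimately show ?thesis using True by (simp add: shifted_def)
next
  case False
  have xC: "x \<in> CC" using V_CC x by (auto simp: shifted_def)
  have xsC: "set xs \<subseteq> CC"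
    using xs unfolding shifted_list_def shifted_def list_all2_conv_all_nth by (metis V_CC in_set_conv_nth subsetI)
  have "br x xs = 0"
  proof (cases "a \<ge> 0")
    case True
    then obtain i where i: "i < length as" "as ! i < 0"
      using False by (metis in_set_conv_nth not_le)
    then have "xs ! i = 0" "i < length xs"
      using xs shifted_cochain(2)[of "xs ! i" "as ! i"] by (auto simp: shifted_list_def list_all2_conv_all_nth)
    then have "xs = take i xs @ 0 # drop (Suc i) xs" by (metis id_take_nth_drop)
    moreover have "set (take i xs) \<subseteq> CC" "set (drop (Suc i) xs) \<subseteq> CC"
      using xsC by (meson order_trans set_take_subset set_drop_subset)+
    ultimately show ?thesis using br_zero_arg[OF xC] by metis
  next
    case False
    then have "x = 0" using shifted_cochain[OF x] by simp
    then show ?thesis by (simp only: br_zero_head)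
  qed
  then show ?thesis by (simp add: shifted_def V_zero)
qed

lemma V_cases:
  assumes "x \<in> V i" obtains e where "i = int e + 1" "cochain_block (e, x)" | "x = 0"
proof (cases "i \<ge> 1")
  case True
  then have "i = int (nat (i - 1)) + 1" "x \<in> C (Suc (nat (i - 1)))"
    using assms by (auto simp: V_iff Suc_nat_eq_nat_zadd1)
  then show ?thesis by (intro that(1)[of "nat (i - 1)"]) (simp_all add: cochain_block_def)
next
  case False
  then show ?thesis using assms that(2) by (simp add: V_iff)
qed

lemma block_V: "cochain_block h \<Longrightarrow> snd h \<in> V (int (fst h) + 1)"
  by (rule C_V) (simp add: cochain_block_def)

lemma dh_degree: "x \<in> V i \<Longrightarrow> dh x \<in> V (i + 1)"
proof (erule V_cases)
  fix e assume e: "i = int e + 1" "cochain_block (e, x)"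
  show "dh x \<in> V (i + 1)"
    using block_V[OF block_d_cochain[OF e(2)]] dh_block[OF e(2)] e(1) by (simp add: block_d_def add.commute)
qed (simp add: dh_zero V_zero del: zero_fun_apply)

lemma cup_degree:
  assumes "x \<in> V i" "y \<in> V j" shows "cup x y \<in> V (i + j)"
proof (cases "x = 0 \<or> y = 0")
  case True
  then show ?thesis using assms V_CC cup_zero V_zero by auto
next
  case False
  then obtain e e' where e: "i = int e + 1" "cochain_block (e, x)" "j = int e' + 1" "cochain_block (e', y)"
    using assms by (meson V_cases)
  show ?thesis
    using block_V[OF block_cup_cochain[OF e(2,4)]] cup_block[OF e(2,4)] e(1,3) by (simp add: block_cup_def ac_simps)
qed

text \<open>
  Only the left factor is homogeneous, because it alone determines the sign; this form is what the
  passage to cohomology needs.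
\<close>

lemma dh_cup:
  assumes f: "n \<noteq> 0" "f \<in> C n" and "g \<in> CC"
  shows "dh (cup f g) = cup (dh f) g + sg n (cup f (dh g))"
  using assms(3)
proof (induction g rule: CC_induct)
  case zero
  show ?case using C_CC[OF f] by (simp add: dh_zero cup_zero dh_CC del: zero_fun_apply)
next
  case (add g g')
  then show ?case using C_CC[OF f]
    by (simp add: dh_linear cup_linear_right cup_CC dh_CC sg_add del: plus_fun_apply)
next
  case g: (homogeneous k g)
  note b = homogeneous_block[OF f] homogeneous_block[OF g]
  show ?case
    using block_d_block_cup[OF b] cup_block[OF b] dh_block[OF block_cup_cochain[OF b]] dh_block[OF b(1)] dh_block[OF b(2)]
      cup_block[OF block_d_cochain[OF b(1)] b(2)] cup_block[OF b(1) block_d_cochain[OF b(2)]] f(1) by simp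
qed

text \<open>
  The identities hold for blocks and carry over to the direct sum by multilinearity; in the Leibniz
  rule the degree of the left factor enters only through its parity.
\<close>

theorem homotopy_G_algebra_hochschild: "homotopy_G_algebra KR M V br cup dh"
proof (unfold homotopy_G_algebra_def homotopy_G_algebra_axioms_def, intro conjI allI impI)
  show "graded_vector_space KR M V" by (rule graded_M)
  show "linear_on KR M (\<lambda>x. br x xs)" if "set xs \<subseteq> CC" for xs
    using that by (simp add: linear_on_M hoch_brace_CC br_add_head br_scale_head)
  show "linear_on KR M (\<lambda>y. br x (xs[i := y]))" if "x \<in> CC" "set xs \<subseteq> CC" "i < length xs" for x xs i
  proof -
    have s: "set (take i xs) \<subseteq> CC" "set (drop (Suc i) xs) \<subseteq> CC"
      using that(2) by (meson order_trans set_take_subset set_drop_subset)+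
    show ?thesis
      using hoch_brace_linear_arg[OF that(1) s] s that
      by (auto simp: linear_on_M upd_conv_take_nth_drop intro!: hoch_brace_CC dest: in_set_takeD in_set_dropD simp del: plus_fun_apply)
  qed
  show "br x [] = x" if "x \<in> CC" for x using br_Nil[OF that] .
  show "br x xs \<in> shifted V (a + sum_list as)" if "x \<in> shifted V a" "shifted_list V as xs" for x a as xs
    by (rule br_degree[OF that])
  show "bilinear_on KR M cup"
    by (simp add: bilinear_on_def linear_on_M cup_CC cup_linear_left cup_linear_right)
  show "cup x y \<in> V (i + j)" if "x \<in> V i" "y \<in> V j" for x i y j using cup_degree[OF that] .
  show "cup (cup x y) z = cup x (cup y z)" if "x \<in> CC" "y \<in> CC" "z \<in> CC" for x y z using cup_assoc[OF that] .
  show "linear_on KR M dh" by (simp add: linear_on_M dh_CC dh_linear)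
  show "dh x \<in> V (i + 1)" if "x \<in> V i" for x i using dh_degree[OF that] .
  show "dh (dh x) = \<zero>\<^bsub>M\<^esub>" if "x \<in> CC" for x using dh_dh[OF that] by simp
  show "dh (cup x y) = cup (dh x) y \<oplus>\<^bsub>M\<^esub> signed M (a + 1) (cup x (dh y))"
    if xy: "x \<in> shifted V a" "y \<in> shifted V b" for x a y b
  proof -
    obtain h where h: "cochain_block h" "snd h = x" "even (fst h) = even a" using shifted_block[OF xy(1)] .
    have C: "x \<in> CC" "y \<in> CC" using xy V_CC unfolding shifted_def by blast+
    have "signed M (a + 1) (cup x (dh y)) = sg (Suc (fst h)) (cup x (dh y))"
      using h(3) C by (intro signed_M cup_CC dh_CC) auto
    then show ?thesis
      using dh_cup[of "Suc (fst h)" x y] h C by (simp add: cochain_block_def)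
  qed
qed (fact brace_brace_M brace_prd_M d_brace_M)+

end

section \<open>The cohomology of a module with a differential\<close>

locale differential_module = Module.module K M
  for K :: "('k, 'r) ring_scheme" (structure) and M :: "('k, 'v, 'm) module_scheme" (structure) +
  fixes d :: "'v \<Rightarrow> 'v"
  assumes d_linear: "linear_on K M d"
    and d_d: "x \<in> carrier M \<Longrightarrow> d (d x) = \<zero>\<^bsub>M\<^esub>"
begin

abbreviation Z where "Z \<equiv> cocycles M d"
abbreviation Bd where "Bd \<equiv> d ` carrier M"
abbreviation cl where "cl \<equiv> cohomology_class M d"
abbreviation Ho where "Ho \<equiv> cohomology M d"

lemma d_closed: "x \<in> carrier M \<Longrightarrow> d x \<in> carrier M"
  and d_add: "x \<in> carrier M \<Longrightarrow> y \<in> carrier M \<Longrightarrow> d (x \<oplus>\<^bsub>M\<^esub> y) = d x \<oplus>\<^bsub>M\<^esub> d y"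
  and d_smult: "c \<in> carrier K \<Longrightarrow> x \<in> carrier M \<Longrightarrow> d (c \<odot>\<^bsub>M\<^esub> x) = c \<odot>\<^bsub>M\<^esub> d x"
  using d_linear by (auto simp: linear_on_def)

lemma d_zero: "d \<zero>\<^bsub>M\<^esub> = \<zero>\<^bsub>M\<^esub>"
  using d_add[of "\<zero>\<^bsub>M\<^esub>" "\<zero>\<^bsub>M\<^esub>"] d_closed[of "\<zero>\<^bsub>M\<^esub>"] by (metis M.add.l_cancel_one M.l_zero M.zero_closed)

lemma d_a_inv: "x \<in> carrier M \<Longrightarrow> d (\<ominus>\<^bsub>M\<^esub> x) = \<ominus>\<^bsub>M\<^esub> d x"
  by (metis M.a_inv_closed M.l_neg M.minus_equality d_add d_closed d_zero)

lemma cocycles_carrier: "x \<in> Z \<Longrightarrow> x \<in> carrier M"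
  by (simp add: cocycles_def)

lemma cocycles_closed:
  "\<zero>\<^bsub>M\<^esub> \<in> Z" "x \<in> Z \<Longrightarrow> y \<in> Z \<Longrightarrow> x \<oplus>\<^bsub>M\<^esub> y \<in> Z" "x \<in> Z \<Longrightarrow> \<ominus>\<^bsub>M\<^esub> x \<in> Z"
  "c \<in> carrier K \<Longrightarrow> x \<in> Z \<Longrightarrow> c \<odot>\<^bsub>M\<^esub> x \<in> Z"
  by (auto simp: cocycles_def d_zero d_add d_a_inv d_smult)

lemma boundaries_submodule: "submodule Bd K M"
proof (rule submoduleI)
  show "\<zero>\<^bsub>M\<^esub> \<in> Bd" using d_zero by (metis M.zero_closed imageI)
  show "\<ominus>\<^bsub>M\<^esub> a \<in> Bd" if "a \<in> Bd" for a
    using that by (auto simp: d_a_inv[symmetric])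
  show "a \<oplus>\<^bsub>M\<^esub> b \<in> Bd" if "a \<in> Bd" "b \<in> Bd" for a b
    using that by (auto simp: d_add[symmetric])
  show "c \<odot>\<^bsub>M\<^esub> b \<in> Bd" if "c \<in> carrier K" "b \<in> Bd" for c b
    using that by (auto simp: d_smult[symmetric])
qed (auto simp: d_closed)

sublocale boundaries: abelian_subgroup Bd M
  using boundaries_submodule
  by (intro abelian_subgroupI3 additive_subgroup.intro M.abelian_group_axioms) (simp add: submodule_def)

lemma class_add: "x \<in> carrier M \<Longrightarrow> y \<in> carrier M \<Longrightarrow> cl x <+>\<^bsub>M\<^esub> cl y = cl (x \<oplus>\<^bsub>M\<^esub> y)"
  unfolding cohomology_class_def by (rule boundaries.a_rcos_sum)

lemma class_eq_iff:
  assumes "x \<in> carrier M" "y \<in> carrier M"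
  shows "cl x = cl y \<longleftrightarrow> x \<oplus>\<^bsub>M\<^esub> \<ominus>\<^bsub>M\<^esub> y \<in> Bd"
proof
  assume "cl x = cl y"
  then have "x \<in> Bd +>\<^bsub>M\<^esub> y"
    using boundaries.a_rcos_self[OF assms(1)] by (simp add: cohomology_class_def)
  then show "x \<oplus>\<^bsub>M\<^esub> \<ominus>\<^bsub>M\<^esub> y \<in> Bd" by (rule boundaries.a_rcos_module_imp[OF assms(2)])
next
  assume "x \<oplus>\<^bsub>M\<^esub> \<ominus>\<^bsub>M\<^esub> y \<in> Bd"
  then have "x \<in> Bd +>\<^bsub>M\<^esub> y" by (rule boundaries.a_rcos_module_rev[OF assms(2,1)])
  then show "cl x = cl y"
    unfolding cohomology_class_def by (rule boundaries.a_repr_independence'[OF _ assms(2), symmetric])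
qed

lemma class_self: "x \<in> carrier M \<Longrightarrow> x \<in> cl x"
  unfolding cohomology_class_def by (rule boundaries.a_rcos_self)

lemma class_zero: "cl \<zero>\<^bsub>M\<^esub> = Bd"
  unfolding cohomology_class_def by (rule boundaries.a_rcos_const) simp

lemma class_member: "x \<in> carrier M \<Longrightarrow> y \<in> cl x \<Longrightarrow> y \<in> carrier M \<and> cl y = cl x"
  unfolding cohomology_class_def
  using boundaries.a_elemrcos_carrier boundaries.a_repr_independence' by metis

text \<open>
  The union in the scalar multiplication of classes ranges over a constant family.
\<close>

lemma class_smult:
  assumes "c \<in> carrier K" "x \<in> carrier M"
  shows "(\<Union>y\<in>cl x. cl (c \<odot>\<^bsub>M\<^esub> y)) = cl (c \<odot>\<^bsub>M\<^esub> x)"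
proof -
  have eq: "cl (c \<odot>\<^bsub>M\<^esub> y) = cl (c \<odot>\<^bsub>M\<^esub> x)" if "y \<in> cl x" for y
  proof -
    have y: "y \<in> carrier M" "cl y = cl x" using class_member[OF assms(2) that] by auto
    then have "y \<oplus>\<^bsub>M\<^esub> \<ominus>\<^bsub>M\<^esub> x \<in> Bd" using class_eq_iff[OF y(1) assms(2)] by simp
    then have "c \<odot>\<^bsub>M\<^esub> (y \<oplus>\<^bsub>M\<^esub> \<ominus>\<^bsub>M\<^esub> x) \<in> Bd"
      using submodule.smult_closed[OF boundaries_submodule] assms(1) by blast
    moreover have "c \<odot>\<^bsub>M\<^esub> (y \<oplus>\<^bsub>M\<^esub> \<ominus>\<^bsub>M\<^esub> x) = c \<odot>\<^bsub>M\<^esub> y \<oplus>\<^bsub>M\<^esub> \<ominus>\<^bsub>M\<^esub> (c \<odot>\<^bsub>M\<^esub> x)"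
      by (simp only: smult_r_distr smult_r_minus assms y M.a_inv_closed)
    ultimately show ?thesis
      using class_eq_iff[OF smult_closed[OF assms(1) y(1)] smult_closed[OF assms]] by (simp only:)
  qed
  have "(\<Union>y\<in>cl x. cl (c \<odot>\<^bsub>M\<^esub> y)) = (\<Union>y\<in>cl x. cl (c \<odot>\<^bsub>M\<^esub> x))"
    by (rule SUP_cong[OF refl]) (rule eq)
  also have "\<dots> = cl (c \<odot>\<^bsub>M\<^esub> x)"
    using class_self[OF assms(2)] by (intro SUP_const) blast
  finally show ?thesis .
qed

lemma cohomology_simps:
  "carrier Ho = cl ` Z" "\<zero>\<^bsub>Ho\<^esub> = cl \<zero>\<^bsub>M\<^esub>"
  "x \<in> Z \<Longrightarrow> y \<in> Z \<Longrightarrow> cl x \<oplus>\<^bsub>Ho\<^esub> cl y = cl (x \<oplus>\<^bsub>M\<^esub> y)"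
  "c \<in> carrier K \<Longrightarrow> x \<in> Z \<Longrightarrow> c \<odot>\<^bsub>Ho\<^esub> cl x = cl (c \<odot>\<^bsub>M\<^esub> x)"
  by (simp_all add: cohomology_def class_zero class_add class_smult cocycles_carrier)

lemma abelian_group_cohomology: "abelian_group Ho"
proof (rule abelian_groupI)
  fix x y assume "x \<in> carrier Ho" "y \<in> carrier Ho"
  then obtain f g where "f \<in> Z" "g \<in> Z" "x = cl f" "y = cl g" by (auto simp: cohomology_simps)
  then show "x \<oplus>\<^bsub>Ho\<^esub> y \<in> carrier Ho" "x \<oplus>\<^bsub>Ho\<^esub> y = y \<oplus>\<^bsub>Ho\<^esub> x"
    using M.a_comm[of f g] by (auto simp: cohomology_simps cocycles_closed cocycles_carrier)
next
  fix x y z assume "x \<in> carrier Ho" "y \<in> carrier Ho" "z \<in> carrier Ho"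
  then obtain f g h where "f \<in> Z" "g \<in> Z" "h \<in> Z" "x = cl f" "y = cl g" "z = cl h" by (auto simp: cohomology_simps)
  then show "x \<oplus>\<^bsub>Ho\<^esub> y \<oplus>\<^bsub>Ho\<^esub> z = x \<oplus>\<^bsub>Ho\<^esub> (y \<oplus>\<^bsub>Ho\<^esub> z)"
    by (simp add: cohomology_simps cocycles_closed cocycles_carrier M.a_assoc)
next
  fix x assume "x \<in> carrier Ho"
  then obtain f where f: "f \<in> Z" "x = cl f" by (auto simp: cohomology_simps)
  then show "\<zero>\<^bsub>Ho\<^esub> \<oplus>\<^bsub>Ho\<^esub> x = x"
    by (simp add: cohomology_simps cocycles_closed cocycles_carrier)
  show "\<exists>y\<in>carrier Ho. y \<oplus>\<^bsub>Ho\<^esub> x = \<zero>\<^bsub>Ho\<^esub>"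
    using f by (intro bexI[of _ "cl (\<ominus>\<^bsub>M\<^esub> f)"]) (simp_all add: cohomology_simps cocycles_closed cocycles_carrier M.l_neg)
qed (simp add: cohomology_simps cocycles_closed)

lemma module_cohomology: "Module.module K Ho"
proof (rule Module.moduleI)
  show "cring K" by (rule R.is_cring)
  show "abelian_group Ho" by (rule abelian_group_cohomology)
  fix a x assume a: "a \<in> carrier K" and "x \<in> carrier Ho"
  then obtain f where f: "f \<in> Z" "x = cl f" by (auto simp: cohomology_simps)
  show "a \<odot>\<^bsub>Ho\<^esub> x \<in> carrier Ho" using f a by (auto simp: cohomology_simps cocycles_closed)
  show "(a \<oplus>\<^bsub>K\<^esub> b) \<odot>\<^bsub>Ho\<^esub> x = a \<odot>\<^bsub>Ho\<^esub> x \<oplus>\<^bsub>Ho\<^esub> b \<odot>\<^bsub>Ho\<^esub> x" if "b \<in> carrier K" for b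
    using f a that by (simp add: cohomology_simps cocycles_closed cocycles_carrier smult_l_distr)
  show "(a \<otimes>\<^bsub>K\<^esub> b) \<odot>\<^bsub>Ho\<^esub> x = a \<odot>\<^bsub>Ho\<^esub> (b \<odot>\<^bsub>Ho\<^esub> x)" if "b \<in> carrier K" for b
    using f a that by (simp add: cohomology_simps cocycles_closed cocycles_carrier smult_assoc1)
  show "a \<odot>\<^bsub>Ho\<^esub> (x \<oplus>\<^bsub>Ho\<^esub> y) = a \<odot>\<^bsub>Ho\<^esub> x \<oplus>\<^bsub>Ho\<^esub> a \<odot>\<^bsub>Ho\<^esub> y" if y: "y \<in> carrier Ho" for y
  proof -
    obtain g where "g \<in> Z" "y = cl g" using y by (auto simp: cohomology_simps)
    then show ?thesis using f a by (simp add: cohomology_simps cocycles_closed cocycles_carrier smult_r_distr)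
  qed
next
  show "\<one>\<^bsub>K\<^esub> \<odot>\<^bsub>Ho\<^esub> x = x" if "x \<in> carrier Ho" for x
    using that by (auto simp: cohomology_simps cocycles_carrier)
qed

lemma class_a_inv: "x \<in> Z \<Longrightarrow> \<ominus>\<^bsub>Ho\<^esub> cl x = cl (\<ominus>\<^bsub>M\<^esub> x)"
proof -
  assume x: "x \<in> Z"
  interpret H: abelian_group Ho by (rule abelian_group_cohomology)
  show ?thesis
    by (rule H.minus_equality) (use x in \<open>simp_all add: cohomology_simps cocycles_closed cocycles_carrier M.l_neg\<close>)
qed

lemma class_signed: "x \<in> Z \<Longrightarrow> signed Ho k (cl x) = cl (signed M k x)"
  by (simp add: signed_def class_a_inv)

lemma class_finsum:
  assumes "finite A" and "\<And>i. i \<in> A \<Longrightarrow> F i \<in> Z"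
  shows "finsum M F A \<in> Z \<and> finsum Ho (\<lambda>i. cl (F i)) A = cl (finsum M F A)"
  using assms
proof (induction A rule: finite_induct)
  case empty
  interpret H: abelian_group Ho by (rule abelian_group_cohomology)
  show ?case by (simp add: cohomology_simps cocycles_closed)
next
  case (insert i A)
  interpret H: abelian_group Ho by (rule abelian_group_cohomology)
  have "F \<in> A \<rightarrow> carrier M" "F i \<in> carrier M" using insert cocycles_carrier by auto
  then show ?case
    using insert by (simp add: cohomology_simps cocycles_closed Pi_def)
qed

end

text \<open>
  Cohomology depends on the differential only through its cocycles and boundaries.
\<close>

lemma cohomology_cong:
  assumes "d ` carrier M = d' ` carrier M" and "cocycles M d = cocycles M d'"
  shows "cohomology_class M d = cohomology_class M d'" and "cohomology M d = cohomology M d'"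
    and "cohomology_grading M V d = cohomology_grading M V d'"
proof -
  show cl: "cohomology_class M d = cohomology_class M d'"
    by (rule ext) (simp add: cohomology_class_def assms)
  show "cohomology M d = cohomology M d'" "cohomology_grading M V d = cohomology_grading M V d'"
    by (auto simp: cohomology_def cohomology_grading_def fun_eq_iff cl assms)
qed

section \<open>The Hochschild coboundary\<close>

context bihom_associative_algebra
begin

abbreviation delta where "delta \<equiv> hoch_delta scale \<mu> \<alpha> \<beta>"

text \<open>
  The automorphism $(-1)^n$ on cochains of arity $n$; it relates \<open>hoch_delta\<close> to
  \<open>hoch_d\<close>.
\<close>

definition alternate :: "'a cochain \<Rightarrow> 'a cochain" where
  "alternate f = (\<lambda>xs. sg (length xs) (f xs))"

lemma ins_m_apply:
  assumes f: "f \<in> C (Suc e)" and xs: "length xs = Suc (Suc e)"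
  shows "ins [(e, f)] m xs = sg e (\<mu> ((\<alpha> ^^ e) (hd xs)) (f (tl xs))) + \<mu> (f (butlast xs)) ((\<beta> ^^ e) (last xs))"
proof -
  have "xs \<noteq> []" using xs by auto
  have "ins [(e, f)] m xs = cuts xs (\<lambda>p r. cuts r (\<lambda>q s. m (T e p @ f (T 0 q) # B e s)))"
    by (simp add: ins_Cons)
  also have "\<dots> = m (T e [hd xs] @ f (tl xs) # []) + m (f (butlast xs) # B e [last xs])"
    by (subst cuts3_outer_short) (use \<open>xs \<noteq> []\<close> in \<open>auto simp: m_apply\<close>)
  also have "\<dots> = sg e (\<mu> ((\<alpha> ^^ e) (hd xs)) (f (tl xs))) + \<mu> (f (butlast xs)) ((\<beta> ^^ e) (last xs))"
    by (simp add: m_apply tau_pow additive_minus(4)[of "\<lambda>x. \<mu> x _", OF lin_add[OF lin_mu(2)]])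
  finally show ?thesis .
qed

text \<open>
  The signs of the Hochschild coboundary: the $i$ arguments in front of the product are twisted
  by $\tau = -\alpha$, and each contributes a factor $-1$.
\<close>

lemma ins_mb_apply:
  assumes f: "f \<in> C (Suc e)" and xs: "length xs = Suc (Suc e)"
  shows "ins [mb] f xs = (\<Sum>i<Suc e. sg i (f (map \<alpha> (take i xs) @ [\<mu> (xs ! i) (xs ! Suc i)] @ map \<beta> (drop (i + 2) xs))))"
proof -
  have fm: "multilin f" using f by (simp add: cochains_iff)
  have z: "f (p @ 0 # q) = 0" for p q by (rule multilin_zero_slot[OF fm])
  have "ins [mb] f xs = cuts xs (\<lambda>p r. cuts r (\<lambda>q s. f (T 1 p @ m (T 0 q) # B 1 s)))"
    by (simp add: ins_Cons)
  also have "\<dots> = (\<Sum>i<Suc e. f (T 1 (take i xs) @ m [xs ! i, xs ! Suc i] # B 1 (drop (i + 2) xs)))"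
    by (subst cuts3_middle_short) (simp_all add: m_apply z xs)
  also have "\<dots> = (\<Sum>i<Suc e. sg i (f (map \<alpha> (take i xs) @ [\<mu> (xs ! i) (xs ! Suc i)] @ map \<beta> (drop (i + 2) xs))))"
  proof (rule sum.cong[OF refl])
    fix i assume "i \<in> {..<Suc e}"
    then have l: "length (take i xs) = i" using xs by simp
    have "f (map uminus (map \<alpha> (take i xs)) @ L) = sg i (f (map \<alpha> (take i xs) @ L))" for L
      using multiadditive_uminus[OF multiadditive_shift(3)[OF multilin_multiadditive[OF fm], of L], of "[]" "map \<alpha> (take i xs)"] l by simp
    then show "f (T 1 (take i xs) @ m [xs ! i, xs ! Suc i] # B 1 (drop (i + 2) xs)) =
      sg i (f (map \<alpha> (take i xs) @ [\<mu> (xs ! i) (xs ! Suc i)] @ map \<beta> (drop (i + 2) xs)))"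
      by (simp add: m_apply comp_def)
  qed
  finally show ?thesis .
qed

text \<open>
  For arity $n$ the difference is the sign $(-1)^{n-1}$, which equals the sign for arity $n + 1$ of
  the resulting cochain.
\<close>

lemma delta_eq_homogeneous:
  assumes f: "f \<in> C (Suc e)" shows "delta f = alternate (dh f)"
proof
  fix xs
  have b: "cochain_block (e, f)" using f by (simp add: cochain_block_def)
  have f0: "length ys \<noteq> Suc e \<Longrightarrow> f ys = 0" for ys using f by (simp add: cochains_iff)
  show "delta f xs = alternate (dh f) xs"
  proof (cases "length xs = Suc (Suc e)")
    case True
    have "dh f xs = ins [(e, f)] m xs - sg e (ins [mb] f xs)"
      using dh_block[OF b] by (simp add: block_d_def sg_apply)
    moreover have "(\<Sum>i=1..Suc e. scale ((-1) ^ i) (f (map \<alpha> (take (i - 1) xs) @ [\<mu> (xs ! (i - 1)) (xs ! i)] @ map \<beta> (drop (i + 1) xs))))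
      = - (\<Sum>i<Suc e. sg i (f (map \<alpha> (take i xs) @ [\<mu> (xs ! i) (xs ! Suc i)] @ map \<beta> (drop (i + 2) xs))))"
      unfolding sum_negf[symmetric] One_nat_def sum.atLeast1_atMost_eq sg_scale
      by (rule sum.cong[OF refl]) (simp add: sg_def)
    ultimately show ?thesis
      using True by (simp add: hoch_delta_def alternate_def ins_m_apply[OF f True] ins_mb_apply[OF f True] sg_scale del: sum.lessThan_Suc)
        (simp add: sg_def del: sum.lessThan_Suc)
  next
    case False
    have "dh f xs = 0"
      using False block_d_cochain[OF b] dh_block[OF b] by (simp add: cochain_block_def cochains_iff block_d_def)
    moreover have "delta f xs = 0"
      using False unfolding hoch_delta_def Let_def
      by (auto simp: f0 intro!: sum.neutral)
    ultimately show ?thesis by (simp add: alternate_def)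
  qed
qed

lemma alternate_add: "alternate (f + g) = alternate f + alternate g"
  by (simp add: alternate_def fun_eq_iff sg_add)

lemma alternate_alternate: "alternate (alternate f) = f"
  by (simp add: alternate_def sg_sg) (simp add: sg_def)

lemma alternate_C: "f \<in> C n \<Longrightarrow> alternate f = sg n f"
  by (auto simp: alternate_def fun_eq_iff cochains_iff sg_apply)

lemma delta_add: "delta (f + g) = delta f + delta g"
  by (simp add: hoch_delta_def Let_def fun_eq_iff lin_add[OF lin_mu(1)] lin_add[OF lin_mu(2)] scale_right_distrib sum.distrib ac_simps)

lemma delta_eq: "f \<in> CC \<Longrightarrow> delta f = alternate (dh f)"
proof (induction f rule: CC_induct)
  case zero
  show ?case by (rule delta_eq_homogeneous[OF C_zero])
next
  case (homogeneous n f)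
  then show ?case using delta_eq_homogeneous[of f "n - 1"] by simp
next
  case (add f g)
  then show ?case by (simp add: delta_add alternate_add dh_linear del: plus_fun_apply)
qed

lemma alternate_CC: "f \<in> CC \<Longrightarrow> alternate f \<in> CC"
proof (induction f rule: CC_induct)
  case zero
  have "alternate 0 = 0" using alternate_C[OF C_zero[of 0]] by simp
  then show ?case using CC_zero by metis
next
  case (homogeneous n f)
  then show ?case using alternate_C[of f n] CC_sg C_CC by metis
next
  case (add f g)
  then show ?case unfolding alternate_add by (intro CC_add)
qed

lemma dh_sg: "f \<in> CC \<Longrightarrow> dh (sg k f) = sg k (dh f)"
  using dh_linear(1)[of f "- f"] CC_uminus[of f] by (simp add: sg_def dh_zero eq_neg_iff_add_eq_0 add.commute)

lemma alternate_dh: "f \<in> CC \<Longrightarrow> alternate (dh f) = - dh (alternate f)"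
proof (induction f rule: CC_induct)
  case zero
  have "alternate 0 = 0" using alternate_C[OF C_zero[of 0]] by simp
  then show ?case by (metis dh_zero neg_equal_0_iff_equal)
next
  case (homogeneous n f)
  note b = homogeneous_block[OF homogeneous]
  have "dh f \<in> C (Suc n)"
    using block_d_cochain[OF b] dh_block[OF b] homogeneous(1) by (simp add: cochain_block_def block_d_def)
  then have "alternate (dh f) = sg (Suc n) (dh f)" by (rule alternate_C)
  moreover have "dh (alternate f) = sg n (dh f)"
    unfolding alternate_C[OF homogeneous(2)] by (rule dh_sg[OF C_CC[OF homogeneous]])
  ultimately show ?case by (simp add: sg_def fun_eq_iff)
next
  case (add f g)
  have "dh (f + g) = dh f + dh g" "dh (alternate f + alternate g) = dh (alternate f) + dh (alternate g)"
    by (rule dh_linear; intro add alternate_CC)+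
  then show ?case by (simp only: alternate_add add.IH minus_add_distrib)
qed

text \<open>
  \<open>alternate\<close> anticommutes with the differential, so it preserves the boundaries.
\<close>

lemma delta_dh_cohomology: "delta ` CC = dh ` CC" "cocycles M delta = cocycles M dh"
proof -
  have neg: "dh (- alternate f) = delta f" if "f \<in> CC" for f
  proof -
    have "dh (- alternate f) = - dh (alternate f)" using dh_sg[OF alternate_CC[OF that], of 1] by (simp add: sg_def)
    then show ?thesis by (simp only: delta_eq[OF that] alternate_dh[OF that])
  qed
  show "delta ` CC = dh ` CC"
  proof (intro equalityI subsetI)
    fix x assume "x \<in> delta ` CC"
    then obtain f where f: "f \<in> CC" "x = delta f" by blast
    have "x = dh (- alternate f)" using neg[OF f(1)] f(2) by (rule trans[OF _ sym, rotated])
    moreover have "- alternate f \<in> CC" by (intro CC_uminus alternate_CC f)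
    ultimately show "x \<in> dh ` CC" by (rule image_eqI)
  next
    fix x assume "x \<in> dh ` CC"
    then obtain f where f: "f \<in> CC" "x = dh f" by blast
    have "alternate (- alternate f) = - f"
      using alternate_alternate[of f] by (simp add: alternate_def fun_eq_iff sg_uminus)
    then have "x = delta (- alternate f)"
      using neg[OF CC_uminus[OF alternate_CC[OF f(1)]]] f(2) by (simp only: minus_minus)
    then show "x \<in> delta ` CC" using CC_uminus[OF alternate_CC[OF f(1)]] by (rule image_eqI)
  qed
  have "alternate 0 = (0 :: 'a cochain)" using alternate_C[OF C_zero[of 0]] by simp
  then have "delta f = 0 \<longleftrightarrow> dh f = 0" if "f \<in> CC" for f
    using delta_eq[OF that] alternate_alternate[of "dh f"] by metis
  then show "cocycles M delta = cocycles M dh"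
    by (auto simp: cocycles_def simp del: zero_fun_apply)
qed

end

section \<open>The bracket of cochains\<close>

context bihom_associative_algebra
begin

text \<open>
  $[f,g] = \{f\}\{g\} - (-1)^{|f||g|}\{g\}\{f\}$ for blocks.
\<close>

definition block_bracket :: "nat \<times> 'a cochain \<Rightarrow> nat \<times> 'a cochain \<Rightarrow> nat \<times> 'a cochain" where
  "block_bracket x y = (fst x + fst y, ins [y] (snd x) - sg (fst x * fst y) (ins [x] (snd y)))"

lemma ins_single:
  assumes "multilin \<phi>"
  shows "ins [(e, g + g')] \<phi> = ins [(e, g)] \<phi> + ins [(e, g')] \<phi>"
    "ins [(e, g - g')] \<phi> = ins [(e, g)] \<phi> - ins [(e, g')] \<phi>"
    "ins [(e, sg k g)] \<phi> = sg k (ins [(e, g)] \<phi>)"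
  using ins_block_add[OF assms, of "[]" e _ _ "[]"] by simp_all

lemma sg_diff: "sg k (x - y) = sg k x - sg k y"
  by (simp add: sg_def)

lemma block_d_sg_diff: "snd (block_d (e, g - sg k g')) = snd (block_d (e, g)) - sg k (snd (block_d (e, g')))"
  by (simp add: block_d_def ins_single[OF m_multi(1)] ins_diff_fun ins_sg_fun) (simp add: sg_def)

lemma block_cup_linear:
  "snd (block_cup (e, g - sg k g') y) = snd (block_cup (e, g) y) - sg k (snd (block_cup (e, g') y))"
  "snd (block_cup y (e, g - sg k g')) = snd (block_cup y (e, g)) - sg k (snd (block_cup y (e, g')))"
  using ins_block_add(2,3)[OF m_multi(1), of "[]" e _ _ "[y]"] ins_block_add(2,3)[OF m_multi(1), of "[y]" e _ _ "[]"]
  by (simp_all add: block_cup_def sg_diff sg_sg add.commute)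

lemma block_bracket_cochain:
  assumes "cochain_block x" "cochain_block y" shows "cochain_block (block_bracket x y)"
  using block_brace_cochain[OF assms(1), of "[y]"] block_brace_cochain[OF assms(2), of "[x]"] assms
  by (simp add: cochain_block_def block_brace_def block_bracket_def C_diff C_sg add.commute)

text \<open>
  The homotopy formula with a single entry: $d$ fails to be a derivation of $x \circ y$ by a graded
  commutator of the product.
\<close>

lemma block_d_circ:
  assumes "cochain_block x" "cochain_block y"
  shows "snd (block_d (block_brace x [y])) = ins [y] (snd (block_d x)) + sg (fst x) (ins [block_d y] (snd x))
    + sg (Suc (fst x) * fst y) (snd (block_cup y x)) + sg (fst x) (snd (block_cup x y))"
proof -
  have "cochain_block h" if "h \<in> set [y]" for h using that assms by simp
  from block_d_ins[OF assms(1), of "[y]", OF this] show ?thesis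
    by (simp add: algebra_simps)
qed

text \<open>
  The defects in \<open>block_d_circ\<close> for $x \circ y$ and $y \circ x$ cancel in the bracket.
\<close>

theorem block_d_block_bracket:
  assumes "cochain_block x" "cochain_block y"
  shows "snd (block_d (block_bracket x y)) = snd (block_bracket (block_d x) y) + sg (fst x) (snd (block_bracket x (block_d y)))"
proof -
  have f: "fst (block_d z) = Suc (fst z)" for z by (simp add: block_d_def)
  have "snd (block_d (block_bracket x y)) = snd (block_d (block_brace x [y])) - sg (fst x * fst y) (snd (block_d (block_brace y [x])))"
    by (simp add: block_bracket_def block_d_sg_diff block_brace_def add.commute)
  then show ?thesis
    unfolding block_d_circ[OF assms] block_d_circ[OF assms(2,1)] block_bracket_def f snd_conv
    by (cases "even (fst x)"; cases "even (fst y)") (simp_all add: sg_def)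
qed

text \<open>
  The associator of $\circ$ is graded symmetric in \<open>y\<close> and \<open>z\<close>: the pre-Lie identity.
\<close>

lemma ins_circ_circ:
  assumes "cochain_block x" "cochain_block y" "cochain_block z"
  shows "ins [z] (ins [y] (snd x)) = ins [block_brace y [z]] (snd x) + ins [y, z] (snd x)
    + sg (fst y * fst z) (ins [z, y] (snd x))"
proof -
  have "ins [z] (ins [y] (snd x)) = brace_sum [y] [z] (\<lambda>W. ins W (snd x))"
    by (rule blocks_ins_ins) (use assms cochain_blockD[OF assms(1)] in auto)
  then show ?thesis by (simp add: ac_simps)
qed

text \<open>
  Expand all brackets and apply the pre-Lie identity to the six double compositions.
\<close>

theorem block_bracket_jacobi:
  assumes x: "cochain_block x" and y: "cochain_block y" and z: "cochain_block z"
  shows "snd (block_bracket x (block_bracket y z)) = snd (block_bracket (block_bracket x y) z) + sg (fst x * fst y) (snd (block_bracket y (block_bracket x z)))"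
proof -
  note mx = cochain_blockD(2)[OF x] and my = cochain_blockD(2)[OF y] and mz = cochain_blockD(2)[OF z]
  have O: "block_brace u [v] = (fst u + fst v, ins [v] (snd u))" for u v
    by (simp add: block_brace_def)
  note c = ins_circ_circ[OF x y z] ins_circ_circ[OF x z y] ins_circ_circ[OF y x z]
    ins_circ_circ[OF y z x] ins_circ_circ[OF z x y] ins_circ_circ[OF z y x]
  have comm: "(fst y + fst x, g) = (fst x + fst y, g)" "(fst z + fst x, g) = (fst x + fst z, g)"
    "(fst z + fst y, g) = (fst y + fst z, g)" for g :: "'a cochain"
    by (simp_all add: add.commute)
  show ?thesis
    unfolding block_bracket_def fst_conv snd_conv ins_single[OF mx] ins_single[OF my] ins_single[OF mz]
      ins_diff_fun ins_sg_fun c O comm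
    by (cases "even (fst x)"; cases "even (fst y)"; cases "even (fst z)")
      (simp_all add: sg_def algebra_simps)
qed

text \<open>
  The homotopy formula for $\{a\}\{b,c\}$ describes $a \circ (b \cdot c)$ up to the boundary of
  $\{a\}\{b,c\}$, and \<open>ins_block_cup\<close> describes $(b \cdot c) \circ a$ exactly.
\<close>

theorem block_bracket_leibniz:
  assumes a: "cochain_block a" and b: "cochain_block b" and c: "cochain_block c"
    and closed: "snd (block_d a) = 0" "snd (block_d b) = 0" "snd (block_d c) = 0"
  shows "snd (block_bracket a (block_cup b c)) - (snd (block_cup (block_bracket a b) c) + sg (fst a * Suc (fst b)) (snd (block_cup b (block_bracket a c))))
    = - sg (fst a + fst b) (snd (block_d (block_brace a [b, c])))"
proof -
  note ma = cochain_blockD(2)[OF a]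
  have O: "block_brace u [v] = (fst u + fst v, ins [v] (snd u))" for u v
    by (simp add: block_brace_def)
  have z: "ins [block_d b, c] (snd a) = 0" "ins [b, block_d c] (snd a) = 0"
    using ins_block_zero[OF ma, of "[]" "fst (block_d b)" "[c]"] ins_block_zero[OF ma, of "[b]" "fst (block_d c)" "[]"] closed
    by (metis append_Nil prod.collapse, metis append_Cons append_Nil prod.collapse)
  have "cochain_block h" if "h \<in> set [b, c]" for h using that b c by auto
  from block_d_ins[OF a, of "[b, c]", OF this] have D: "snd (block_d (block_brace a [b, c])) =
      sg (Suc (fst a) * fst b) (snd (block_cup b (block_brace a [c]))) - sg (fst a) (sg (fst b) (ins [block_cup b c] (snd a)))
      + sg (fst a + fst b) (snd (block_cup (block_brace a [b]) c))"
    by (simp add: closed ins_zero_fun z lessThan_Suc)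
  have "ins [a] (snd (block_cup b c)) =
      cuts [a] (\<lambda>Y1 Y2. sg (Suc (fst c) * weight Y1) (snd (block_cup (block_brace b Y1) (block_brace c Y2))))"
    by (rule ins_block_cup[OF b c]) (use a in simp)
  then have I: "ins [a] (snd (block_cup b c)) = snd (block_cup b (block_brace c [a])) + sg (Suc (fst c) * fst a) (snd (block_cup (block_brace b [a]) c))"
    by simp
  have comm: "(fst b + fst a, g) = (fst a + fst b, g)" "(fst c + fst a, g) = (fst a + fst c, g)" for g :: "'a cochain"
    by (simp_all add: add.commute)
  have fc: "fst (block_cup b c) = Suc (fst b + fst c)" by (simp add: block_cup_def)
  show ?thesis
    unfolding block_bracket_def[of a "block_cup b c"] snd_conv D I fc
    unfolding block_bracket_def block_cup_linear O comm
    by (cases "even (fst a)"; cases "even (fst b)"; cases "even (fst c)")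
      (simp_all add: sg_def algebra_simps)
qed

text \<open>
  The bracket with a homogeneous left argument \<open>f\<close> of arity \<open>k\<close>; the sign depends on the
  arity of each component of \<open>g\<close>.
\<close>

definition bracket_summand :: "'a cochain \<Rightarrow> nat \<Rightarrow> 'a cochain \<Rightarrow> 'a cochain" where
  "bracket_summand g k f = arity_sum (\<lambda>l g. br f [g] - sg ((k - 1) * (l - 1)) (br g [f])) g"

text \<open>
  The bilinear extension of the graded bracket to the direct sum, which is needed because classes
  need not be homogeneous.
\<close>

definition total_bracket :: "'a cochain \<Rightarrow> 'a cochain \<Rightarrow> 'a cochain" where
  "total_bracket f g = arity_sum (bracket_summand g) f"

lemma arity_sum_cong:
  assumes "g \<in> CC" and "\<And>n h. n \<noteq> 0 \<Longrightarrow> h \<in> C n \<Longrightarrow> F n h = F' n h"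
  shows "arity_sum F g = arity_sum F' g"
  unfolding arity_sum_def
proof (rule sum.cong[OF refl])
  fix n assume "n \<in> arity_set g"
  then have "n \<noteq> 0" using CC_arity(1)[OF assms(1)] by (cases n) auto
  then show "F n (component n g) = F' n (component n g)"
    using CC_component[OF assms(1)] assms(2) by blast
qed

lemma arity_sum_fun_add: "arity_sum (\<lambda>n h. F n h + F' n h) g = arity_sum F g + arity_sum F' g"
  by (simp add: arity_sum_def sum.distrib)

lemma arity_sum_fun_scale: "arity_sum (\<lambda>n h. fscale c (F n h)) g = fscale c (arity_sum F g)"
  by (simp add: arity_sum_def fscale_def fun_eq_iff sum_fun_apply scale_sum_right)

lemma br_zero: "f \<in> CC \<Longrightarrow> br f [0] = 0" "br 0 [f] = 0"
  by (simp_all add: br_arg1(3) br_zero_head)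

lemma bracket_summand_CC: "k \<noteq> 0 \<Longrightarrow> f \<in> C k \<Longrightarrow> g \<in> CC \<Longrightarrow> bracket_summand g k f \<in> CC"
proof -
  assume k: "k \<noteq> 0" "f \<in> C k" and g: "g \<in> CC"
  from k have "f \<in> CC" by (rule C_CC)
  then show "bracket_summand g k f \<in> CC"
    unfolding bracket_summand_def using g by (intro arity_sum_CC) (simp_all add: CC_diff CC_sg hoch_brace_CC C_CC)
qed

lemma bracket_summand_linear_right:
  assumes f: "f \<in> CC" and g: "g \<in> CC" "g' \<in> CC"
  shows "bracket_summand (g + g') k f = bracket_summand g k f + bracket_summand g' k f" "bracket_summand (fscale c g) k f = fscale c (bracket_summand g k f)"
  unfolding bracket_summand_def
  by (rule arity_sum_linear(1)[OF _ _ _ g] arity_sum_linear(2)[OF _ _ _ g];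
      simp add: br_arg1 br_add_head br_scale_head br_zero f C_CC sg_add fscale_laws)+

lemma bracket_summand_linear_left:
  assumes g: "g \<in> CC" and f: "f \<in> CC" "f' \<in> CC"
  shows "bracket_summand g k (f + f') = bracket_summand g k f + bracket_summand g k f'" "bracket_summand g k (fscale c f) = fscale c (bracket_summand g k f)"
  unfolding bracket_summand_def arity_sum_fun_add[symmetric] arity_sum_fun_scale[symmetric]
  by (rule arity_sum_cong[OF g]; simp add: br_arg1 br_add_head br_scale_head f C_CC sg_add fscale_laws)+

lemma bracket_summand_scale:
  assumes "g \<in> CC" "f \<in> CC"
  shows "bracket_summand g k (fscale c f) = fscale c (bracket_summand g k f)" "bracket_summand (fscale c g) k f = fscale c (bracket_summand g k f)"
  using bracket_summand_linear_left(2)[OF assms(1,2,2)] bracket_summand_linear_right(2)[OF assms(2,1,1)] by auto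

lemma bracket_summand_zero: "g \<in> CC \<Longrightarrow> bracket_summand g k 0 = 0"
  using bracket_summand_linear_left(1)[OF _ CC_zero CC_zero, of g k] by simp

lemma total_bracket_CC: "f \<in> CC \<Longrightarrow> g \<in> CC \<Longrightarrow> total_bracket f g \<in> CC"
  unfolding total_bracket_def by (rule arity_sum_CC) (auto intro: bracket_summand_CC)

lemma total_bracket_linear_left:
  assumes "f \<in> CC" "f' \<in> CC" "g \<in> CC"
  shows "total_bracket (f + f') g = total_bracket f g + total_bracket f' g" "total_bracket (fscale c f) g = fscale c (total_bracket f g)"
  unfolding total_bracket_def
  by (rule arity_sum_linear(1)[where F = "bracket_summand g", OF _ _ bracket_summand_zero[OF assms(3)] assms(1,2)]
        arity_sum_linear(2)[where F = "bracket_summand g", OF _ _ bracket_summand_zero[OF assms(3)] assms(1,2)];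
      simp add: bracket_summand_linear_left(1) bracket_summand_scale C_CC assms)+

lemma total_bracket_linear_right:
  assumes "f \<in> CC" "g \<in> CC" "g' \<in> CC"
  shows "total_bracket f (g + g') = total_bracket f g + total_bracket f g'" "total_bracket f (fscale c g) = fscale c (total_bracket f g)"
  unfolding total_bracket_def arity_sum_fun_add[symmetric] arity_sum_fun_scale[symmetric]
  by (rule arity_sum_cong[OF assms(1)]; simp add: bracket_summand_linear_right(1) bracket_summand_scale C_CC assms)+

lemma total_bracket_zero: "g \<in> CC \<Longrightarrow> total_bracket 0 g = 0" "g \<in> CC \<Longrightarrow> total_bracket g 0 = 0"
  using total_bracket_linear_left(1)[OF CC_zero CC_zero, of g] total_bracket_linear_right(1)[OF _ CC_zero CC_zero, of g] by simp_all

lemma total_bracket_block: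
  assumes x: "cochain_block x" and y: "cochain_block y"
  shows "total_bracket (snd x) (snd y) = snd (block_bracket x y)"
proof -
  have C: "snd x \<in> C (Suc (fst x))" "snd y \<in> C (Suc (fst y))" "snd x \<in> CC" "snd y \<in> CC"
    using assms block_CC by (auto simp: cochain_block_def)
  have "total_bracket (snd x) (snd y) = bracket_summand (snd y) (Suc (fst x)) (snd x)"
    unfolding total_bracket_def by (rule arity_sum_C) (use C bracket_summand_zero in auto)
  also have "\<dots> = br (snd x) [snd y] - sg (fst x * fst y) (br (snd y) [snd x])"
    unfolding bracket_summand_def by (subst arity_sum_C[where n = "Suc (fst y)"]) (use C br_zero in auto)
  also have "\<dots> = snd (block_bracket x y)"
  proof -
    have "br (snd x) (map snd [y]) = ins [y] (snd x)" "br (snd y) (map snd [x]) = ins [x] (snd y)"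
      by (rule br_blocks; use assms in auto)+
    then show ?thesis by (simp add: block_bracket_def)
  qed
  finally show ?thesis .
qed

lemma dh_total_bracket:
  assumes f: "n \<noteq> 0" "f \<in> C n" and "g \<in> CC"
  shows "dh (total_bracket f g) = total_bracket (dh f) g + sg (n - 1) (total_bracket f (dh g))"
  using assms(3)
proof (induction g rule: CC_induct)
  case zero
  show ?case using C_CC[OF f] by (simp add: dh_zero total_bracket_zero dh_CC del: zero_fun_apply)
next
  case (add g g')
  then show ?case using C_CC[OF f]
    by (simp add: dh_linear total_bracket_linear_right total_bracket_CC dh_CC sg_add del: plus_fun_apply)
next
  case g: (homogeneous k g)
  note b = homogeneous_block[OF f] homogeneous_block[OF g]
  show ?case
    using block_d_block_bracket[OF b] total_bracket_block[OF b] dh_block[OF block_bracket_cochain[OF b]] dh_block[OF b(1)] dh_block[OF b(2)]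
      total_bracket_block[OF block_d_cochain[OF b(1)] b(2)] total_bracket_block[OF b(1) block_d_cochain[OF b(2)]] by simp
qed

abbreviation ZC where "ZC \<equiv> cocycles M dh"
abbreviation BC where "BC \<equiv> dh ` CC"
abbreviation cls where "cls \<equiv> cohomology_class M dh"
abbreviation HH where "HH \<equiv> cohomology M dh"

lemma ZC_iff: "f \<in> ZC \<longleftrightarrow> f \<in> CC \<and> dh f = 0"
  by (auto simp: cocycles_def simp del: zero_fun_apply)

lemma differential_M: "differential_module KR M dh"
proof (intro differential_module.intro differential_module_axioms.intro module_M)
  show "linear_on KR M dh" by (simp add: linear_on_M dh_CC dh_linear)
qed (simp add: dh_dh)

text \<open>
  The differential raises the arity by one, so the components of cocycles and boundaries are again
  cocycles and boundaries.
\<close>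

lemma component_dh: "f \<in> CC \<Longrightarrow> component (Suc n) (dh f) = dh (component n f)"
proof (induction f rule: CC_induct)
  case zero
  show ?case by (simp only: dh_zero component_zero)
next
  case (homogeneous k f)
  note b = homogeneous_block[OF homogeneous]
  have "dh f \<in> C (Suc k)"
    using block_d_cochain[OF b] dh_block[OF b] homogeneous(1) by (simp add: cochain_block_def block_d_def)
  then show ?case using homogeneous(2) dh_zero by (simp add: component_C del: zero_fun_apply)
next
  case (add f g)
  have c: "component n h \<in> CC" if "h \<in> CC" for h
  proof (cases n)
    case 0
    then have "component n h = 0" using that by (auto simp: CC_iff component_def fun_eq_iff)
    then show ?thesis by (simp only: CC_zero)
  next
    case (Suc k)
    then show ?thesis using CC_component[OF that, of n] C_CC by blast
  qed
  show ?case
    unfolding dh_linear(1)[OF add.hyps] component_add dh_linear(1)[OF c[OF add.hyps(1)] c[OF add.hyps(2)]] add.IH ..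
qed

lemma component_cocycle: "f \<in> ZC \<Longrightarrow> component n f \<in> ZC"
proof -
  assume f: "f \<in> ZC"
  have "component n f \<in> CC"
    using component_V[of f "int n"] f V_CC by (auto simp: ZC_iff)
  moreover have "dh (component n f) = 0"
    using component_dh[of f n] f by (simp add: ZC_iff del: zero_fun_apply)
  ultimately show "component n f \<in> ZC" by (simp only: ZC_iff)
qed

lemma component_boundary: "f \<in> BC \<Longrightarrow> component n f \<in> BC"
proof -
  assume "f \<in> BC"
  then obtain w where w: "w \<in> CC" "f = dh w" by blast
  show "component n f \<in> BC"
  proof (cases n)
    case 0
    have "component n f = 0"
      using 0 dh_CC[OF w(1)] w(2) by (auto simp: CC_iff component_def fun_eq_iff)
    then show ?thesis using dh_zero CC_zero by (metis imageI)
  next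
    case (Suc k)
    have "component k w \<in> CC" using component_V[OF w(1), of "int k"] V_CC by auto
    then show ?thesis using component_dh[OF w(1)] w(2) Suc by simp
  qed
qed

lemma ZC_induct [consumes 1, case_names zero homogeneous add]:
  assumes f: "f \<in> ZC" and zero: "P 0"
    and hom: "\<And>n f. n \<noteq> 0 \<Longrightarrow> f \<in> C n \<Longrightarrow> f \<in> ZC \<Longrightarrow> P f"
    and add: "\<And>f g. f \<in> ZC \<Longrightarrow> g \<in> ZC \<Longrightarrow> P f \<Longrightarrow> P g \<Longrightarrow> P (f + g)"
  shows "P f"
proof -
  have fC: "f \<in> CC" using f by (simp add: ZC_iff)
  have Z0: "0 \<in> ZC" unfolding ZC_iff by (intro conjI CC_zero dh_zero)
  have Zadd: "u + v \<in> ZC" if "u \<in> ZC" "v \<in> ZC" for u v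
    using that by (simp add: ZC_iff CC_add dh_linear del: plus_fun_apply zero_fun_apply)
  have "(\<Sum>n\<in>A. component n f) \<in> ZC \<and> P (\<Sum>n\<in>A. component n f)" if "finite A" "A \<subseteq> arity_set f" for A
    using that
  proof (induction A rule: finite_induct)
    case (insert n A)
    then have n0: "n \<noteq> 0" using CC_arity(1)[OF fC] by (cases n) auto
    have n: "component n f \<in> ZC" by (rule component_cocycle[OF f])
    have "P (component n f)" by (rule hom[OF n0 CC_component[OF fC n0] n])
    moreover have "(\<Sum>n\<in>A. component n f) \<in> ZC" "P (\<Sum>n\<in>A. component n f)" using insert by auto
    ultimately show ?case
      unfolding sum.insert[OF insert(1,2)] using n by (intro conjI Zadd add)
  qed (simp add: zero Z0)
  from this[of "arity_set f"] have "P (\<Sum>n\<in>arity_set f. component n f)"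
    using CC_arity(2)[OF fC] by simp
  moreover have "(\<Sum>n\<in>arity_set f. component n f) = f"
    by (rule CC_decompose[OF fC, unfolded arity_sum_def, symmetric])
  ultimately show ?thesis by simp
qed

lemma BC_add: "f \<in> BC \<Longrightarrow> g \<in> BC \<Longrightarrow> f + g \<in> BC"
  by (auto simp: dh_linear[symmetric] CC_add simp del: plus_fun_apply)

lemma BC_zero: "0 \<in> BC"
  using dh_zero CC_zero by (metis imageI)

lemma BC_sg: "f \<in> BC \<Longrightarrow> sg k f \<in> BC"
  by (auto simp: dh_sg[symmetric] CC_sg)

lemma BC_uminus: "f \<in> BC \<Longrightarrow> - f \<in> BC"
  using BC_sg[of f 1] by (simp add: sg_def)

text \<open>
  A product that satisfies the Leibniz rule up to a sign depending on the degree of the left factor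
  descends to cohomology.  The constant \<open>c\<close> accounts for the two conventions: the degree for the
  cup product, the shifted degree for the bracket.
\<close>

lemma leibniz_descends:
  assumes CC: "\<And>f g. f \<in> CC \<Longrightarrow> g \<in> CC \<Longrightarrow> p f g \<in> CC"
    and left: "\<And>f f' g. f \<in> CC \<Longrightarrow> f' \<in> CC \<Longrightarrow> g \<in> CC \<Longrightarrow> p (f + f') g = p f g + p f' g"
    and right: "\<And>f g g'. f \<in> CC \<Longrightarrow> g \<in> CC \<Longrightarrow> g' \<in> CC \<Longrightarrow> p f (g + g') = p f g + p f g'"
    and leibniz: "\<And>n f g. n \<noteq> 0 \<Longrightarrow> f \<in> C n \<Longrightarrow> g \<in> CC \<Longrightarrow> dh (p f g) = p (dh f) g + sg (n + c) (p f (dh g))"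
    and f: "f \<in> ZC" and g: "g \<in> ZC"
  shows "p f g \<in> ZC" and "w \<in> CC \<Longrightarrow> p f (dh w) \<in> BC" and "w \<in> CC \<Longrightarrow> p (dh w) g \<in> BC"
proof -
  have z: "p 0 h = 0" "p h 0 = 0" if "h \<in> CC" for h
    using left[OF CC_zero CC_zero that] right[OF that CC_zero CC_zero] by simp_all
  have gC: "g \<in> CC" "dh g = 0" using g by (simp_all add: ZC_iff)
  show "p f g \<in> ZC"
    using f
  proof (induction f rule: ZC_induct)
    case zero
    show ?case unfolding z(1)[OF gC(1)] ZC_iff by (intro conjI CC_zero dh_zero)
  next
    case (homogeneous n f)
    then have "dh (p f g) = 0"
      using leibniz[OF homogeneous(1,2) gC(1)] gC by (simp add: ZC_iff z del: zero_fun_apply)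
    then show ?case using homogeneous CC gC by (simp add: ZC_iff del: zero_fun_apply)
  next
    case (add f f')
    then show ?case
      using left gC CC by (simp add: ZC_iff CC_add dh_linear del: plus_fun_apply zero_fun_apply)
  qed
  show "p f (dh w) \<in> BC" if w: "w \<in> CC"
    using f
  proof (induction f rule: ZC_induct)
    case zero
    show ?case unfolding z(1)[OF dh_CC[OF w]] by (rule BC_zero)
  next
    case (homogeneous n f)
    have fC: "f \<in> CC" "dh f = 0" using homogeneous by (simp_all add: ZC_iff)
    have "p f (dh w) = sg (n + c) (dh (p f w))"
      unfolding leibniz[OF homogeneous(1,2) w] fC(2) z(1)[OF w] by (simp add: sg_sg) (simp add: sg_def)
    then show ?case using BC_sg CC[OF fC(1) w] by (metis imageI)
  next
    case (add f f')
    have "f \<in> CC" "f' \<in> CC" using add by (simp_all add: ZC_iff)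
    then show ?case unfolding left[OF \<open>f \<in> CC\<close> \<open>f' \<in> CC\<close> dh_CC[OF w]] by (intro BC_add add)
  qed
  show "p (dh w) g \<in> BC" if w: "w \<in> CC"
    using w
  proof (induction w rule: CC_induct)
    case zero
    show ?case unfolding dh_zero z(1)[OF gC(1)] by (rule BC_zero)
  next
    case (homogeneous n f)
    have "p (dh f) g = dh (p f g)"
      using leibniz[OF homogeneous gC(1)] gC z(2)[OF C_CC[OF homogeneous]] by simp
    then show ?case using CC[OF C_CC[OF homogeneous] gC(1)] by blast
  next
    case (add f f')
    show ?case unfolding dh_linear(1)[OF add.hyps] left[OF dh_CC[OF add.hyps(1)] dh_CC[OF add.hyps(2)] gC(1)]
      by (intro BC_add add)
  qed
qed

end

section \<open>The Gerstenhaber algebra on cohomology\<close>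

context bihom_associative_algebra
begin

sublocale coh: differential_module KR M dh
  by (rule differential_M)

abbreviation VH where "VH \<equiv> cohomology_grading M V dh"

lemma ZC_closed: "0 \<in> ZC" "f \<in> ZC \<Longrightarrow> g \<in> ZC \<Longrightarrow> f + g \<in> ZC" "f \<in> ZC \<Longrightarrow> - f \<in> ZC"
  "f \<in> ZC \<Longrightarrow> fscale c f \<in> ZC" "f \<in> ZC \<Longrightarrow> sg k f \<in> ZC" "f \<in> ZC \<Longrightarrow> f \<in> CC"
proof -
  show "0 \<in> ZC" unfolding ZC_iff by (intro conjI CC_zero dh_zero)
  show "f + g \<in> ZC" if "f \<in> ZC" "g \<in> ZC"
    using that by (simp add: ZC_iff CC_add dh_linear del: plus_fun_apply zero_fun_apply)
  show "fscale c f \<in> ZC" if "f \<in> ZC"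
    using that by (simp add: ZC_iff CC_scale dh_linear(2)[of f f] fscale_laws del: zero_fun_apply)
  show s: "sg k f \<in> ZC" if "f \<in> ZC" for k
    using that by (simp add: ZC_iff CC_sg dh_sg)
  show "- f \<in> ZC" if "f \<in> ZC" using s[OF that, of 1] by (simp add: sg_def)
  show "f \<in> ZC \<Longrightarrow> f \<in> CC" by (simp add: ZC_iff)
qed

lemma cls_eq_iff: "f \<in> ZC \<Longrightarrow> g \<in> ZC \<Longrightarrow> cls f = cls g \<longleftrightarrow> f - g \<in> BC"
  using coh.class_eq_iff[of f g] by (simp add: ZC_closed a_inv_M)

lemma HH_simps:
  "carrier HH = cls ` ZC" "\<zero>\<^bsub>HH\<^esub> = cls 0"
  "f \<in> ZC \<Longrightarrow> g \<in> ZC \<Longrightarrow> cls f \<oplus>\<^bsub>HH\<^esub> cls g = cls (f + g)"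
  "f \<in> ZC \<Longrightarrow> c \<odot>\<^bsub>HH\<^esub> cls f = cls (fscale c f)"
  "f \<in> ZC \<Longrightarrow> \<ominus>\<^bsub>HH\<^esub> cls f = cls (- f)"
  using coh.cohomology_simps coh.class_a_inv[of f] by (simp_all add: ZC_closed a_inv_M)

lemma signed_HH: "f \<in> ZC \<Longrightarrow> even k = even n \<Longrightarrow> signed HH k (cls f) = cls (sg n f)"
  by (simp add: coh.class_signed signed_M ZC_closed)

lemma finsum_HH:
  assumes "finite A" "\<And>i. i \<in> A \<Longrightarrow> F i \<in> ZC"
  shows "(\<Sum>i\<in>A. F i) \<in> ZC" "finsum HH (\<lambda>i. cls (F i)) A = cls (\<Sum>i\<in>A. F i)"
proof -
  have "finsum M F A = (\<Sum>i\<in>A. F i)"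
    by (rule finsum_M) (use assms ZC_closed(6) in auto)
  moreover have "finsum M F A \<in> ZC \<and> finsum HH (\<lambda>i. cls (F i)) A = cls (finsum M F A)"
    by (rule coh.class_finsum) (use assms in auto)
  ultimately show "(\<Sum>i\<in>A. F i) \<in> ZC" "finsum HH (\<lambda>i. cls (F i)) A = cls (\<Sum>i\<in>A. F i)"
    by simp_all
qed

lemma VH_iff: "x \<in> VH i \<longleftrightarrow> (\<exists>f. f \<in> ZC \<and> f \<in> V i \<and> x = cls f)"
  by (auto simp: cohomology_grading_def)

text \<open>
  The homogeneous components, indexed by the integer degrees of the grading.
\<close>

definition proj :: "int \<Rightarrow> 'a cochain \<Rightarrow> 'a cochain" where
  "proj i f = (if i \<ge> 1 then component (nat i) f else 0)"

lemma proj_add: "proj i (f + g) = proj i f + proj i g"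
  by (simp add: proj_def component_add)

lemma proj_zero: "proj i 0 = 0"
  by (simp add: proj_def del: zero_fun_apply)

lemma proj_V: "f \<in> V j \<Longrightarrow> proj i f = (if i = j then f else 0)"
proof (cases "j \<ge> 1")
  case True
  assume "f \<in> V j"
  then have "f \<in> C (nat j)" using True by (simp add: V_iff)
  then show ?thesis using True by (auto simp: proj_def component_C)
next
  case False
  assume "f \<in> V j"
  then have "f = 0" using False by (simp add: V_iff)
  then show ?thesis by (simp add: proj_def)
qed

lemma proj_ZC: "f \<in> ZC \<Longrightarrow> proj i f \<in> ZC" and proj_BC: "f \<in> BC \<Longrightarrow> proj i f \<in> BC"
  by (auto simp: proj_def component_cocycle component_boundary ZC_closed BC_zero)

lemma proj_in_V: "f \<in> CC \<Longrightarrow> proj i f \<in> V i"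
  using component_V[of f i] by (simp add: proj_def V_zero)

lemma proj_sum: "(\<Sum>j\<in>A. F j) \<in> CC \<Longrightarrow> finite A \<Longrightarrow> (\<And>j. j \<in> A \<Longrightarrow> F j \<in> V j) \<Longrightarrow>
    proj i (\<Sum>j\<in>A. F j) = (if i \<in> A then F i else 0)"
proof -
  assume A: "finite A" "\<And>j. j \<in> A \<Longrightarrow> F j \<in> V j"
  have "proj i (\<Sum>j\<in>A. F j) = (\<Sum>j\<in>A. proj i (F j))"
    using A(1) by (induction A rule: finite_induct) (simp_all add: proj_add proj_zero del: plus_fun_apply zero_fun_apply)
  also have "\<dots> = (\<Sum>j\<in>A. if i = j then F j else 0)"
    by (intro sum.cong refl) (simp add: proj_V A)
  finally show ?thesis using A(1) by simp
qed

lemma proj_decompose: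
  assumes "f \<in> CC"
  shows "finite {i. proj i f \<noteq> 0}" and "f = (\<Sum>i\<in>{i. proj i f \<noteq> 0}. proj i f)"
proof -
  have sub: "{i. proj i f \<noteq> 0} \<subseteq> int ` arity_set f"
  proof
    fix i assume "i \<in> {i. proj i f \<noteq> 0}"
    then have "i \<ge> 1" "component (nat i) f \<noteq> (\<lambda>_. 0)" by (auto simp: proj_def zero_fun_def split: if_splits)
    then show "i \<in> int ` arity_set f" using component_outside[of "nat i" f] by (intro image_eqI[of _ _ "nat i"]) auto
  qed
  have fin: "finite (int ` arity_set f)" using CC_arity(2)[OF assms] by simp
  show "finite {i. proj i f \<noteq> 0}" using finite_subset[OF sub fin] .
  have "(\<Sum>i\<in>{i. proj i f \<noteq> 0}. proj i f) = (\<Sum>i\<in>int ` arity_set f. proj i f)"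
    by (rule sum.mono_neutral_left[OF fin sub]) simp
  also have "\<dots> = (\<Sum>n\<in>arity_set f. proj (int n) f)"
    by (rule sum.reindex_cong[of int]) simp_all
  also have "\<dots> = (\<Sum>n\<in>arity_set f. component n f)"
  proof (rule sum.cong[OF refl])
    fix n assume "n \<in> arity_set f"
    then have "n \<noteq> 0" using CC_arity(1)[OF assms] by (cases n) auto
    then show "proj (int n) f = component n f" by (simp add: proj_def)
  qed
  also have "\<dots> = f" by (rule CC_decompose[OF assms, unfolded arity_sum_def, symmetric])
  finally show "f = (\<Sum>i\<in>{i. proj i f \<noteq> 0}. proj i f)" ..
qed

text \<open>
  The differential is homogeneous, so the decomposition of a cocycle into its components descends
  to classes.  It is unique because the components of a boundary are boundaries.
\<close>

lemma graded_HH: "graded_vector_space KR HH VH"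
proof (unfold graded_vector_space_def graded_vector_space_axioms_def, intro conjI allI impI)
  show "Module.module KR HH" by (rule coh.module_cohomology)
  show "Ring.field KR" by (rule field_from_type_algebra)
  interpret H: module KR HH by (rule coh.module_cohomology)
  show "submodule (VH i) KR HH" for i
  proof (rule H.submoduleI)
    show "VH i \<subseteq> carrier HH" by (auto simp: VH_iff HH_simps)
    show "\<zero>\<^bsub>HH\<^esub> \<in> VH i" using V_zero ZC_closed(1) by (auto simp: VH_iff HH_simps)
    show "\<ominus>\<^bsub>HH\<^esub> a \<in> VH i" if "a \<in> VH i" for a
    proof -
      obtain f where f: "f \<in> ZC" "f \<in> V i" "a = cls f" using \<open>a \<in> VH i\<close> by (auto simp: VH_iff)
      have "- f \<in> V i" using V_sg[OF f(2), of 1] by (simp add: sg_def)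
      then show ?thesis
        unfolding VH_iff using f by (intro exI[of _ "- f"]) (simp add: HH_simps ZC_closed(3))
    qed
    show "a \<oplus>\<^bsub>HH\<^esub> b \<in> VH i" if ab: "a \<in> VH i" "b \<in> VH i" for a b
    proof -
      obtain f g where "f \<in> ZC" "f \<in> V i" "a = cls f" "g \<in> ZC" "g \<in> V i" "b = cls g" using ab by (auto simp: VH_iff)
      then show ?thesis
        unfolding VH_iff by (intro exI[of _ "f + g"]) (simp add: HH_simps ZC_closed(2) V_add)
    qed
    show "c \<odot>\<^bsub>HH\<^esub> a \<in> VH i" if "a \<in> VH i" for c a
    proof -
      obtain f where f: "f \<in> ZC" "f \<in> V i" "a = cls f" using \<open>a \<in> VH i\<close> by (auto simp: VH_iff)
      have "fscale c f \<in> V i" using f(2) by (auto simp: V_iff C_scale fscale_laws split: if_splits)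
      then show ?thesis
        unfolding VH_iff using f by (intro exI[of _ "fscale c f"]) (simp add: HH_simps ZC_closed(4))
    qed
  qed
  fix x assume "x \<in> carrier HH"
  then obtain f where f: "f \<in> ZC" "x = cls f" by (auto simp: HH_simps)
  have fC: "f \<in> CC" using f ZC_closed by simp
  define c where "c i = cls (proj i f)" for i
  have zero: "cls g = \<zero>\<^bsub>HH\<^esub> \<longleftrightarrow> g \<in> BC" if "g \<in> ZC" for g
    using cls_eq_iff[OF that ZC_closed(1)] by (simp add: HH_simps)
  have sub: "{i. c i \<noteq> \<zero>\<^bsub>HH\<^esub>} \<subseteq> {i. proj i f \<noteq> 0}"
    by (auto simp: c_def HH_simps)
  have fin: "finite {i. c i \<noteq> \<zero>\<^bsub>HH\<^esub>}" by (rule finite_subset[OF sub proj_decompose(1)[OF fC]])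
  have xeq: "x = finsum HH c {i. c i \<noteq> \<zero>\<^bsub>HH\<^esub>}"
  proof -
    let ?A = "{i. proj i f \<noteq> 0}" and ?S = "{i. c i \<noteq> \<zero>\<^bsub>HH\<^esub>}"
    \<comment> \<open>the components missing in the sum over \<open>?S\<close> are nonzero but represent the zero class\<close>
    have diff: "f - (\<Sum>i\<in>?S. proj i f) = (\<Sum>i\<in>?A - ?S. proj i f)"
      using sum.subset_diff[OF sub proj_decompose(1)[OF fC], of "\<lambda>i. proj i f"] proj_decompose(2)[OF fC]
      by (simp add: diff_eq_eq)
    have "(\<Sum>i\<in>D. proj i f) \<in> BC" if "finite D" "D \<subseteq> ?A - ?S" for D
      using that
    proof (induction D rule: finite_induct)
      case empty
      then show ?case by (simp add: BC_zero del: zero_fun_apply)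
    next
      case (insert i D)
      have "proj i f \<in> BC" using insert zero[OF proj_ZC[OF f(1)]] by (auto simp: c_def)
      then show ?case unfolding sum.insert[OF insert(1,2)] using insert by (intro BC_add) auto
    qed
    from this[of "?A - ?S"] have "f - (\<Sum>i\<in>?S. proj i f) \<in> BC"
      unfolding diff using proj_decompose(1)[OF fC] by simp
    then show ?thesis
      unfolding c_def f(2) using finsum_HH[OF fin, of "\<lambda>i. proj i f"] proj_ZC[OF f(1)] cls_eq_iff[OF f(1)]
      by (simp add: c_def)
  qed
  show "\<exists>!c. (\<forall>i. c i \<in> VH i) \<and> finite {i. c i \<noteq> \<zero>\<^bsub>HH\<^esub>} \<and> x = (\<Oplus>\<^bsub>HH\<^esub>i\<in>{i. c i \<noteq> \<zero>\<^bsub>HH\<^esub>}. c i)"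
  proof (rule ex1I[of _ c])
    show "(\<forall>i. c i \<in> VH i) \<and> finite {i. c i \<noteq> \<zero>\<^bsub>HH\<^esub>} \<and> x = (\<Oplus>\<^bsub>HH\<^esub>i\<in>{i. c i \<noteq> \<zero>\<^bsub>HH\<^esub>}. c i)"
    proof (intro conjI allI)
      show "c i \<in> VH i" for i
        unfolding VH_iff c_def using proj_ZC[OF f(1)] proj_in_V[OF fC] by blast
    qed (rule fin, rule xeq)
  next
    fix c' assume c': "(\<forall>i. c' i \<in> VH i) \<and> finite {i. c' i \<noteq> \<zero>\<^bsub>HH\<^esub>} \<and> x = (\<Oplus>\<^bsub>HH\<^esub>i\<in>{i. c' i \<noteq> \<zero>\<^bsub>HH\<^esub>}. c' i)"
    then have "\<forall>i. \<exists>r. r \<in> ZC \<and> r \<in> V i \<and> c' i = cls r" by (simp add: VH_iff)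
    then obtain r where r: "r i \<in> ZC" "r i \<in> V i" "c' i = cls (r i)" for i by metis
    let ?S = "{i. c' i \<noteq> \<zero>\<^bsub>HH\<^esub>}"
    have S: "finite ?S" using c' by simp
    have sum: "(\<Sum>i\<in>?S. r i) \<in> ZC" "x = cls (\<Sum>i\<in>?S. r i)"
    proof -
      show "(\<Sum>i\<in>?S. r i) \<in> ZC" by (rule finsum_HH(1)[OF S]) (rule r(1))
      have cr: "c' = (\<lambda>i. cls (r i))" by (rule ext) (rule r(3))
      have "x = finsum HH c' ?S" using c' by simp
      moreover have "finsum HH c' ?S = finsum HH (\<lambda>i. cls (r i)) ?S"
        by (rule arg_cong[where f = "\<lambda>c. finsum HH c ?S", OF cr])
      moreover have "finsum HH (\<lambda>i. cls (r i)) ?S = cls (\<Sum>i\<in>?S. r i)"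
        by (rule finsum_HH(2)[OF S]) (rule r(1))
      ultimately show "x = cls (\<Sum>i\<in>?S. r i)" by (rule trans[OF trans])
    qed
    \<comment> \<open>uniqueness: the homogeneous components of this boundary are boundaries\<close>
    then have "f - (\<Sum>i\<in>?S. r i) \<in> BC" using f cls_eq_iff[OF f(1)] by simp
    then have b: "proj i f - proj i (\<Sum>i\<in>?S. r i) \<in> BC" for i
      using proj_BC[of "f - (\<Sum>i\<in>?S. r i)" i] proj_add[of i "f - (\<Sum>i\<in>?S. r i)" "\<Sum>i\<in>?S. r i"]
      by (simp add: add_diff_cancel_right)
    have ps: "proj i (\<Sum>i\<in>?S. r i) = (if i \<in> ?S then r i else 0)" for i
      by (rule proj_sum) (use sum ZC_closed S r in auto)
    have "c' i = c i" for i
    proof -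
      have "c i = cls (proj i (\<Sum>i\<in>?S. r i))"
        unfolding c_def using b cls_eq_iff[OF proj_ZC[OF f(1)] proj_ZC[OF sum(1)]] by simp
      then show ?thesis
        unfolding ps using r(3)[of i] by (cases "c' i = \<zero>\<^bsub>HH\<^esub>") (simp_all add: HH_simps(2))
    qed
    then show "c' = c" by (simp add: fun_eq_iff)
  qed
qed

definition representative :: "'a cochain set \<Rightarrow> 'a cochain" where
  "representative x = (SOME f. f \<in> ZC \<and> cls f = x)"

lemma representative: "x \<in> carrier HH \<Longrightarrow> representative x \<in> ZC \<and> cls (representative x) = x"
proof -
  assume "x \<in> carrier HH"
  then obtain f where "f \<in> ZC" "x = cls f" unfolding HH_simps(1) by (rule imageE)
  then have "f \<in> ZC \<and> cls f = x" by simp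
  then show ?thesis unfolding representative_def by (rule someI[where P = "\<lambda>f. f \<in> ZC \<and> cls f = x"])
qed

definition descend :: "('a cochain \<Rightarrow> 'a cochain \<Rightarrow> 'a cochain) \<Rightarrow> 'a cochain set \<Rightarrow> 'a cochain set \<Rightarrow> 'a cochain set" where
  "descend p x y = cls (p (representative x) (representative y))"

text \<open>
  Changing a factor by a boundary changes the product by a boundary.
\<close>

lemma descend_class:
  assumes left: "\<And>f f' g. f \<in> CC \<Longrightarrow> f' \<in> CC \<Longrightarrow> g \<in> CC \<Longrightarrow> p (f + f') g = p f g + p f' g"
    and right: "\<And>f g g'. f \<in> CC \<Longrightarrow> g \<in> CC \<Longrightarrow> g' \<in> CC \<Longrightarrow> p f (g + g') = p f g + p f g'"
    and Z: "\<And>f g. f \<in> ZC \<Longrightarrow> g \<in> ZC \<Longrightarrow> p f g \<in> ZC"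
    and B: "\<And>f w. f \<in> ZC \<Longrightarrow> w \<in> CC \<Longrightarrow> p f (dh w) \<in> BC" "\<And>g w. g \<in> ZC \<Longrightarrow> w \<in> CC \<Longrightarrow> p (dh w) g \<in> BC"
    and f: "f \<in> ZC" and g: "g \<in> ZC"
  shows "descend p (cls f) (cls g) = cls (p f g)"
proof -
  have "cls f \<in> carrier HH" "cls g \<in> carrier HH" using f g by (simp_all add: HH_simps)
  then have r: "representative (cls f) \<in> ZC" "representative (cls g) \<in> ZC" "cls (representative (cls f)) = cls f" "cls (representative (cls g)) = cls g"
    using representative by auto
  obtain w where w: "w \<in> CC" "representative (cls f) = f + dh w"
    using r(3) cls_eq_iff[OF r(1) f] by (auto simp: diff_eq_eq add.commute)
  obtain w' where w': "w' \<in> CC" "representative (cls g) = g + dh w'"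
    using r(4) cls_eq_iff[OF r(2) g] by (auto simp: diff_eq_eq add.commute)
  have "p (representative (cls f)) (representative (cls g)) = p f (representative (cls g)) + p (dh w) (representative (cls g))"
    unfolding w(2) by (rule left) (use ZC_closed f r w dh_CC in auto)
  also have "p f (representative (cls g)) = p f g + p f (dh w')"
    unfolding w'(2) by (rule right) (use ZC_closed f g w' dh_CC in auto)
  finally have "p (representative (cls f)) (representative (cls g)) - p f g = p f (dh w') + p (dh w) (representative (cls g))"
    by (simp add: algebra_simps del: plus_fun_apply)
  also have "\<dots> \<in> BC" by (intro BC_add B f r w w')
  finally show ?thesis
    unfolding descend_def by (subst cls_eq_iff) (use Z r f g in auto)
qed

lemma cup_leibniz: "n \<noteq> 0 \<Longrightarrow> f \<in> C n \<Longrightarrow> g \<in> CC \<Longrightarrow> dh (cup f g) = cup (dh f) g + sg (n + 0) (cup f (dh g))"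
  using dh_cup by simp

lemma total_bracket_leibniz: "n \<noteq> 0 \<Longrightarrow> f \<in> C n \<Longrightarrow> g \<in> CC \<Longrightarrow> dh (total_bracket f g) = total_bracket (dh f) g + sg (n + 1) (total_bracket f (dh g))"
  using dh_total_bracket[of n f g] by (simp add: sg_def)

lemma cup_descends:
  assumes "f \<in> ZC"
  shows "g \<in> ZC \<Longrightarrow> cup f g \<in> ZC" and "w \<in> CC \<Longrightarrow> cup f (dh w) \<in> BC" and "w \<in> CC \<Longrightarrow> cup (dh w) f \<in> BC"
proof -
  note * = leibniz_descends[where p = cup and c = 0, OF cup_CC cup_linear_left(1) cup_linear_right(1) cup_leibniz]
  show "g \<in> ZC \<Longrightarrow> cup f g \<in> ZC" by (rule *(1)) (assumption | rule assms)+
  show "w \<in> CC \<Longrightarrow> cup f (dh w) \<in> BC" by (rule *(2)) (assumption | rule assms)+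
  show "w \<in> CC \<Longrightarrow> cup (dh w) f \<in> BC" by (rule *(3)) (assumption | rule assms)+
qed

lemma cup_class: "f \<in> ZC \<Longrightarrow> g \<in> ZC \<Longrightarrow> descend cup (cls f) (cls g) = cls (cup f g)"
  by (rule descend_class[where p = cup]) (assumption | rule cup_linear_left(1) cup_linear_right(1) cup_descends)+

lemma total_bracket_descends:
  assumes "f \<in> ZC"
  shows "g \<in> ZC \<Longrightarrow> total_bracket f g \<in> ZC" and "w \<in> CC \<Longrightarrow> total_bracket f (dh w) \<in> BC" and "w \<in> CC \<Longrightarrow> total_bracket (dh w) f \<in> BC"
proof -
  note * = leibniz_descends[where p = total_bracket and c = 1, OF total_bracket_CC total_bracket_linear_left(1) total_bracket_linear_right(1) total_bracket_leibniz]
  show "g \<in> ZC \<Longrightarrow> total_bracket f g \<in> ZC" by (rule *(1)) (assumption | rule assms)+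
  show "w \<in> CC \<Longrightarrow> total_bracket f (dh w) \<in> BC" by (rule *(2)) (assumption | rule assms)+
  show "w \<in> CC \<Longrightarrow> total_bracket (dh w) f \<in> BC" by (rule *(3)) (assumption | rule assms)+
qed

lemma total_bracket_class: "f \<in> ZC \<Longrightarrow> g \<in> ZC \<Longrightarrow> descend total_bracket (cls f) (cls g) = cls (total_bracket f g)"
  by (rule descend_class[where p = total_bracket]) (assumption | rule total_bracket_linear_left(1) total_bracket_linear_right(1) total_bracket_descends)+

lemma bilinear_on_HH:
  assumes cl: "\<And>f g. f \<in> ZC \<Longrightarrow> g \<in> ZC \<Longrightarrow> descend p (cls f) (cls g) = cls (p f g)"
    and Z: "\<And>f g. f \<in> ZC \<Longrightarrow> g \<in> ZC \<Longrightarrow> p f g \<in> ZC"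
    and left: "\<And>f f' g. f \<in> CC \<Longrightarrow> f' \<in> CC \<Longrightarrow> g \<in> CC \<Longrightarrow> p (f + f') g = p f g + p f' g"
      "\<And>c f g. f \<in> CC \<Longrightarrow> g \<in> CC \<Longrightarrow> p (fscale c f) g = fscale c (p f g)"
    and right: "\<And>f g g'. f \<in> CC \<Longrightarrow> g \<in> CC \<Longrightarrow> g' \<in> CC \<Longrightarrow> p f (g + g') = p f g + p f g'"
      "\<And>c f g. f \<in> CC \<Longrightarrow> g \<in> CC \<Longrightarrow> p f (fscale c g) = fscale c (p f g)"
  shows "bilinear_on KR HH (descend p)"
  unfolding bilinear_on_def linear_on_def HH_simps(1)
  using ZC_closed by (auto simp: HH_simps cl Z left right simp del: plus_fun_apply)

lemma ZV_block:
  assumes "f \<in> shifted V a" "f \<in> ZC"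
  obtains h where "cochain_block h" "snd h = f" "even (fst h) = even a" "snd (block_d h) = 0"
proof -
  obtain h where h: "cochain_block h" "snd h = f" "even (fst h) = even a" using shifted_block[OF assms(1)] .
  moreover have "snd (block_d h) = 0" using dh_block[OF h(1)] h(2) assms(2) by (simp add: ZC_iff)
  ultimately show ?thesis by (rule that)
qed

text \<open>
  By the homotopy formula with one entry, $x \cdot y$ and $\pm\, y \cdot x$ differ by the boundary of
  $\pm\, x \circ y$.
\<close>

lemma cup_comm:
  assumes f: "f \<in> shifted V a" "f \<in> ZC" and g: "g \<in> shifted V b" "g \<in> ZC" and n: "even n = even ((a + 1) * (b + 1))"
  shows "cup f g - sg n (cup g f) \<in> BC"
proof -
  obtain x where x: "cochain_block x" "snd x = f" "even (fst x) = even a" "snd (block_d x) = 0" using ZV_block[OF f] .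
  obtain y where y: "cochain_block y" "snd y = g" "even (fst y) = even b" "snd (block_d y) = 0" using ZV_block[OF g] .
  have z: "ins [block_d y] (snd x) = 0"
    using ins_block_zero[OF cochain_blockD(2)[OF x(1)], of "[]" "fst (block_d y)" "[]"] y(4) by (metis append_Nil prod.collapse)
  have O: "cochain_block (block_brace x [y])" by (rule block_brace_cochain) (use x y in auto)
  have "snd (block_d (block_brace x [y])) = sg (Suc (fst x) * fst y) (snd (block_cup y x)) + sg (fst x) (snd (block_cup x y))"
    using block_d_circ[OF x(1) y(1)] by (simp add: x(4) z ins_zero_fun)
  then have "cup f g - sg n (cup g f) = sg (fst x) (dh (snd (block_brace x [y])))"
    using cup_block[OF x(1) y(1)] cup_block[OF y(1) x(1)] dh_block[OF O] x(2,3) y(2,3) n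
    by (cases "even a"; cases "even b") (simp_all add: sg_def)
  then show ?thesis using block_CC[OF O] by (simp add: BC_sg)
qed

lemma total_bracket_shifted:
  assumes "f \<in> shifted V a" "g \<in> shifted V b"
  shows "hoch_bracket scale \<alpha> \<beta> a b f g = total_bracket f g"
proof -
  obtain x where x: "cochain_block x" "snd x = f" "even (fst x) = even a" using shifted_block[OF assms(1)] .
  obtain y where y: "cochain_block y" "snd y = g" "even (fst y) = even b" using shifted_block[OF assms(2)] .
  have b: "br (snd x) (map snd [y]) = ins [y] (snd x)" "br (snd y) (map snd [x]) = ins [x] (snd y)"
    by (rule br_blocks; use x y in auto)+
  have "br g [f] \<in> CC" using block_CC[OF x(1)] block_CC[OF y(1)] x(2) y(2) by (simp add: hoch_brace_CC)
  then have "hoch_bracket scale \<alpha> \<beta> a b f g = br f [g] - sg (fst x * fst y) (br g [f])"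
    unfolding hoch_bracket_def Let_def using x(3) y(3)
    by (simp add: signed_M[of _ "a * b" "fst x * fst y"] a_minus_M CC_sg)
  then show ?thesis using total_bracket_block[OF x(1) y(1)] b x(2) y(2) by (simp add: block_bracket_def)
qed

lemma cup_scale: "f \<in> CC \<Longrightarrow> g \<in> CC \<Longrightarrow> cup (fscale c f) g = fscale c (cup f g)"
    "f \<in> CC \<Longrightarrow> g \<in> CC \<Longrightarrow> cup f (fscale c g) = fscale c (cup f g)"
  using cup_linear_left(2) cup_linear_right(2) by blast+

lemma total_bracket_scale: "f \<in> CC \<Longrightarrow> g \<in> CC \<Longrightarrow> total_bracket (fscale c f) g = fscale c (total_bracket f g)"
    "f \<in> CC \<Longrightarrow> g \<in> CC \<Longrightarrow> total_bracket f (fscale c g) = fscale c (total_bracket f g)"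
  using total_bracket_linear_left(2) total_bracket_linear_right(2) by blast+

text \<open>
  Every identity is checked on representing cocycles.  On these, associativity, antisymmetry and the
  Jacobi identity hold strictly, while graded commutativity and the derivation rule hold up to a
  boundary.
\<close>

theorem gerstenhaber_algebra_cohomology:
  "gerstenhaber_algebra KR HH VH (descend cup) (descend total_bracket)"
proof (unfold gerstenhaber_algebra_def gerstenhaber_algebra_axioms_def, intro conjI allI impI)
  show "graded_vector_space KR HH VH" by (rule graded_HH)
  show "bilinear_on KR HH (descend cup)"
    by (rule bilinear_on_HH[where p = cup])
      (assumption | rule cup_class cup_descends(1) cup_linear_left(1) cup_scale cup_linear_right(1))+
  show "bilinear_on KR HH (descend total_bracket)"
    by (rule bilinear_on_HH[where p = total_bracket])
      (assumption | rule total_bracket_class total_bracket_descends(1) total_bracket_linear_left(1) total_bracket_scale total_bracket_linear_right(1))+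
  note Z = cup_descends(1) total_bracket_descends(1)
  show "descend cup x y \<in> VH (i + j)" if xy: "x \<in> VH i" "y \<in> VH j" for x i y j
  proof -
    obtain f g where f: "f \<in> ZC" "f \<in> V i" "x = cls f" and g: "g \<in> ZC" "g \<in> V j" "y = cls g"
      using xy unfolding VH_iff by blast
    then show ?thesis
      unfolding VH_iff by (intro exI[of _ "cup f g"]) (simp add: cup_class Z cup_degree)
  qed
  show "descend cup (descend cup x y) z = descend cup x (descend cup y z)"
    if xyz: "x \<in> carrier HH" "y \<in> carrier HH" "z \<in> carrier HH" for x y z
  proof -
    obtain f g h where "f \<in> ZC" "x = cls f" "g \<in> ZC" "y = cls g" "h \<in> ZC" "z = cls h"
      using xyz unfolding HH_simps(1) by blast
    then show ?thesis by (simp add: cup_class Z cup_assoc ZC_closed)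
  qed
  show "descend cup x y = signed HH (i * j) (descend cup y x)" if xy: "x \<in> VH i" "y \<in> VH j" for x i y j
  proof -
    obtain f g where f: "f \<in> ZC" "f \<in> V i" "x = cls f" and g: "g \<in> ZC" "g \<in> V j" "y = cls g"
      using xy unfolding VH_iff by blast
    \<comment> \<open>only the parity of the exponent matters, and \<open>i * j\<close> may be negative\<close>
    define n where "n = nat (i * j mod 2)"
    have n: "even n = even (i * j)" by (simp add: n_def even_nat_iff)
    have "cup f g - sg n (cup g f) \<in> BC"
      by (rule cup_comm[of f "i - 1" g "j - 1"]) (use f g n in \<open>auto simp: shifted_def\<close>)
    then have "cls (cup f g) = cls (sg n (cup g f))"
      using cls_eq_iff[OF Z(1)[OF f(1) g(1)] ZC_closed(5)[OF Z(1)[OF g(1) f(1)]]] by simp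
    then show ?thesis
      using f g signed_HH[OF Z(1)[OF g(1) f(1)] n[symmetric]] by (simp add: cup_class)
  qed
  have shifted: "\<exists>f. f \<in> ZC \<and> f \<in> shifted V a \<and> x = cls f" if "x \<in> shifted VH a" for x a
    using that unfolding VH_iff shifted_def by blast
  show "descend total_bracket x y \<in> VH (i + j - 1)" if xy: "x \<in> VH i" "y \<in> VH j" for x i y j
  proof -
    obtain f g where f: "f \<in> ZC" "f \<in> V i" "x = cls f" and g: "g \<in> ZC" "g \<in> V j" "y = cls g"
      using xy unfolding VH_iff by blast
    have s: "f \<in> shifted V (i - 1)" "g \<in> shifted V (j - 1)" using f g by (simp_all add: shifted_def)
    have d: "br f [g] \<in> V (i + j - 1)" "br g [f] \<in> V (i + j - 1)"
      using br_degree[OF s(1), of "[j - 1]" "[g]"] br_degree[OF s(2), of "[i - 1]" "[f]"] s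
      by (simp_all add: shifted_list_def shifted_def algebra_simps)
    have "total_bracket f g = br f [g] \<ominus>\<^bsub>M\<^esub> signed M ((i - 1) * (j - 1)) (br g [f])"
      using total_bracket_shifted[OF s] by (simp add: hoch_bracket_def Let_def)
    also have "\<dots> = br f [g] - sg (nat ((i - 1) * (j - 1) mod 2)) (br g [f])"
      using V_CC[OF d(2)] by (subst signed_M[where n = "nat ((i - 1) * (j - 1) mod 2)"])
        (auto simp: even_nat_iff a_minus_M CC_sg)
    also have "\<dots> \<in> V (i + j - 1)" by (intro V_diff V_sg d)
    finally show ?thesis
      using f g unfolding VH_iff by (intro exI[of _ "total_bracket f g"]) (simp add: total_bracket_class Z)
  qed
  show "descend total_bracket x y = \<ominus>\<^bsub>HH\<^esub> signed HH (a * b) (descend total_bracket y x)" if xy: "x \<in> shifted VH a" "y \<in> shifted VH b" for x a y b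
  proof -
    obtain f where f: "f \<in> ZC" "f \<in> shifted V a" "x = cls f" using shifted xy by blast
    obtain g where g: "g \<in> ZC" "g \<in> shifted V b" "y = cls g" using shifted xy by blast
    obtain u where u: "cochain_block u" "snd u = f" "even (fst u) = even a" using shifted_block[OF f(2)] .
    obtain v where v: "cochain_block v" "snd v = g" "even (fst v) = even b" using shifted_block[OF g(2)] .
    have "total_bracket f g = - sg (fst u * fst v) (total_bracket g f)"
      using total_bracket_block[OF u(1) v(1)] total_bracket_block[OF v(1) u(1)] u(2) v(2) by (simp add: block_bracket_def sg_diff sg_sg mult.commute) (simp add: sg_def)
    then show ?thesis
      using f g u(3) v(3) signed_HH[OF Z(2)[OF g(1) f(1)], of "a * b" "fst u * fst v"]
      by (simp add: total_bracket_class HH_simps ZC_closed Z)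
  qed
  show "descend total_bracket x (descend total_bracket y z) = descend total_bracket (descend total_bracket x y) z \<oplus>\<^bsub>HH\<^esub> signed HH (a * b) (descend total_bracket y (descend total_bracket x z))"
    if xyz: "x \<in> shifted VH a" "y \<in> shifted VH b" "z \<in> shifted VH c" for x a y b z c
  proof -
    obtain f where f: "f \<in> ZC" "f \<in> shifted V a" "x = cls f" using shifted xyz by blast
    obtain g where g: "g \<in> ZC" "g \<in> shifted V b" "y = cls g" using shifted xyz by blast
    obtain h where h: "h \<in> ZC" "h \<in> shifted V c" "z = cls h" using shifted xyz by blast
    obtain u where u: "cochain_block u" "snd u = f" "even (fst u) = even a" using shifted_block[OF f(2)] .
    obtain v where v: "cochain_block v" "snd v = g" "even (fst v) = even b" using shifted_block[OF g(2)] .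
    obtain w where w: "cochain_block w" "snd w = h" "even (fst w) = even c" using shifted_block[OF h(2)] .
    have "total_bracket f (total_bracket g h) = total_bracket (total_bracket f g) h + sg (fst u * fst v) (total_bracket g (total_bracket f h))"
      using block_bracket_jacobi[OF u(1) v(1) w(1)] total_bracket_block[OF u(1) v(1)] total_bracket_block[OF v(1) w(1)] total_bracket_block[OF u(1) w(1)]
        total_bracket_block[OF u(1) block_bracket_cochain[OF v(1) w(1)]] total_bracket_block[OF block_bracket_cochain[OF u(1) v(1)] w(1)]
        total_bracket_block[OF v(1) block_bracket_cochain[OF u(1) w(1)]] u(2) v(2) w(2) by simp
    then show ?thesis
      using f g h u(3) v(3) signed_HH[OF Z(2)[OF g(1) Z(2)[OF f(1) h(1)]], of "a * b" "fst u * fst v"]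
      by (simp add: total_bracket_class HH_simps ZC_closed Z)
  qed
  show "descend total_bracket x (descend cup y z) = descend cup (descend total_bracket x y) z \<oplus>\<^bsub>HH\<^esub> signed HH (a * (b + 1)) (descend cup y (descend total_bracket x z))"
    if xyz: "x \<in> shifted VH a" "y \<in> shifted VH b" "z \<in> shifted VH c" for x a y b z c
  proof -
    obtain f where f: "f \<in> ZC" "f \<in> shifted V a" "x = cls f" using shifted xyz by blast
    obtain g where g: "g \<in> ZC" "g \<in> shifted V b" "y = cls g" using shifted xyz by blast
    obtain h where h: "h \<in> ZC" "h \<in> shifted V c" "z = cls h" using shifted xyz by blast
    obtain u where u: "cochain_block u" "snd u = f" "even (fst u) = even a" "snd (block_d u) = 0" using ZV_block[OF f(2,1)] .
    obtain v where v: "cochain_block v" "snd v = g" "even (fst v) = even b" "snd (block_d v) = 0" using ZV_block[OF g(2,1)] .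
    obtain w where w: "cochain_block w" "snd w = h" "even (fst w) = even c" "snd (block_d w) = 0" using ZV_block[OF h(2,1)] .
    let ?k = "fst u * Suc (fst v)"
    have O: "cochain_block (block_brace u [v, w])" by (rule block_brace_cochain) (use u v w in auto)
    have "total_bracket f (cup g h) - (cup (total_bracket f g) h + sg ?k (cup g (total_bracket f h))) = - sg (fst u + fst v) (dh (snd (block_brace u [v, w])))"
      using block_bracket_leibniz[OF u(1) v(1) w(1) u(4) v(4) w(4)] total_bracket_block[OF u(1) v(1)] cup_block[OF v(1) w(1)] total_bracket_block[OF u(1) w(1)]
        total_bracket_block[OF u(1) block_cup_cochain[OF v(1) w(1)]] cup_block[OF block_bracket_cochain[OF u(1) v(1)] w(1)]
        cup_block[OF v(1) block_bracket_cochain[OF u(1) w(1)]] dh_block[OF O] u(2) v(2) w(2) by simp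
    also have "\<dots> \<in> BC" using block_CC[OF O] by (intro BC_uminus BC_sg) blast
    finally have "cls (total_bracket f (cup g h)) = cls (cup (total_bracket f g) h + sg ?k (cup g (total_bracket f h)))"
      by (subst cls_eq_iff) (use f g h in \<open>auto intro!: ZC_closed(2,5) Z\<close>)
    moreover have "even (a * (b + 1)) = even ?k" using u(3) v(3) by auto
    ultimately show ?thesis
      using f g h signed_HH[OF Z(1)[OF g(1) Z(2)[OF f(1) h(1)]], of "a * (b + 1)" ?k]
      by (simp add: total_bracket_class cup_class HH_simps ZC_closed Z del: plus_fun_apply)
  qed
qed

end

theorem theorem4p3:
  fixes scale :: "'k::field_char_0 \<Rightarrow> 'a::ab_group_add \<Rightarrow> 'a"
    and \<mu> :: "'a \<Rightarrow> 'a \<Rightarrow> 'a" and \<alpha> \<beta> :: "'a \<Rightarrow> 'a"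
  assumes "bihom_associative_algebra scale \<mu> \<alpha> \<beta>"
  shows "homotopy_G_algebra (ring_of_type_algebra :: 'k ring)
           (hoch_complex scale \<alpha> \<beta>) (hoch_degree scale \<alpha> \<beta>)
           (hoch_brace scale \<alpha> \<beta>) (hoch_cup scale \<mu> \<alpha> \<beta>) (hoch_d scale \<mu> \<alpha> \<beta>) \<and>
         (\<exists>prd brk.
           gerstenhaber_algebra (ring_of_type_algebra :: 'k ring)
             (hoch_cohomology scale \<mu> \<alpha> \<beta>) (hoch_cohomology_degree scale \<mu> \<alpha> \<beta>) prd brk \<and>
           (\<forall>f\<in>hoch_cocycles scale \<mu> \<alpha> \<beta>. \<forall>g\<in>hoch_cocycles scale \<mu> \<alpha> \<beta>.
             prd (hoch_class scale \<mu> \<alpha> \<beta> f) (hoch_class scale \<mu> \<alpha> \<beta> g) =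
               hoch_class scale \<mu> \<alpha> \<beta> (hoch_cup scale \<mu> \<alpha> \<beta> f g)) \<and>
           (\<forall>a b. \<forall>f \<in> hoch_cocycles scale \<mu> \<alpha> \<beta> \<inter> shifted (hoch_degree scale \<alpha> \<beta>) a.
             \<forall>g \<in> hoch_cocycles scale \<mu> \<alpha> \<beta> \<inter> shifted (hoch_degree scale \<alpha> \<beta>) b.
             brk (hoch_class scale \<mu> \<alpha> \<beta> f) (hoch_class scale \<mu> \<alpha> \<beta> g) =
               hoch_class scale \<mu> \<alpha> \<beta> (hoch_bracket scale \<alpha> \<beta> a b f g)))"
proof -
  interpret bihom_associative_algebra scale \<mu> \<alpha> \<beta> by (rule assms)
  show ?thesis
    unfolding cohomology_cong[OF delta_dh_cohomology] delta_dh_cohomology(2)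
  proof (rule conjI, goal_cases)
    case 1
    show ?case by (rule homotopy_G_algebra_hochschild)
  next
    case 2
    show ?case
      by (rule exI[of _ "descend cup"], rule exI[of _ "descend total_bracket"])
        (simp add: gerstenhaber_algebra_cohomology cup_class total_bracket_class total_bracket_shifted)
  qed
qed

end
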